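(* Let $d\in\mathbb{N}$, $d>2$, and let $\mathfrak{F}$ denote a sample from the wired uniform spanning forest $\mathsf{WSF}$ on $\mathbb{Z}^d$ (nearest-neighbor graph, all edge conductances equal to $1$). Let $\mathfrak{F}(\mathbf 0)$ denote the connected component of $\mathbf 0$ in $\mathfrak{F}$. Then $\mathfrak{F}(\mathbf 0)$ a.s. has one end, and therefore $\mathfrak{F}(\mathbf 0)\backslash\{\mathbf 0\}$ has just one infinite connected component a.s. Moreover, if $Q$ denotes the union of the finite connected components of $\mathfrak{F}(\mathbf 0)\backslash\{\mathbf 0\}$, then for all $t>0$, $$\mathbf{P}\bigl[\operatorname{diam}(Q)>t\bigr]\le C_d\,t^{-\beta_d},$$ where $\beta_d:=\frac12-\frac1d$ and $C_d$ is some constant depending only on $d$. Here $\operatorname{diam}$ means the Euclidean diameter.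
   Context: For a finite connected graph, the uniform spanning tree is a uniformly chosen spanning tree. Let an infinite connected graph $G$ be exhausted by finite connected subgraphs $G_0\subset G_1\subset\cdots$ with $\bigcup_n G_n=G$, and let $G_n^*$ be the graph obtained from $G$ by identifying all vertices outside $G_n$ to a single vertex and dropping the resulting loops (multiple edges are kept). The wired uniform spanning forest $\mathsf{WSF}$ on $G$ is the weak limit, as $n\to\infty$, of the laws of the uniform spanning trees of $G_n^*$ (regarded as random sets of edges); the limit exists and does not depend on the exhaustion. It is supported on spanning forests (cycle-free subgraphs containing all vertices) of $G$ all of whose trees are infinite. The ends of a tree are the equivalence classes of infinite simple paths in it, two paths being equivalent if their symmetric difference is finite. For a graph $H$ and a set $K$ of vertices, $H\backslash K$ is $H$ with the vertices of $K$ and all edges incident to them removed. *)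

theory Defs
  imports "HOL-Probability.Probability"
begin

section \<open>Undirected multigraphs\<close>

text \<open>
  Every edge \<open>e\<close> carries its set of endpoints, which has one element exactly when \<open>e\<close> is a loop.
  Parallel edges are distinct edges with the same endpoints. Since identifying vertices changes
  only the endpoints, the edges of a contracted graph are literally edges of the original one.
\<close>

record ('v, 'e) multigraph =
  verts :: "'v set"
  edges :: "'e set"
  endpoints :: "'e \<Rightarrow> 'v set"

definition adjacent :: "('v, 'e) multigraph \<Rightarrow> 'v \<Rightarrow> 'v \<Rightarrow> bool" where
  "adjacent G u v \<longleftrightarrow> (\<exists>e\<in>edges G. endpoints G e = {u, v})"

definition reachable :: "('v, 'e) multigraph \<Rightarrow> 'v \<Rightarrow> 'v \<Rightarrow> bool" where
  "reachable G = (adjacent G)\<^sup>*\<^sup>*"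

definition connected_graph :: "('v, 'e) multigraph \<Rightarrow> bool" where
  "connected_graph G \<longleftrightarrow> verts G \<noteq> {} \<and> (\<forall>u\<in>verts G. \<forall>v\<in>verts G. reachable G u v)"

text \<open>A cycle of length 1 is a loop, a cycle of length 2 is a pair of parallel edges.\<close>

definition is_cycle :: "('v, 'e) multigraph \<Rightarrow> 'v list \<Rightarrow> 'e list \<Rightarrow> bool" where
  "is_cycle G vs es \<longleftrightarrow>
     vs \<noteq> [] \<and> length es = length vs \<and> distinct vs \<and> distinct es \<and>
     set vs \<subseteq> verts G \<and> set es \<subseteq> edges G \<and>
     (\<forall>i<length vs. endpoints G (es ! i) = {vs ! i, vs ! (Suc i mod length vs)})"

definition subgraph :: "('v, 'e) multigraph \<Rightarrow> ('v, 'e) multigraph \<Rightarrow> bool" where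
  "subgraph H G \<longleftrightarrow>
     verts H \<subseteq> verts G \<and> edges H \<subseteq> edges G \<and>
     (\<forall>e\<in>edges H. endpoints H e = endpoints G e \<and> endpoints H e \<subseteq> verts H)"

text \<open>A spanning tree contains all vertices, so it is identified with its set of edges.\<close>

definition spanning_trees :: "('v, 'e) multigraph \<Rightarrow> 'e set set" where
  "spanning_trees G =
     {T. T \<subseteq> edges G \<and> connected_graph (G\<lparr>edges := T\<rparr>) \<and> (\<nexists>vs es. is_cycle (G\<lparr>edges := T\<rparr>) vs es)}"

definition cluster :: "('v, 'e) multigraph \<Rightarrow> 'v \<Rightarrow> ('v, 'e) multigraph" where
  "cluster G v = (let C = {u \<in> verts G. reachable G v u} in
     G\<lparr>verts := C, edges := {e \<in> edges G. endpoints G e \<subseteq> C}\<rparr>)"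

definition components_verts :: "('v, 'e) multigraph \<Rightarrow> 'v set set" where
  "components_verts G = (\<lambda>v. verts (cluster G v)) ` verts G"

definition remove_verts :: "('v, 'e) multigraph \<Rightarrow> 'v set \<Rightarrow> ('v, 'e) multigraph" where
  "remove_verts G K =
     G\<lparr>verts := verts G - K, edges := {e \<in> edges G. endpoints G e \<inter> K = {}}\<rparr>"


section \<open>Ends of a tree\<close>

definition rays :: "('v, 'e) multigraph \<Rightarrow> (nat \<Rightarrow> 'v) set" where
  "rays T = {p. inj p \<and> range p \<subseteq> verts T \<and> (\<forall>n. adjacent T (p n) (p (Suc n)))}"

definition tree_ends :: "('v, 'e) multigraph \<Rightarrow> (nat \<Rightarrow> 'v) set set" where
  "tree_ends T =
     rays T // {(p, q). p \<in> rays T \<and> q \<in> rays T \<and>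
                        finite ((range p - range q) \<union> (range q - range p))}"


section \<open>Random sets of edges\<close>

text \<open>The topology on the power set of \<open>E\<close> is that of \<open>{0, 1}\<^sup>E\<close>, sets being identified with
  their indicator functions.\<close>

definition edge_set_topology :: "'e set \<Rightarrow> 'e set topology" where
  "edge_set_topology E =
     pullback_topology (Pow E) (\<lambda>F. \<lambda>e\<in>E. e \<in> F) (product_topology (\<lambda>_. discrete_topology UNIV) E)"

definition borel_sets_of :: "'a topology \<Rightarrow> 'a measure" where
  "borel_sets_of X = sigma (topspace X) {U. openin X U}"

definition weakly_converges :: "'a topology \<Rightarrow> (nat \<Rightarrow> 'a measure) \<Rightarrow> 'a measure \<Rightarrow> bool" where
  "weakly_converges X \<mu> M \<longleftrightarrow>
     (\<forall>f::'a \<Rightarrow> real. continuous_map X euclideanreal f \<and> bounded (f ` topspace X) \<longrightarrow>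
        (\<lambda>n. integral\<^sup>L (\<mu> n) f) \<longlonglongrightarrow> integral\<^sup>L M f)"

text \<open>The law, on sets of edges from \<open>E\<close>, of the uniform spanning tree of a finite connected graph \<open>H\<close>
  with \<open>edges H \<subseteq> E\<close>.\<close>

definition ust :: "'e set \<Rightarrow> ('v, 'e) multigraph \<Rightarrow> 'e set measure" where
  "ust E H = distr (uniform_count_measure (spanning_trees H)) (borel_sets_of (edge_set_topology E)) (\<lambda>T. T)"


section \<open>The wired uniform spanning forest\<close>

definition exhaustion :: "('v, 'e) multigraph \<Rightarrow> (nat \<Rightarrow> ('v, 'e) multigraph) \<Rightarrow> bool" where
  "exhaustion G Gs \<longleftrightarrow>
     (\<forall>n. subgraph (Gs n) G \<and> finite (verts (Gs n)) \<and> finite (edges (Gs n)) \<and> connected_graph (Gs n)) \<and>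
     (\<forall>n. subgraph (Gs n) (Gs (Suc n))) \<and>
     (\<Union>n. verts (Gs n)) = verts G \<and> (\<Union>n. edges (Gs n)) = edges G"

text \<open>All vertices outside \<open>K\<close> are identified to the vertex \<open>None\<close>; loops are dropped.\<close>

definition wired :: "('v, 'e) multigraph \<Rightarrow> 'v set \<Rightarrow> ('v option, 'e) multigraph" where
  "wired G K = (let q = (\<lambda>v. if v \<in> K then Some v else None) in
     \<lparr>verts = insert None (Some ` K),
      edges = {e \<in> edges G. card (q ` endpoints G e) \<noteq> 1},
      endpoints = (\<lambda>e. q ` endpoints G e)\<rparr>)"

text \<open>\<open>M\<close> is the law of the wired uniform spanning forest of the infinite, connected, locally finite
  graph \<open>G\<close>: the weak limit, the same for every exhaustion. For such \<open>G\<close> this determines \<open>M\<close>.\<close>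

definition is_wsf :: "('v, 'e) multigraph \<Rightarrow> 'e set measure \<Rightarrow> bool" where
  "is_wsf G M \<longleftrightarrow>
     prob_space M \<and> sets M = sets (borel_sets_of (edge_set_topology (edges G))) \<and>
     (\<exists>Gs. exhaustion G Gs) \<and>
     (\<forall>Gs. exhaustion G Gs \<longrightarrow>
        weakly_converges (edge_set_topology (edges G))
          (\<lambda>n. ust (edges G) (wired G (verts (Gs n)))) M)"


section \<open>The lattice\<close>

definition int_lattice :: "(int ^ 'd, (int ^ 'd) set) multigraph" where
  "int_lattice = \<lparr>verts = UNIV,
              edges = {{x, y} | x y. (\<Sum>i\<in>UNIV. \<bar>x $ i - y $ i\<bar>) = 1},
              endpoints = (\<lambda>e. e)\<rparr>"

definition tree_at_0 :: "(int ^ 'd) set set \<Rightarrow> (int ^ 'd, (int ^ 'd) set) multigraph" where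
  "tree_at_0 F = cluster (int_lattice\<lparr>edges := F\<rparr>) 0"

text \<open>For every set \<open>F\<close> of lattice edges this is a finite set: each component of
  \<open>remove_verts (tree_at_0 F) {0}\<close> contains a lattice neighbour of \<open>0\<close>. So the supremum in
  \<^const>\<open>diameter\<close> below is a genuine one.\<close>

definition finite_part :: "(int ^ 'd) set set \<Rightarrow> (int ^ 'd) set" where
  "finite_part F = \<Union>{C \<in> components_verts (remove_verts (tree_at_0 F) {0}). finite C}"

definition euclidean_diam :: "(int ^ 'd) set \<Rightarrow> real" where
  "euclidean_diam A = diameter ((\<lambda>x. (\<chi> i. real_of_int (x $ i)) :: real ^ 'd) ` A)"

end

theory Submission
  imports Defs
begin

text \<open>
  The theorem is due to Lyons, Morris and Schramm. On finitely many edges the wired forest is the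
  limit of uniform spanning trees of the lattice wired outside a finite set, so everything rests on an
  estimate for these trees: the probability that a vertex \<open>x\<close> has two arms, that is, two
  neighbours that are joined to \<open>x\<close> by an edge of the tree and to distance \<open>m\<close> by a path avoiding \<open>x\<close>, is
  at most a constant times \<open>m powr - (1/2 - 1/d)\<close> (\<open>two_arms_count\<close>).

  From the estimate to the theorem. Almost surely, every component of the forest is infinite and no
  vertex has two arms of every length. Then exactly one branch at each vertex is infinite; its first
  vertex is called the parent. Every ray follows parents, and the rays that start at the two ends
  of an edge merge, so there is one end (\<open>one_end\<close>). If the finite branches at \<open>0\<close> have a union of
  diameter above \<open>t\<close>, then one of them is an arm of length \<open>t / (2 * d)\<close>, the infinite branch is another
  one, and the estimate applies (\<open>two_arms_if_diam\<close>).

  The estimate. One of the two arms avoids the first edge on the path from \<open>x\<close> to the root \<open>\<rho>\<close>, the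
  vertex obtained by wiring. Removing this edge leaves a forest with two components, one containing \<open>x\<close>
  and one containing \<open>\<rho>\<close>. So it is to be shown that, in a uniform forest of this kind, the
  component of \<open>x\<close> seldom reaches far in a given coordinate direction. The edges are revealed
  half-space by half-space in that direction. Let \<open>M\<close> be the number of spanning trees divided by the
  number of forests that are compatible with the edges revealed so far. It has two descriptions.

  \<^item> As a ratio of counts it is a nonnegative martingale under the uniform forest
    (\<open>sum_conductance_le\<close>).

  \<^item> It is the effective conductance between \<open>x\<close> and \<open>\<rho>\<close> in the network in which the edges found present
    are contracted and the others deleted. The potential at \<open>w\<close> is the conditional probability that
    \<open>w\<close> belongs to the component of \<open>x\<close> (\<open>conductance_green\<close>).

  By Dirichlet's principle, revealing an edge with potential difference \<open>i\<close> moves \<open>M\<close> by at least the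
  square of \<open>i\<close>, up or down. Suppose the explored part of the component of \<open>x\<close> has \<open>k > 0\<close> vertices in the
  hyperplane bounding the revealed half-space. The half-space beyond is untouched, and a trace
  inequality (\<open>trace_bound\<close>) bounds the conductance from below by \<open>k powr ((d - 2) / (d - 1))\<close>, up to a
  constant. Since the current \<open>M\<close> leaves through the \<open>k\<close> edges crossing the hyperplane there, one
  of them has a potential difference of order at least \<open>M powr - (1 / (d - 2))\<close>
  (\<open>steep_edge_exists\<close>). Hence, as long as \<open>M\<close> stays below a level \<open>L\<close>, every step in which the component
  survives adds \<open>L powr - (4 / (d - 2))\<close> to the quadratic variation of \<open>M\<close>, up to a constant. Up to
  exceeding \<open>L\<close> the total quadratic variation is at most of order \<open>L\<close> in the mean, and the probability of
  exceeding \<open>L\<close> is of order \<open>1 / L\<close>. For \<open>L = R powr (1/2 - 1/d)\<close> this bounds the probability of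
  surviving \<open>R\<close> steps by a constant times \<open>R powr - (1/2 - 1/d)\<close> (\<open>reaches_count\<close>).
\<close>

section \<open>Connectivity and acyclic edge sets\<close>

definition linked :: "('e \<Rightarrow> 'v set) \<Rightarrow> 'e set \<Rightarrow> 'v \<Rightarrow> 'v \<Rightarrow> bool" where
  "linked en T = (\<lambda>u v. \<exists>e\<in>T. en e = {u, v})\<^sup>*\<^sup>*"

lemma reachable_eq_linked: "reachable G = linked (endpoints G) (edges G)"
  by (simp add: reachable_def linked_def adjacent_def[abs_def])

lemma linked_refl [simp, intro]: "linked en T u u"
  by (simp add: linked_def)

lemma linked_trans [trans]: "linked en T u v \<Longrightarrow> linked en T v w \<Longrightarrow> linked en T u w"
  by (simp add: linked_def)

lemma linked_edge: "e \<in> T \<Longrightarrow> en e = {u, v} \<Longrightarrow> linked en T u v"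
  unfolding linked_def by (rule r_into_rtranclp) auto

lemma linked_sym: "linked en T u v \<Longrightarrow> linked en T v u"
  unfolding linked_def
proof (induction rule: rtranclp_induct)
  case (step y z)
  then have "(\<lambda>u v. \<exists>e\<in>T. en e = {u, v}) z y" by (auto simp: insert_commute)
  then show ?case using step.IH by (rule converse_rtranclp_into_rtranclp)
qed simp

lemma linked_mono: "linked en T u v \<Longrightarrow> T \<subseteq> T' \<Longrightarrow> linked en T' u v"
  unfolding linked_def by (erule rtranclp_mono[THEN predicate2D, rotated]) auto

lemma linked_induct [consumes 1, case_names refl step]:
  assumes "linked en T u v" "P u"
    and "\<And>y z e. linked en T u y \<Longrightarrow> e \<in> T \<Longrightarrow> en e = {y, z} \<Longrightarrow> P y \<Longrightarrow> P z"
  shows "P v"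
  using assms(1) unfolding linked_def
  by (induction rule: rtranclp_induct) (use assms(2,3) in \<open>auto simp: linked_def\<close>)

text \<open>
  All facts about adding or removing one edge of a tree come from this equivalence: a walk that uses
  the new edge can be shortened to one that uses it once.
\<close>

lemma linked_insert:
  assumes "en e = {a, b}"
  shows "linked en (insert e T) u v \<longleftrightarrow>
    linked en T u v \<or> (linked en T u a \<and> linked en T b v) \<or> (linked en T u b \<and> linked en T a v)"
    (is "?l \<longleftrightarrow> ?r v")
proof
  assume ?l
  then show "?r v"
  proof (induction rule: linked_induct)
    case (step y z f)
    show ?case
    proof (cases "f = e")
      case True
      then have "(y = a \<and> z = b) \<or> (y = b \<and> z = a)"
        using step assms by (metis doubleton_eq_iff)
      then show ?thesis using step.IH by (metis linked_refl)
    next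
      case False
      then have "linked en T y z" using step.hyps by (auto intro: linked_edge)
      then show ?thesis using step.IH by (meson linked_trans)
    qed
  qed auto
next
  have ab: "linked en (insert e T) a b" by (rule linked_edge[of e]) (auto simp: assms)
  have m: "linked en T p q \<Longrightarrow> linked en (insert e T) p q" for p q
    by (erule linked_mono) auto
  show "?r v \<Longrightarrow> ?l"
    by (meson ab linked_sym linked_trans m)
qed

lemma linked_finite: "linked en T u v \<Longrightarrow> \<exists>D\<subseteq>T. finite D \<and> linked en D u v"
proof (induction rule: linked_induct)
  case (step y z e)
  then obtain D where D: "D \<subseteq> T" "finite D" "linked en D u y" by auto
  have "linked en (insert e D) u y" by (rule linked_mono[OF D(3)]) auto
  moreover have "linked en (insert e D) y z" by (rule linked_edge[of e]) (auto simp: step)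
  ultimately show ?case using D step.hyps
    by (intro exI[of _ "insert e D"]) (auto intro: linked_trans)
qed (auto intro: exI[of _ "{}"])

text \<open>
  An edge set is acyclic when each of its edges is a bridge. This form speaks of connectivity only
  and is inherited by subsets, unlike a statement about vertex and edge lists; its equivalence
  with the absence of cycles is \<open>no_cycle_imp_acyc\<close> and \<open>acyc_imp_no_cycle\<close>.
\<close>

definition acyc :: "('e \<Rightarrow> 'v set) \<Rightarrow> 'e set \<Rightarrow> bool" where
  "acyc en T \<longleftrightarrow> (\<forall>e\<in>T. \<forall>a b. en e = {a, b} \<longrightarrow> \<not> linked en (T - {e}) a b)"

lemma acycD: "acyc en T \<Longrightarrow> e \<in> T \<Longrightarrow> en e = {a, b} \<Longrightarrow> \<not> linked en (T - {e}) a b"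
  by (auto simp: acyc_def)

lemma acyc_subset: "acyc en T \<Longrightarrow> T' \<subseteq> T \<Longrightarrow> acyc en T'"
  unfolding acyc_def by (meson Diff_mono equalityE linked_mono subsetD)

lemma acyc_insert:
  assumes "acyc en F" "en e = {a, b}" "\<not> linked en F a b"
  shows "acyc en (insert e F)"
  unfolding acyc_def
proof (intro ballI allI impI notI)
  fix f c d assume f: "f \<in> insert e F" "en f = {c, d}" "linked en (insert e F - {f}) c d"
  have enF: "e \<notin> F" using assms by (auto dest: linked_edge)
  show False
  proof (cases "f = e")
    case True
    then have "linked en F c d" using f enF by simp
    moreover have "(c = a \<and> d = b) \<or> (c = b \<and> d = a)"
      using f True assms(2) by (metis doubleton_eq_iff)
    ultimately show False using assms(3) linked_sym by metis
  next
    case False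
    then have eq: "insert e F - {f} = insert e (F - {f})" by auto
    have cd: "linked en F c d" using f False by (auto intro: linked_edge)
    have mono: "linked en (F - {f}) p q \<Longrightarrow> linked en F p q" for p q
      by (erule linked_mono) auto
    from f(3)[unfolded eq linked_insert[where e = e and a = a and b = b and en = en, OF assms(2)]] consider
      "linked en (F - {f}) c d" | "linked en F c a" "linked en F b d" | "linked en F c b" "linked en F a d"
      using mono by blast
    then show False
    proof cases
      case 1 then show False using acycD[OF assms(1), of f c d] f False by auto
    next
      case 2 then show False using cd assms(3) by (meson linked_sym linked_trans)
    next
      case 3 then show False using cd assms(3) by (meson linked_sym linked_trans)
    qed
  qed
qed

text \<open>
  Walks are shortened to simple paths in order to exhibit a cycle: when the new endpoint already
  occurs on the path, the path is cut there.
\<close>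

lemma rtranclp_simple_path:
  assumes "r\<^sup>*\<^sup>* a b"
  shows "\<exists>xs. xs \<noteq> [] \<and> distinct xs \<and> hd xs = a \<and> last xs = b \<and>
    (\<forall>i. Suc i < length xs \<longrightarrow> r (xs ! i) (xs ! Suc i))"
  using assms
proof (induction rule: rtranclp_induct)
  case base
  show ?case by (rule exI[of _ "[a]"]) auto
next
  case (step b c)
  then obtain xs where xs: "xs \<noteq> []" "distinct xs" "hd xs = a" "last xs = b"
    "\<And>i. Suc i < length xs \<Longrightarrow> r (xs ! i) (xs ! Suc i)" by auto
  show ?case
  proof (cases "c \<in> set xs")
    case True
    then obtain j where j: "j < length xs" "xs ! j = c" by (metis in_set_conv_nth)
    have "last (take (Suc j) xs) = c" using j by (simp add: take_Suc_conv_app_nth)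
    then show ?thesis using xs j
      by (intro exI[of _ "take (Suc j) xs"]) auto
  next
    case False
    have "r ((xs @ [c]) ! i) ((xs @ [c]) ! Suc i)" if "Suc i < length (xs @ [c])" for i
    proof (cases "Suc i < length xs")
      case True then show ?thesis using xs(5)[of i] by (simp add: nth_append)
    next
      case False
      then have "Suc i = length xs" using that by simp
      then have "xs ! i = b" using xs(1,4) by (metis diff_Suc_1 last_conv_nth)
      then show ?thesis using \<open>Suc i = length xs\<close> step.hyps by (simp add: nth_append)
    qed
    then show ?thesis using xs False by (intro exI[of _ "xs @ [c]"]) auto
  qed
qed

text \<open>
  A simple path that avoids \<open>e\<close> between the ends of \<open>e\<close>, closed up by \<open>e\<close>, is a cycle. Its edges
  are distinct because its vertices are; a path with a single edge gives a pair of parallel edges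
  and a path with no edge a loop.
\<close>

lemma no_cycle_imp_acyc:
  assumes sub: "\<And>e. e \<in> T \<Longrightarrow> endpoints G e \<subseteq> verts G"
    and nc: "\<nexists>vs es. is_cycle (G\<lparr>edges := T\<rparr>) vs es"
  shows "acyc (endpoints G) T"
  unfolding acyc_def
proof (intro ballI allI impI notI)
  fix e a b assume e: "e \<in> T" "endpoints G e = {a, b}" "linked (endpoints G) (T - {e}) a b"
  let ?en = "endpoints G"
  obtain xs where xs: "xs \<noteq> []" "distinct xs" "hd xs = a" "last xs = b"
    "\<And>i. Suc i < length xs \<Longrightarrow> \<exists>f\<in>T - {e}. ?en f = {xs ! i, xs ! Suc i}"
    using rtranclp_simple_path[OF e(3)[unfolded linked_def]] by metis
  \<comment> \<open>The last position carries the closing edge, so that indices modulo the length fit the definition of a cycle.\<close>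
  define g where "g i = (if Suc i < length xs then (SOME f. f \<in> T - {e} \<and> ?en f = {xs ! i, xs ! Suc i}) else e)" for i
  have g: "g i \<in> T - {e} \<and> ?en (g i) = {xs ! i, xs ! Suc i}" if "Suc i < length xs" for i
    using someI_ex[of "\<lambda>f. f \<in> T - {e} \<and> ?en f = {xs ! i, xs ! Suc i}"] xs(5)[OF that] that
    unfolding g_def by auto
  let ?n = "length xs"
  let ?es = "map g [0..<?n]"
  have last: "g i = e" "xs ! i = b" if "Suc i = ?n" for i
    using that xs(1,4) diff_Suc_1[of i] by (auto simp: g_def last_conv_nth)
  have ends: "?en (g i) = {xs ! i, xs ! (Suc i mod ?n)}" if "i < ?n" for i
  proof (cases "Suc i < ?n")
    case True then show ?thesis using g by simp
  next
    case False
    then have i: "Suc i = ?n" using that by simp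
    then show ?thesis using last[OF i] e(2) xs(1,3) by (simp add: hd_conv_nth insert_commute)
  qed
  have inT: "g i \<in> T" for i using g e(1) by (cases "Suc i < ?n") (auto simp: g_def)
  have inj: "g i = g j \<Longrightarrow> i < j \<Longrightarrow> j < ?n \<Longrightarrow> False" for i j
  proof -
    assume *: "g i = g j" "i < j" "j < ?n"
    then have i: "Suc i < ?n" by simp
    have "Suc j < ?n" using g[OF i] * by (auto simp: g_def[of j] split: if_splits)
    then have "{xs ! i, xs ! Suc i} = {xs ! j, xs ! Suc j}" using g[OF i] g[of j] * by metis
    then have "xs ! i = xs ! j \<or> xs ! i = xs ! Suc j" by (auto simp: doubleton_eq_iff)
    then show False using xs(2) * \<open>Suc j < ?n\<close> by (auto simp: nth_eq_iff_index_eq)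
  qed
  have vsub: "set xs \<subseteq> verts G"
  proof
    fix v assume "v \<in> set xs"
    then obtain i where "i < ?n" "xs ! i = v" by (metis in_set_conv_nth)
    then show "v \<in> verts G" using ends[of i] sub[OF inT[of i]] by auto
  qed
  have "distinct ?es"
    unfolding distinct_map using inj by (auto simp: inj_on_def) (metis nat_neq_iff)
  then have "is_cycle (G\<lparr>edges := T\<rparr>) xs ?es"
    unfolding is_cycle_def using xs vsub inT ends by auto
  then show False using nc by blast
qed

lemma acyc_imp_no_cycle:
  assumes ac: "acyc (endpoints G) T"
  shows "\<not> is_cycle (G\<lparr>edges := T\<rparr>) vs es"
proof
  assume c: "is_cycle (G\<lparr>edges := T\<rparr>) vs es"
  let ?en = "endpoints G" let ?n = "length vs"
  have n: "?n > 0" and len: "length es = ?n" and d: "distinct es" and eT: "set es \<subseteq> T"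
    and ends: "\<And>i. i < ?n \<Longrightarrow> ?en (es ! i) = {vs ! i, vs ! (Suc i mod ?n)}"
    using c by (auto simp: is_cycle_def)
  have walk: "linked ?en (T - {es ! 0}) (vs ! (1 mod ?n)) (vs ! (Suc k mod ?n))" if "k < ?n" for k
    using that
  proof (induction k)
    case (Suc k)
    have "es ! Suc k \<noteq> es ! 0" using Suc.prems d len n by (subst nth_eq_iff_index_eq) auto
    moreover have "es ! Suc k \<in> T" using Suc.prems eT len by (metis nth_mem subsetD)
    ultimately have "es ! Suc k \<in> T - {es ! 0}" by blast
    moreover have "?en (es ! Suc k) = {vs ! (Suc k mod ?n), vs ! (Suc (Suc k) mod ?n)}"
      using ends[OF Suc.prems] Suc.prems by simp
    ultimately show ?case using Suc by (meson Suc_lessD linked_edge linked_trans)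
  qed simp
  have "linked ?en (T - {es ! 0}) (vs ! (1 mod ?n)) (vs ! 0)" using walk[of "?n - 1"] n by simp
  moreover have "es ! 0 \<in> T" using eT n len by (metis nth_mem subsetD)
  moreover have "?en (es ! 0) = {vs ! (1 mod ?n), vs ! 0}" using ends[OF n] by (simp add: insert_commute)
  ultimately show False using acycD[OF ac] by blast
qed

lemma spanning_trees_iff:
  assumes "\<And>e. e \<in> edges G \<Longrightarrow> endpoints G e \<subseteq> verts G" "verts G \<noteq> {}"
  shows "T \<in> spanning_trees G \<longleftrightarrow>
    T \<subseteq> edges G \<and> acyc (endpoints G) T \<and> (\<forall>u\<in>verts G. \<forall>v\<in>verts G. linked (endpoints G) T u v)"
proof
  assume "T \<in> spanning_trees G"
  then show "T \<subseteq> edges G \<and> acyc (endpoints G) T \<and> (\<forall>u\<in>verts G. \<forall>v\<in>verts G. linked (endpoints G) T u v)"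
    using no_cycle_imp_acyc[of T G] assms
    by (auto simp: spanning_trees_def connected_graph_def reachable_eq_linked)
next
  assume "T \<subseteq> edges G \<and> acyc (endpoints G) T \<and> (\<forall>u\<in>verts G. \<forall>v\<in>verts G. linked (endpoints G) T u v)"
  then show "T \<in> spanning_trees G"
    using acyc_imp_no_cycle[of G T] assms
    by (auto simp: spanning_trees_def connected_graph_def reachable_eq_linked)
qed

section \<open>Trees, forests and effective conductance\<close>

text \<open>
  Removing an edge of a tree separates its two ends, and any vertex stays with exactly one of them.
\<close>

lemma linked_if_edge_away:
  assumes "acyc en T" "e \<in> T" "en e = {y, z}" "linked en T y w"
  shows "linked en (T - {e}) z w \<longleftrightarrow> \<not> linked en (T - {e}) y w"
proof -
  have "insert e (T - {e}) = T" using assms by auto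
  then have "linked en (T - {e}) y w \<or> linked en (T - {e}) z w"
    using linked_insert[where en=en and e=e and a=y and b=z and T="T-{e}", OF assms(3)] assms(4) by metis
  moreover have "\<not> (linked en (T - {e}) y w \<and> linked en (T - {e}) z w)"
    using acycD[OF assms(1-3)] by (meson linked_sym linked_trans)
  ultimately show ?thesis by blast
qed

text \<open>
  A finite multigraph with a source \<open>x\<close> and a root \<open>\<rho>\<close>. The functions \<open>src\<close> and \<open>tgt\<close> orient
  the edges, so that functions on the vertices have signed gradients.
\<close>

locale network =
  fixes V :: "'v set" and E :: "'e set" and en :: "'e \<Rightarrow> 'v set"
    and src tgt :: "'e \<Rightarrow> 'v" and x \<rho> :: 'v
  assumes finE [simp]: "finite E" and xV: "x \<in> V" and rV: "\<rho> \<in> V"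
    and en_eq: "e \<in> E \<Longrightarrow> en e = {src e, tgt e}"
    and srcV: "e \<in> E \<Longrightarrow> src e \<in> V" and tgtV: "e \<in> E \<Longrightarrow> tgt e \<in> V"
begin

abbreviation "lk \<equiv> linked en"

text \<open>
  The signed indicator of an edge \<open>e\<close> of \<open>T\<close> on the path of the tree \<open>T\<close> from \<open>y\<close> to \<open>\<rho>\<close>: \<open>1\<close> if the path runs
  from \<open>src e\<close> to \<open>tgt e\<close>, \<open>-1\<close> if it runs backwards and \<open>0\<close> if it avoids \<open>e\<close>. Expressed through
  connectivity in \<open>T - {e}\<close> it avoids all mention of the path itself.
\<close>

definition spine :: "'v \<Rightarrow> 'e set \<Rightarrow> 'e \<Rightarrow> real" where
  "spine y T e = of_bool (lk (T - {e}) y (src e) \<and> lk (T - {e}) (tgt e) \<rho>)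
     - of_bool (lk (T - {e}) y (tgt e) \<and> lk (T - {e}) (src e) \<rho>)"

text \<open>
  The telescoping sum along the path from \<open>y\<close> to \<open>\<rho>\<close>. When the starting point moves across an edge
  \<open>g\<close>, the spine changes at \<open>g\<close> only: either \<open>g\<close> is appended in front, or it was the first edge and
  is dropped.
\<close>

lemma spine_potential:
  assumes T: "T \<subseteq> E" "acyc en T" and y: "lk T y \<rho>"
  shows "(\<Sum>e\<in>T. spine y T e * (f (src e) - f (tgt e))) = f y - f \<rho>"
proof -
  have fT: "finite T" using T(1) finE by (rule finite_subset)
  have "lk T \<rho> y" using y by (rule linked_sym)
  then show ?thesis
  proof (induction rule: linked_induct)
    case refl
    have "spine \<rho> T e = 0" if e: "e \<in> T" for e
    proof -
      have "en e = {src e, tgt e}" using en_eq e T by auto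
      then have "\<not> lk (T - {e}) (src e) (tgt e)" using acycD T e by metis
      then have "\<not> (lk (T - {e}) \<rho> (src e) \<and> lk (T - {e}) (tgt e) \<rho>)"
        "\<not> (lk (T - {e}) \<rho> (tgt e) \<and> lk (T - {e}) (src e) \<rho>)"
        by (meson linked_sym linked_trans)+
      then show ?thesis unfolding spine_def by auto
    qed
    then show ?case by simp
  next
    case (step y z g)
    have yr: "lk T y \<rho>" using step.hyps(1) by (rule linked_sym)
    have gT: "g \<in> T" by fact
    have eng: "en g = {src g, tgt g}" using en_eq gT T by auto
    have nyz: "\<not> lk (T - {g}) y z" using acycD T step by metis
    have nzy: "\<not> lk (T - {g}) z y" using nyz linked_sym by metis
    have alt: "lk (T - {g}) z \<rho> \<longleftrightarrow> \<not> lk (T - {g}) y \<rho>"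
      by (rule linked_if_edge_away[OF T(2) gT _ yr]) fact
    have other: "spine z T e = spine y T e" if "e \<in> T - {g}" for e
    proof -
      have yz: "lk (T - {e}) y z" by (rule linked_edge[of g]) (use that step in auto)
      have "lk (T - {e}) z w \<longleftrightarrow> lk (T - {e}) y w" for w
        using yz by (meson linked_sym linked_trans)
      then show ?thesis unfolding spine_def by simp
    qed
    have this_edge: "spine z T g * (f (src g) - f (tgt g)) = spine y T g * (f (src g) - f (tgt g)) + (f z - f y)"
    proof -
      consider "src g = y" "tgt g = z" | "src g = z" "tgt g = y"
        using eng step.hyps by (metis doubleton_eq_iff)
      then show ?thesis
      proof cases
        case 1 show ?thesis using nyz nzy alt unfolding spine_def 1 by auto
      next
        case 2 show ?thesis using nyz nzy alt unfolding spine_def 2 by auto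
      qed
    qed
    have "(\<Sum>e\<in>T. spine z T e * (f (src e) - f (tgt e)))
        = spine z T g * (f (src g) - f (tgt g)) + (\<Sum>e\<in>T-{g}. spine z T e * (f (src e) - f (tgt e)))"
      by (rule sum.remove[OF fT gT])
    also have "\<dots> = spine y T g * (f (src g) - f (tgt g)) + (f z - f y)
        + (\<Sum>e\<in>T-{g}. spine y T e * (f (src e) - f (tgt e)))"
      using this_edge other by simp
    also have "\<dots> = (\<Sum>e\<in>T. spine y T e * (f (src e) - f (tgt e))) + (f z - f y)"
      using sum.remove[OF fT gT, of "\<lambda>e. spine y T e * (f (src e) - f (tgt e))"] by simp
    finally show ?case using step.IH by simp
  qed
qed

text \<open>
  The edges of \<open>B\<close> have been revealed and \<open>Q\<close> is the set of those that turned out to be present.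
  \<open>trees B Q\<close> are the spanning trees, and \<open>forests B Q\<close> the spanning forests with exactly two
  components, one containing \<open>x\<close> and the other \<open>\<rho>\<close>, that are compatible with this information.
\<close>

definition trees :: "'e set \<Rightarrow> 'e set \<Rightarrow> 'e set set" where
  "trees B Q = {T. T \<subseteq> E \<and> T \<inter> B = Q \<and> acyc en T \<and> (\<forall>u\<in>V. lk T x u)}"

definition forests :: "'e set \<Rightarrow> 'e set \<Rightarrow> 'e set set" where
  "forests B Q = {F. F \<subseteq> E \<and> F \<inter> B = Q \<and> acyc en F \<and> (\<forall>u\<in>V. lk F x u \<or> lk F \<rho> u) \<and> \<not> lk F x \<rho>}"

lemma finite_trees [simp]: "finite (trees B Q)"
  by (rule finite_subset[of _ "Pow E"]) (auto simp: trees_def)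

lemma finite_forests [simp]: "finite (forests B Q)"
  by (rule finite_subset[of _ "Pow E"]) (auto simp: forests_def)

text \<open>
  Cutting the tree at an edge of its spine leaves a two-component forest, and a forest together with
  an edge that joins its two components gives back the tree. The conditions on \<open>B\<close> are preserved
  because \<open>e\<close> is not revealed.
\<close>

lemma tree_cut_bij:
  assumes e: "e \<in> E - B" and ab: "en e = {a, b}" and bV: "b \<in> V"
  shows "bij_betw (\<lambda>T. T - {e})
     {T\<in>trees B Q. e \<in> T \<and> lk (T - {e}) x a \<and> lk (T - {e}) b \<rho>}
     {F\<in>forests B Q. lk F x a \<and> \<not> lk F x b}"
proof (rule bij_betw_byWitness[where f' = "insert e"])
  show "\<forall>T\<in>{T\<in>trees B Q. e \<in> T \<and> lk (T - {e}) x a \<and> lk (T - {e}) b \<rho>}. insert e (T - {e}) = T"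
    by auto
  have notin: "e \<notin> F" if "lk F x a" "\<not> lk F x b" for F
    using that ab by (meson linked_edge linked_trans)
  show "\<forall>F\<in>{F\<in>forests B Q. lk F x a \<and> \<not> lk F x b}. insert e F - {e} = F"
    using notin by auto
  show "(\<lambda>T. T - {e}) ` {T\<in>trees B Q. e \<in> T \<and> lk (T - {e}) x a \<and> lk (T - {e}) b \<rho>}
    \<subseteq> {F\<in>forests B Q. lk F x a \<and> \<not> lk F x b}"
  proof safe
    fix T assume T: "T \<in> trees B Q" "e \<in> T" "lk (T - {e}) x a" "lk (T - {e}) b \<rho>"
    have ac: "acyc en T" using T by (auto simp: trees_def)
    have nab: "\<not> lk (T - {e}) a b" using acycD[OF ac T(2) ab] .
    show "lk (T - {e}) x b \<Longrightarrow> False" using nab T(3) by (meson linked_sym linked_trans)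
    have nxr: "\<not> lk (T - {e}) x \<rho>" using nab T(3,4) by (meson linked_sym linked_trans)
    have "lk (T - {e}) x u \<or> lk (T - {e}) \<rho> u" if "u \<in> V" for u
    proof -
      have ins: "insert e (T - {e}) = T" using T by auto
      have "lk T x u" using T that by (auto simp: trees_def)
      then show ?thesis
        using linked_insert[where en=en and e=e and a=a and b=b and T="T-{e}" and u=x and v=u, OF ab, unfolded ins]
          T(3,4) by (meson linked_sym linked_trans)
    qed
    then show "T - {e} \<in> forests B Q"
      using T e ac nxr acyc_subset[OF ac, of "T - {e}"] by (auto simp: forests_def trees_def)
  qed
  show "insert e ` {F\<in>forests B Q. lk F x a \<and> \<not> lk F x b}
    \<subseteq> {T\<in>trees B Q. e \<in> T \<and> lk (T - {e}) x a \<and> lk (T - {e}) b \<rho>}"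
  proof safe
    fix F assume F: "F \<in> forests B Q" "lk F x a" "\<not> lk F x b"
    have eF: "insert e F - {e} = F" using notin F by auto
    have br: "lk F b \<rho>" using F bV linked_sym[of en F \<rho> b] by (auto simp: forests_def)
    show "lk (insert e F - {e}) x a" "lk (insert e F - {e}) b \<rho>" using eF F br by auto
    have nab: "\<not> lk F a b" using F by (meson linked_trans)
    have "acyc en F" using F by (simp add: forests_def)
    then have "acyc en (insert e F)" using ab nab by (rule acyc_insert)
    moreover have "lk (insert e F) x u" if "u \<in> V" for u
    proof -
      have "lk F x u \<or> lk F \<rho> u" using F that by (auto simp: forests_def)
      then show ?thesis using linked_insert[where en=en and e=e and a=a and b=b, OF ab] F br
        by (meson linked_trans)
    qed
    ultimately show "insert e F \<in> trees B Q" using F e by (auto simp: forests_def trees_def)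
  qed
qed

definition energy :: "'e set \<Rightarrow> ('v \<Rightarrow> real) \<Rightarrow> ('v \<Rightarrow> real) \<Rightarrow> real" where
  "energy B f g = (\<Sum>e\<in>E - B. (f (src e) - f (tgt e)) * (g (src e) - g (tgt e)))"

definition hits :: "'e set \<Rightarrow> 'e set \<Rightarrow> 'v \<Rightarrow> real" where
  "hits B Q w = real (card {F \<in> forests B Q. lk F x w})"

text \<open>
  \<open>potential B Q w\<close> is the probability that \<open>w\<close> is in the component of \<open>x\<close> for a uniform forest
  compatible with \<open>(B, Q)\<close>. It is the electric potential with value \<open>1\<close> at \<open>x\<close> and \<open>0\<close> at \<open>\<rho>\<close> in the
  network in which the edges of \<open>Q\<close> are contracted and those of \<open>B - Q\<close> deleted, and
  \<open>conductance B Q\<close> is the effective conductance of that network between \<open>x\<close> and \<open>\<rho>\<close>; this is the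
  content of \<open>conductance_green\<close> and \<open>conductance_energy\<close>.
\<close>

definition potential :: "'e set \<Rightarrow> 'e set \<Rightarrow> 'v \<Rightarrow> real" where
  "potential B Q w = real (card {F \<in> forests B Q. lk F x w}) / real (card (forests B Q))"

definition conductance :: "'e set \<Rightarrow> 'e set \<Rightarrow> real" where
  "conductance B Q = real (card (trees B Q)) / real (card (forests B Q))"

text \<open>
  The discrete Green identity, and the reason why counting trees is electricity. In each tree the
  spine from \<open>x\<close> to \<open>\<rho>\<close> telescopes \<open>f\<close>. Summed over all trees, a revealed edge contributes nothing:
  either it is closed, or it is open and \<open>f\<close> does not change along it. An unrevealed edge \<open>e\<close> lies on
  the spine, from \<open>a\<close> to \<open>b\<close>, for as many trees as there are forests in which \<open>a\<close> but not \<open>b\<close> belongs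
  to the component of \<open>x\<close>; after the opposite orientation is subtracted, the forests in which both
  belong to it cancel, and a difference of hitting counts remains.
\<close>

lemma trees_green:
  assumes Q: "Q \<subseteq> B" and f: "\<And>e. e \<in> Q \<Longrightarrow> f (src e) = f (tgt e)"
  shows "real (card (trees B Q)) * (f x - f \<rho>) =
    (\<Sum>e\<in>E - B. (f (src e) - f (tgt e)) * (hits B Q (src e) - hits B Q (tgt e)))"
proof -
  let ?d = "\<lambda>e. f (src e) - f (tgt e)"
  let ?tr = "trees B Q" and ?fo = "forests B Q"
  define sp where "sp T e = (if e \<in> T then spine x T e else 0)" for T e
  have "(\<Sum>e\<in>E. sp T e * ?d e) = f x - f \<rho>" if T: "T \<in> ?tr" for T
  proof -
    have "(\<Sum>e\<in>E. sp T e * ?d e) = (\<Sum>e\<in>T. spine x T e * ?d e)"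
      using T by (intro sum.mono_neutral_cong_right) (auto simp: sp_def trees_def)
    also have "\<dots> = f x - f \<rho>"
      using T rV by (intro spine_potential) (auto simp: trees_def)
    finally show ?thesis .
  qed
  then have "real (card ?tr) * (f x - f \<rho>) = (\<Sum>T\<in>?tr. \<Sum>e\<in>E. sp T e * ?d e)" by simp
  also have "\<dots> = (\<Sum>e\<in>E. ?d e * (\<Sum>T\<in>?tr. sp T e))"
    by (subst sum.swap) (simp add: sum_distrib_left mult.commute)
  also have "\<dots> = (\<Sum>e\<in>E - B. ?d e * (\<Sum>T\<in>?tr. sp T e))"
  proof (rule sum.mono_neutral_right)
    show "\<forall>e\<in>E - (E - B). ?d e * (\<Sum>T\<in>?tr. sp T e) = 0"
    proof
      fix e assume e: "e \<in> E - (E - B)"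
      show "?d e * (\<Sum>T\<in>?tr. sp T e) = 0"
      proof (cases "e \<in> Q")
        case False
        then have "sp T e = 0" if "T \<in> ?tr" for T using that e by (auto simp: sp_def trees_def)
        then show ?thesis by simp
      qed (simp add: f)
    qed
  qed auto
  also have "\<dots> = (\<Sum>e\<in>E - B. ?d e * (hits B Q (src e) - hits B Q (tgt e)))"
  proof (rule sum.cong[OF refl])
    fix e assume e: "e \<in> E - B"
    have en1: "en e = {src e, tgt e}" and en2: "en e = {tgt e, src e}" using en_eq e by auto
    have c: "real (card {T\<in>?tr. e \<in> T \<and> lk (T - {e}) x a \<and> lk (T - {e}) b \<rho>})
        = real (card {F\<in>?fo. lk F x a \<and> \<not> lk F x b})"
      if "en e = {a, b}" "b \<in> V" for a b
      using bij_betw_same_card[OF tree_cut_bij[OF e that]] by simp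
    have part: "hits B Q a = real (card {F\<in>?fo. lk F x a \<and> lk F x b}) + real (card {F\<in>?fo. lk F x a \<and> \<not> lk F x b})" for a b
    proof -
      have "{F\<in>?fo. lk F x a} = {F\<in>?fo. lk F x a \<and> lk F x b} \<union> {F\<in>?fo. lk F x a \<and> \<not> lk F x b}" by auto
      then show ?thesis unfolding hits_def by (simp, subst card_Un_disjoint) auto
    qed
    have bsum: "(\<Sum>T\<in>?tr. of_bool (P T)) = real (card {T\<in>?tr. P T})" for P
    proof -
      have "(\<Sum>T\<in>?tr. of_bool (P T)) = (\<Sum>T\<in>{T\<in>?tr. P T}. (1::real))"
        by (intro sum.mono_neutral_cong_right) auto
      then show ?thesis by simp
    qed
    have "(\<Sum>T\<in>?tr. sp T e) = (\<Sum>T\<in>?tr. of_bool (e \<in> T \<and> lk (T - {e}) x (src e) \<and> lk (T - {e}) (tgt e) \<rho>)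
        - of_bool (e \<in> T \<and> lk (T - {e}) x (tgt e) \<and> lk (T - {e}) (src e) \<rho>))"
      by (rule sum.cong) (auto simp: sp_def spine_def)
    also have "\<dots> = real (card {F\<in>?fo. lk F x (src e) \<and> \<not> lk F x (tgt e)})
        - real (card {F\<in>?fo. lk F x (tgt e) \<and> \<not> lk F x (src e)})"
      using e by (simp only: sum_subtractf bsum c[OF en1 tgtV] c[OF en2 srcV] DiffD1)
    also have "\<dots> = hits B Q (src e) - hits B Q (tgt e)"
      using part[of "src e" "tgt e"] part[of "tgt e" "src e"] by (simp add: conj_commute)
    finally show "?d e * (\<Sum>T\<in>?tr. sp T e) = ?d e * (hits B Q (src e) - hits B Q (tgt e))" by simp
  qed
  finally show ?thesis .
qed

lemma conductance_green:
  assumes "Q \<subseteq> B" "\<And>e. e \<in> Q \<Longrightarrow> f (src e) = f (tgt e)" "forests B Q \<noteq> {}"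
  shows "conductance B Q * (f x - f \<rho>) = energy B f (potential B Q)"
proof -
  let ?N = "real (card (forests B Q))"
  have N: "?N > 0" using assms(3) by (simp add: card_gt_0_iff)
  have "conductance B Q * (f x - f \<rho>) = (\<Sum>e\<in>E - B. (f (src e) - f (tgt e)) * (hits B Q (src e) - hits B Q (tgt e))) / ?N"
    unfolding conductance_def using trees_green[OF assms(1,2)] by simp
  also have "\<dots> = energy B f (potential B Q)"
    unfolding energy_def potential_def hits_def by (simp add: sum_divide_distrib diff_divide_distrib[symmetric])
  finally show ?thesis .
qed

lemma potential_one:
  assumes "forests B Q \<noteq> {}" "lk Q x w"
  shows "potential B Q w = 1"
proof -
  have "lk F x w" if "F \<in> forests B Q" for F
    using assms(2) by (rule linked_mono) (use that in \<open>auto simp: forests_def\<close>)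
  then have "{F \<in> forests B Q. lk F x w} = forests B Q" by auto
  then show ?thesis using assms(1) by (simp add: potential_def)
qed

lemma potential_root: "potential B Q \<rho> = 0"
proof -
  have "{F \<in> forests B Q. lk F x \<rho>} = {}" by (auto simp: forests_def)
  then show ?thesis by (simp add: potential_def)
qed

lemma potential_open:
  assumes "e \<in> Q" "e \<in> E"
  shows "potential B Q (src e) = potential B Q (tgt e)"
proof -
  have "lk F x (src e) \<longleftrightarrow> lk F x (tgt e)" if "F \<in> forests B Q" for F
  proof -
    have "e \<in> F" using that assms by (auto simp: forests_def)
    then have "lk F (src e) (tgt e)" using en_eq[OF assms(2)] by (auto intro: linked_edge)
    then show ?thesis by (meson linked_sym linked_trans)
  qed
  then show ?thesis unfolding potential_def by (metis (mono_tags, lifting))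
qed

text \<open>
  Dirichlet's principle with its error term: by \<open>conductance_green\<close>, \<open>f - v\<close> is orthogonal to \<open>v\<close>.
\<close>

lemma dirichlet:
  assumes Q: "Q \<subseteq> B" "Q \<subseteq> E" and f: "\<And>e. e \<in> Q \<Longrightarrow> f (src e) = f (tgt e)"
    and f1: "f x = 1" "f \<rho> = 0" and ne: "forests B Q \<noteq> {}"
  defines "v \<equiv> potential B Q"
  shows "energy B f f = conductance B Q + energy B (\<lambda>w. f w - v w) (\<lambda>w. f w - v w)"
proof -
  have v1: "v x = 1" "v \<rho> = 0" using potential_one[OF ne] potential_root by (auto simp: v_def)
  have vc: "e \<in> Q \<Longrightarrow> v (src e) = v (tgt e)" for e using potential_open Q by (auto simp: v_def)
  have 1: "conductance B Q = energy B f v" using conductance_green[OF Q(1) f ne] f1 by (simp add: v_def)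
  have 2: "conductance B Q = energy B v v" using conductance_green[OF Q(1) vc ne] v1 by (simp add: v_def)
  have "energy B (\<lambda>w. f w - v w) (\<lambda>w. f w - v w) = energy B f f - 2 * energy B f v + energy B v v"
    unfolding energy_def sum_distrib_left sum_subtractf[symmetric] sum.distrib[symmetric]
    by (rule sum.cong) (auto simp: algebra_simps)
  then show ?thesis using 1 2 by simp
qed

lemma conductance_energy:
  assumes "Q \<subseteq> B" "Q \<subseteq> E" "forests B Q \<noteq> {}"
  shows "energy B (potential B Q) (potential B Q) = conductance B Q"
  using conductance_green[OF assms(1) _ assms(3), of "potential B Q"] potential_open assms
    potential_one[OF assms(3)] potential_root by (simp add: subset_iff)

lemma energy_nonneg: "energy B f f \<ge> 0"
  unfolding energy_def by (intro sum_nonneg) auto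

lemma energy_ge_edge:
  assumes "e \<in> E - B" shows "energy B f f \<ge> (f (src e) - f (tgt e))\<^sup>2"
  unfolding energy_def
  using member_le_sum[of e "E - B" "\<lambda>e. (f (src e) - f (tgt e)) * (f (src e) - f (tgt e))"] assms
  by (auto simp: power2_eq_square)

lemma energy_insert:
  assumes "e \<in> E - B"
  shows "energy B f f = energy (insert e B) f f + (f (src e) - f (tgt e))\<^sup>2"
proof -
  have "E - insert e B = (E - B) - {e}" by auto
  then show ?thesis unfolding energy_def using assms
    by (subst sum.remove[of "E - B" e]) (auto simp: power2_eq_square)
qed

text \<open>
  The potential of the larger network is a competitor in the network without \<open>e\<close>, and loses exactly
  the energy that \<open>e\<close> dissipated.
\<close>

lemma conductance_delete:
  assumes e: "e \<in> E - B" and Q: "Q \<subseteq> B" "Q \<subseteq> E" and ne: "forests B Q \<noteq> {}"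
    and ne': "forests (insert e B) Q \<noteq> {}"
  shows "conductance (insert e B) Q
    \<le> conductance B Q - (potential B Q (src e) - potential B Q (tgt e))\<^sup>2"
proof -
  let ?v = "potential B Q"
  have "conductance (insert e B) Q \<le> energy (insert e B) ?v ?v"
    using dirichlet[of Q "insert e B" ?v] Q ne' potential_open potential_one[OF ne] potential_root
      energy_nonneg[of "insert e B"] by (auto simp: subset_iff)
  then show ?thesis using energy_insert[OF e, of ?v] conductance_energy[OF Q ne] by simp
qed

text \<open>
  Contracting \<open>e\<close> forces the potential difference across \<open>e\<close> to vanish. The new potential therefore
  differs from the old one, already on the edge \<open>e\<close> alone, by the full old difference, which is a
  lower bound for the error term in Dirichlet's principle.
\<close>

lemma conductance_contract:
  assumes e: "e \<in> E - B" and Q: "Q \<subseteq> B" "Q \<subseteq> E" and ne: "forests B Q \<noteq> {}"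
    and ne': "forests (insert e B) (insert e Q) \<noteq> {}"
  shows "conductance (insert e B) (insert e Q)
    \<ge> conductance B Q + (potential B Q (src e) - potential B Q (tgt e))\<^sup>2"
proof -
  let ?v = "potential B Q" and ?w = "potential (insert e B) (insert e Q)"
  have Q': "insert e Q \<subseteq> insert e B" "insert e Q \<subseteq> E" using Q e by auto
  have we: "?w (src e) = ?w (tgt e)" using potential_open e by auto
  have "conductance (insert e B) (insert e Q) = energy (insert e B) ?w ?w"
    using conductance_energy[OF Q' ne'] by simp
  also have "\<dots> = energy B ?w ?w" using energy_insert[OF e, of ?w] we by simp
  also have "\<dots> = conductance B Q + energy B (\<lambda>u. ?w u - ?v u) (\<lambda>u. ?w u - ?v u)"
    by (rule dirichlet[OF Q _ _ _ ne])
      (use potential_open Q potential_one[OF ne'] potential_root in \<open>auto simp: subset_iff\<close>)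
  finally show ?thesis using energy_ge_edge[OF e, of "\<lambda>u. ?w u - ?v u"] we
    by (simp add: power2_commute)
qed

lemma forests_fibre:
  assumes "B \<subseteq> B'" "F0 \<in> forests B Q"
  shows "{F. F \<in> forests B Q \<and> F \<inter> B' = F0 \<inter> B'} = forests B' (F0 \<inter> B')"
proof -
  have Q: "F0 \<inter> B = Q" using assms(2) by (simp add: forests_def)
  have "F \<inter> B = Q" if "F \<inter> B' = F0 \<inter> B'" for F
    using that assms(1) Q by blast
  then show ?thesis unfolding forests_def by blast
qed

lemma sum_forests_refine:
  assumes "B \<subseteq> B'"
  shows "(\<Sum>F\<in>forests B Q. g F)
    = (\<Sum>Q'\<in>(\<lambda>F. F \<inter> B') ` forests B Q. \<Sum>F\<in>forests B' Q'. (g F::real))"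
proof -
  have "(\<Sum>F\<in>forests B Q. g F) = (\<Sum>Q'\<in>(\<lambda>F. F \<inter> B') ` forests B Q.
      \<Sum>F\<in>{F. F \<in> forests B Q \<and> F \<inter> B' = Q'}. g F)"
    by (rule sum.image_gen) simp
  also have "\<dots> = (\<Sum>Q'\<in>(\<lambda>F. F \<inter> B') ` forests B Q. \<Sum>F\<in>forests B' Q'. g F)"
    by (rule sum.cong[OF refl]) (use forests_fibre[OF assms, of _ Q] in auto)
  finally show ?thesis .
qed

text \<open>
  The martingale property of the conductance under the uniform forest: refining the information
  splits the set of compatible trees, and weighting a conductance by its number of forests gives a
  number of trees. It is an inequality because a class of trees that is compatible with no forest does
  not contribute.
\<close>

lemma sum_conductance_le:
  assumes "B \<subseteq> B'"
  shows "(\<Sum>F\<in>forests B Q. conductance B' (F \<inter> B')) \<le> real (card (trees B Q))"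
proof -
  let ?I = "(\<lambda>F. F \<inter> B') ` forests B Q"
  have sub: "trees B' Q' \<subseteq> trees B Q" if I: "Q' \<in> ?I" for Q'
  proof
    fix T assume T: "T \<in> trees B' Q'"
    then have "T \<inter> B' = Q'" by (simp add: trees_def)
    then have "T \<inter> B = Q' \<inter> B" using assms by blast
    moreover obtain F where "F \<inter> B = Q" "Q' = F \<inter> B'" using I by (auto simp: forests_def)
    then have "Q' \<inter> B = Q" using assms by blast
    ultimately show "T \<in> trees B Q" using T by (auto simp: trees_def)
  qed
  have "(\<Sum>F\<in>forests B Q. conductance B' (F \<inter> B')) =
      (\<Sum>Q'\<in>?I. \<Sum>F\<in>forests B' Q'. conductance B' (F \<inter> B'))"
    by (rule sum_forests_refine[OF assms])
  also have "\<dots> = (\<Sum>Q'\<in>?I. \<Sum>F\<in>forests B' Q'. conductance B' Q')"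
    by (intro sum.cong refl) (auto simp: forests_def)
  also have "\<dots> \<le> (\<Sum>Q'\<in>?I. real (card (trees B' Q')))"
    by (rule sum_mono) (auto simp: conductance_def)
  also have "\<dots> = real (card (\<Union>Q'\<in>?I. trees B' Q'))"
    by (subst card_UN_disjoint) (auto simp: trees_def)
  also have "\<dots> \<le> real (card (trees B Q))"
    using sub by (intro of_nat_mono card_mono) auto
  finally show ?thesis .
qed

text \<open>
  A concave function that is quadratic up to \<open>L\<close> and constant beyond it. Evaluated along the
  conductance martingale it decreases in the mean, and in a step taken from a value below \<open>L\<close> by at
  least the downward part of the variance; so upward jumps across \<open>L\<close> do no harm.
\<close>

definition capped :: "real \<Rightarrow> real \<Rightarrow> real" where
  "capped L m = L\<^sup>2 - (max 0 (L - m))\<^sup>2"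

lemma capped_tangent_sharp:
  assumes "M < L"
  shows "capped L m \<le> capped L M + 2 * (L - M) * (m - M) - (if m \<le> M then (m - M)\<^sup>2 else 0)"
proof (cases "m \<le> L")
  case True
  then have "capped L m = capped L M + 2 * (L - M) * (m - M) - (m - M)\<^sup>2"
    using assms unfolding capped_def by (simp add: max_def power2_eq_square algebra_simps)
  then show ?thesis by simp
next
  case False
  have "(L - M) * (L - M) \<le> (L - M) * (2 * (m - M))"
    using assms False by (intro mult_left_mono) auto
  then show ?thesis
    using assms False unfolding capped_def by (simp add: max_def power2_eq_square algebra_simps)
qed

lemma capped_tangent: "capped L m \<le> capped L M + 2 * max 0 (L - M) * (m - M)"
proof (cases "M < L")
  case True
  have "capped L m \<le> capped L M + 2 * (L - M) * (m - M)"
  proof (cases "m \<le> M")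
    case m: True
    have "0 \<le> (m - M)\<^sup>2" by simp
    then show ?thesis using capped_tangent_sharp[OF True, of m] unfolding if_P[OF m] by linarith
  next
    case False then show ?thesis using capped_tangent_sharp[OF True, of m] by simp
  qed
  then show ?thesis using True by simp
next
  case False then show ?thesis by (auto simp: capped_def)
qed

lemma capped_nonneg: "0 \<le> m \<Longrightarrow> 0 < L \<Longrightarrow> 0 \<le> capped L m"
  unfolding capped_def using power_mono[of "max 0 (L - m)" L 2] by simp

lemma capped_le: 
  assumes "0 \<le> m" "0 < L" shows "capped L m \<le> 2 * L * m"
proof (cases "m \<le> L")
  case True
  then have "capped L m = 2 * L * m - m\<^sup>2" by (simp add: capped_def max_def power2_eq_square algebra_simps)
  then show ?thesis by simp
next
  case False
  have "L * L \<le> L * m" using assms False by (intro mult_left_mono) auto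
  moreover have "0 \<le> L * m" using assms by simp
  ultimately show ?thesis using False by (simp add: capped_def power2_eq_square)
qed

lemma conductance_nonneg: "conductance B Q \<ge> 0"
  by (simp add: conductance_def)

text \<open>
  Jensen's inequality for the concave function and the conductance martingale.
\<close>

lemma sum_capped_le:
  assumes "B \<subseteq> B'"
  shows "(\<Sum>F\<in>forests B Q. capped L (conductance B' (F \<inter> B')))
    \<le> real (card (forests B Q)) * capped L (conductance B Q)"
proof -
  let ?M = "conductance B Q" and ?N = "real (card (forests B Q))"
  have "(\<Sum>F\<in>forests B Q. capped L (conductance B' (F \<inter> B')))
    \<le> (\<Sum>F\<in>forests B Q. capped L ?M + 2 * max 0 (L - ?M) * (conductance B' (F \<inter> B') - ?M))"
    by (intro sum_mono capped_tangent)
  also have "\<dots> = ?N * capped L ?M + 2 * max 0 (L - ?M) * ((\<Sum>F\<in>forests B Q. conductance B' (F \<inter> B')) - ?N * ?M)"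
    by (simp add: sum.distrib sum_distrib_left[symmetric] sum_subtractf)
  also have "\<dots> \<le> ?N * capped L ?M + 2 * max 0 (L - ?M) * 0"
  proof (intro add_left_mono mult_left_mono)
    have "?N * ?M = real (card (trees B Q))" if "forests B Q \<noteq> {}"
      using that by (simp add: conductance_def)
    then show "(\<Sum>F\<in>forests B Q. conductance B' (F \<inter> B')) - ?N * ?M \<le> 0"
      using sum_conductance_le[OF assms, of Q] by (cases "forests B Q = {}") auto
  qed simp
  finally show ?thesis by simp
qed

text \<open>
  Suppose the refined information includes an edge with potential difference at least \<open>\<epsilon>\<close>. The
  conductance drops by at least \<open>\<epsilon>\<^sup>2\<close> if the edge is absent and rises by at least \<open>\<epsilon>\<^sup>2\<close> if it is
  present, with mean zero. Hence the downward part of the variance is at least \<open>\<epsilon> ^ 4\<close> times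
  either of the two probabilities, one of which is at least \<open>1/2\<close>.
\<close>

lemma sum_capped_drop:
  assumes e: "e \<in> E - B" "e \<in> B'" and BB: "B \<subseteq> B'" and Q: "Q \<subseteq> B" "Q \<subseteq> E"
    and MltL: "conductance B Q < L" and eps: "0 \<le> \<epsilon>"
    and i: "\<epsilon> \<le> \<bar>potential B Q (src e) - potential B Q (tgt e)\<bar>"
  shows "(\<Sum>F\<in>forests B Q. capped L (conductance B' (F \<inter> B')))
    \<le> real (card (forests B Q)) * (capped L (conductance B Q) - \<epsilon> ^ 4 / 2)"
proof (cases "forests B Q = {}")
  case True then show ?thesis by simp
next
  case ne: False
  let ?C = "insert e B"
  let ?F0 = "forests ?C Q" and ?F1 = "forests ?C (insert e Q)"
  let ?T0 = "real (card (trees ?C Q))" and ?T1 = "real (card (trees ?C (insert e Q)))"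
  define N N0 N1 M M0 M1
    where "N = real (card (forests B Q))" and "N0 = real (card ?F0)" and "N1 = real (card ?F1)"
    and "M = conductance B Q" and "M0 = conductance ?C Q" and "M1 = conductance ?C (insert e Q)"
  have eB: "e \<notin> B" "e \<notin> Q" using e Q by auto
  have un: "forests B Q = ?F0 \<union> ?F1" "?F0 \<inter> ?F1 = {}" using eB by (auto simp: forests_def)
  have N: "N = N0 + N1" unfolding N_def N0_def N1_def un(1) using un(2) by (subst card_Un_disjoint) auto
  have tun: "trees B Q = trees ?C Q \<union> trees ?C (insert e Q)" "trees ?C Q \<inter> trees ?C (insert e Q) = {}"
    using eB by (auto simp: trees_def)
  have TT: "N * M = ?T0 + ?T1"
  proof -
    have "N * M = real (card (trees B Q))" using ne by (simp add: N_def M_def conductance_def)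
    then show ?thesis unfolding tun(1) using tun(2) by (subst (asm) card_Un_disjoint) auto
  qed
  have pos: "N > 0" "N0 \<ge> 0" "N1 \<ge> 0" using ne by (auto simp: N_def N0_def N1_def card_gt_0_iff)
  have NM0: "N0 > 0 \<Longrightarrow> N0 * M0 = ?T0" "N1 > 0 \<Longrightarrow> N1 * M1 = ?T1"
    by (auto simp: N0_def M0_def N1_def M1_def conductance_def)
  have le0: "N0 * M0 \<le> ?T0" "N1 * M1 \<le> ?T1" using NM0 pos by (auto simp: less_eq_real_def)
  define j where "j = (potential B Q (src e) - potential B Q (tgt e))\<^sup>2"
  have j: "j \<ge> \<epsilon>\<^sup>2" unfolding j_def using i eps by (metis abs_ge_zero power2_abs power_mono)
  have j0: "\<epsilon>\<^sup>2 \<ge> 0" by simp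
  have M0: "N0 > 0 \<Longrightarrow> M0 \<le> M - \<epsilon>\<^sup>2"
    using conductance_delete[OF e(1) Q ne] j by (auto simp: N0_def M0_def M_def j_def card_gt_0_iff)
  have M1: "N1 > 0 \<Longrightarrow> M1 \<ge> M + \<epsilon>\<^sup>2"
    using conductance_contract[OF e(1) Q ne] j by (auto simp: N1_def M1_def M_def j_def card_gt_0_iff)
  have var: "N * (\<epsilon> ^ 4 / 2) \<le> N0 * (M - M0)\<^sup>2"
  proof -
    have e4: "\<epsilon> ^ 4 = \<epsilon>\<^sup>2 * \<epsilon>\<^sup>2" by (simp add: power2_eq_square power4_eq_xxxx)
    have sq: "N0 * (\<epsilon>\<^sup>2 * \<epsilon>\<^sup>2) \<le> N0 * (M - M0)\<^sup>2"
    proof (cases "N0 = 0")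
      case False
      then have d: "\<epsilon>\<^sup>2 \<le> M - M0" using M0 pos by simp
      have "\<epsilon>\<^sup>2 * \<epsilon>\<^sup>2 \<le> (M - M0)\<^sup>2"
        unfolding power2_eq_square[of "M - M0"] by (intro mult_mono) (use d j0 in linarith)+
      then show ?thesis using pos by (intro mult_left_mono) auto
    qed simp
    \<comment> \<open>The mean downward step balances the mean upward step, which is at least \<open>\<epsilon>\<^sup>2\<close> times the weight of the upward outcome.\<close>
    have bal: "N1 * \<epsilon>\<^sup>2 \<le> N0 * (M - M0)"
    proof (cases "N1 = 0")
      case True
      have "0 \<le> N0 * (M - M0)"
      proof (cases "N0 = 0")
        case False
        then have "0 \<le> M - M0" using M0 pos j0 by linarith
        then show ?thesis using pos by simp
      qed simp
      then show ?thesis using True by simp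
    next
      case False
      then have n1: "N1 > 0" using pos by simp
      have "N1 * \<epsilon>\<^sup>2 \<le> N1 * (M1 - M)" using M1[OF n1] pos by (intro mult_left_mono) auto
      also have "\<dots> = ?T1 - N1 * M" using NM0(2)[OF n1] by (simp add: algebra_simps)
      also have "\<dots> = N0 * M - ?T0" using TT N by (simp add: algebra_simps)
      also have "\<dots> \<le> N0 * (M - M0)" using le0 by (simp add: algebra_simps)
      finally show ?thesis .
    qed
    have "N1 * (\<epsilon>\<^sup>2 * \<epsilon>\<^sup>2) \<le> N0 * (M - M0)\<^sup>2"
    proof (cases "N0 = 0")
      case True
      then show ?thesis using bal pos by (cases "N1 = 0") (auto simp: mult_le_0_iff)
    next
      case False
      then have n0: "N0 > 0" using pos by simp
      have "N1 * (\<epsilon>\<^sup>2 * \<epsilon>\<^sup>2) = (N1 * \<epsilon>\<^sup>2) * \<epsilon>\<^sup>2" by simp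
      also have "\<dots> \<le> (N0 * (M - M0)) * \<epsilon>\<^sup>2" using bal by (intro mult_right_mono) auto
      also have "\<dots> \<le> (N0 * (M - M0)) * (M - M0)"
        by (intro mult_left_mono mult_nonneg_nonneg) (use M0[OF n0] n0 j0 in linarith)+
      finally show ?thesis by (simp add: power2_eq_square)
    qed
    then show ?thesis using sq unfolding e4 N by (simp add: algebra_simps)
  qed
  have Fe: "e \<notin> F \<Longrightarrow> F \<inter> ?C = F \<inter> B" "e \<in> F \<Longrightarrow> F \<inter> ?C = insert e (F \<inter> B)" for F by auto
  have CB: "?C \<subseteq> B'" using e BB by auto
  have "(\<Sum>F\<in>forests B Q. capped L (conductance B' (F \<inter> B')))
    = (\<Sum>F\<in>?F0. capped L (conductance B' (F \<inter> B'))) + (\<Sum>F\<in>?F1. capped L (conductance B' (F \<inter> B')))"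
    unfolding un(1) by (rule sum.union_disjoint) (use un(2) in auto)
  also have "\<dots> \<le> N0 * capped L M0 + N1 * capped L M1"
    unfolding N0_def N1_def M0_def M1_def by (intro add_mono sum_capped_le CB)
  also have "\<dots> \<le> N0 * (capped L M + 2 * (L - M) * (M0 - M) - (M - M0)\<^sup>2) + N1 * (capped L M + 2 * (L - M) * (M1 - M))"
  proof (rule add_mono)
    show "N0 * capped L M0 \<le> N0 * (capped L M + 2 * (L - M) * (M0 - M) - (M - M0)\<^sup>2)"
    proof (cases "N0 = 0")
      case False
      then have "M0 \<le> M" using M0 pos j0 by linarith
      then show ?thesis using capped_tangent_sharp[of M L M0] MltL pos
        by (intro mult_left_mono) (auto simp: M_def power2_commute)
    qed simp
    show "N1 * capped L M1 \<le> N1 * (capped L M + 2 * (L - M) * (M1 - M))"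
      using capped_tangent[of L M1 M] MltL pos by (intro mult_left_mono) (auto simp: M_def)
  qed
  also have "\<dots> = N * capped L M + 2 * (L - M) * (N0 * M0 + N1 * M1 - N * M) - N0 * (M - M0)\<^sup>2"
    unfolding N by (simp add: algebra_simps)
  also have "\<dots> \<le> N * capped L M + 2 * (L - M) * 0 - N * (\<epsilon> ^ 4 / 2)"
    using le0 TT MltL var by (intro diff_mono add_left_mono mult_left_mono) (auto simp: M_def)
  finally show ?thesis by (simp add: N_def M_def algebra_simps)
qed

text \<open>
  The second moment argument. \<open>B 0 \<subseteq> B 1 \<subseteq> \<dots>\<close> are revealed one after the other, and \<open>touches r\<close> is
  an event for which, as long as the conductance is below \<open>L\<close>, the next layer contains an edge with
  large potential difference. The mean of the capped conductance starts below \<open>2 * L\<close> times the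
  ratio of trees to forests and stays nonnegative, which bounds the number of such layers with
  conductance below \<open>L\<close>; the others are rare by Markov's inequality.
\<close>

lemma reach_bound:
  fixes B :: "nat \<Rightarrow> 'e set" and touches :: "nat \<Rightarrow> 'e set \<Rightarrow> bool"
  assumes BE: "\<And>r. B r \<subseteq> E" and mono: "\<And>r. B r \<subseteq> B (Suc r)"
    and L: "0 < L" and eps: "0 \<le> \<epsilon>"
    and step: "\<And>r Q. r < R \<Longrightarrow> forests (B r) Q \<noteq> {} \<Longrightarrow> touches r Q \<Longrightarrow> conductance (B r) Q < L \<Longrightarrow>
      \<exists>e\<in>B (Suc r) - B r. \<epsilon> \<le> \<bar>potential (B r) Q (src e) - potential (B r) Q (tgt e)\<bar>"
  shows "(\<Sum>r<R. real (card {F\<in>forests {} {}. touches r (F \<inter> B r)})) * (\<epsilon> ^ 4 / 2)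
    \<le> real (card (trees {} {})) * (2 * L + real R * \<epsilon> ^ 4 / (2 * L))"
proof -
  let ?FF = "forests {} {}" and ?t = "real (card (trees {} {}))"
  define \<Phi> where "\<Phi> r = (\<Sum>F\<in>?FF. capped L (conductance (B r) (F \<inter> B r)))" for r
  define low where "low r = {F\<in>?FF. touches r (F \<inter> B r) \<and> conductance (B r) (F \<inter> B r) < L}" for r
  define high where "high r = {F\<in>?FF. L \<le> conductance (B r) (F \<inter> B r)}" for r
  have one: "\<Phi> (Suc r) + real (card (low r)) * (\<epsilon> ^ 4 / 2) \<le> \<Phi> r" if r: "r < R" for r
  proof -
    let ?I = "(\<lambda>F. F \<inter> B r) ` ?FF"
    let ?c = "\<lambda>Q. if touches r Q \<and> conductance (B r) Q < L then \<epsilon> ^ 4 / 2 else 0"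
    have ind: "F \<in> forests (B r) Q \<Longrightarrow> F \<inter> B r = Q" for F Q by (auto simp: forests_def)
    have "\<Phi> (Suc r) = (\<Sum>Q\<in>?I. \<Sum>F\<in>forests (B r) Q. capped L (conductance (B (Suc r)) (F \<inter> B (Suc r))))"
      unfolding \<Phi>_def by (rule sum_forests_refine) simp
    also have "\<dots> \<le> (\<Sum>Q\<in>?I. real (card (forests (B r) Q)) * (capped L (conductance (B r) Q) - ?c Q))"
    proof (rule sum_mono)
      fix Q assume "Q \<in> ?I"
      then have Q: "Q \<subseteq> B r" "Q \<subseteq> E" using BE by auto
      show "(\<Sum>F\<in>forests (B r) Q. capped L (conductance (B (Suc r)) (F \<inter> B (Suc r))))
        \<le> real (card (forests (B r) Q)) * (capped L (conductance (B r) Q) - ?c Q)"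
      proof (cases "touches r Q \<and> conductance (B r) Q < L \<and> forests (B r) Q \<noteq> {}")
        case True
        then obtain e where "e \<in> B (Suc r) - B r" "\<epsilon> \<le> \<bar>potential (B r) Q (src e) - potential (B r) Q (tgt e)\<bar>"
          using step[OF r] by blast
        then show ?thesis using sum_capped_drop[of e "B r" "B (Suc r)" Q L \<epsilon>] BE[of "Suc r"] mono Q True eps by auto
      next
        case False
        then show ?thesis using sum_capped_le[OF mono] by (cases "forests (B r) Q = {}") auto
      qed
    qed
    also have "\<dots> = (\<Sum>Q\<in>?I. \<Sum>F\<in>forests (B r) Q. capped L (conductance (B r) (F \<inter> B r)) - ?c (F \<inter> B r))"
      using ind by (intro sum.cong refl) simp
    also have "\<dots> = (\<Sum>F\<in>?FF. capped L (conductance (B r) (F \<inter> B r)) - ?c (F \<inter> B r))"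
      by (rule sum_forests_refine[symmetric]) simp
    also have "\<dots> = \<Phi> r - (\<Sum>F\<in>?FF. ?c (F \<inter> B r))" by (simp add: \<Phi>_def sum_subtractf)
    also have "(\<Sum>F\<in>?FF. ?c (F \<inter> B r)) = (\<Sum>F\<in>low r. \<epsilon> ^ 4 / 2)"
      unfolding low_def by (intro sum.mono_neutral_cong_right) auto
    finally show ?thesis by simp
  qed
  have tele: "\<Phi> n + (\<Sum>r<n. real (card (low r))) * (\<epsilon> ^ 4 / 2) \<le> \<Phi> 0" if "n \<le> R" for n
    using that
  proof (induction n)
    case (Suc n) then show ?case using one[of n] by (simp add: algebra_simps)
  qed simp
  have sc: "(\<Sum>F\<in>?FF. conductance (B r) (F \<inter> B r)) \<le> ?t" for r by (rule sum_conductance_le) simp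
  have "\<Phi> 0 \<le> (\<Sum>F\<in>?FF. 2 * L * conductance (B 0) (F \<inter> B 0))"
    unfolding \<Phi>_def by (intro sum_mono capped_le conductance_nonneg L)
  also have "\<dots> \<le> 2 * L * ?t" unfolding sum_distrib_left[symmetric] using sc L by simp
  finally have P0: "\<Phi> 0 \<le> 2 * L * ?t" .
  have PR: "\<Phi> R \<ge> 0" unfolding \<Phi>_def by (intro sum_nonneg capped_nonneg conductance_nonneg L)
  have hi: "real (card (high r)) \<le> ?t / L" for r
  proof -
    have "real (card (high r)) * L = (\<Sum>F\<in>high r. L)" by simp
    also have "\<dots> \<le> (\<Sum>F\<in>high r. conductance (B r) (F \<inter> B r))" by (rule sum_mono) (auto simp: high_def)
    also have "\<dots> \<le> (\<Sum>F\<in>?FF. conductance (B r) (F \<inter> B r))"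
      by (rule sum_mono2) (auto simp: high_def conductance_nonneg)
    also have "\<dots> \<le> ?t" by (rule sc)
    finally show ?thesis using L by (simp add: field_simps)
  qed
  have "real (card {F\<in>?FF. touches r (F \<inter> B r)}) \<le> real (card (low r)) + ?t / L" for r
  proof -
    have "{F\<in>?FF. touches r (F \<inter> B r)} \<subseteq> low r \<union> high r" by (auto simp: low_def high_def)
    then have "card {F\<in>?FF. touches r (F \<inter> B r)} \<le> card (low r \<union> high r)"
      by (intro card_mono) (auto simp: low_def high_def)
    also have "\<dots> \<le> card (low r) + card (high r)" by (rule card_Un_le)
    finally show ?thesis using hi[of r] by simp
  qed
  then have "(\<Sum>r<R. real (card {F\<in>?FF. touches r (F \<inter> B r)})) \<le> (\<Sum>r<R. real (card (low r)) + ?t / L)"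
    by (intro sum_mono) auto
  also have "\<dots> = (\<Sum>r<R. real (card (low r))) + real R * (?t / L)" by (simp add: sum.distrib)
  finally have "(\<Sum>r<R. real (card {F\<in>?FF. touches r (F \<inter> B r)})) * (\<epsilon> ^ 4 / 2)
    \<le> ((\<Sum>r<R. real (card (low r))) + real R * (?t / L)) * (\<epsilon> ^ 4 / 2)"
    using eps by (intro mult_right_mono) auto
  also have "\<dots> \<le> 2 * L * ?t + real R * (?t / L) * (\<epsilon> ^ 4 / 2)"
    using tele[of R] PR P0 by (simp add: distrib_right)
  finally show ?thesis by (simp add: algebra_simps)
qed

end

section \<open>A trace inequality in half-spaces of the lattice\<close>

lemma card_vec_Collect:
  assumes "\<And>m. finite (S m)"
  shows "finite {u :: 'a ^ 'd::finite. \<forall>m. u $ m \<in> S m}"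
    and "card {u :: 'a ^ 'd. \<forall>m. u $ m \<in> S m} = (\<Prod>m\<in>UNIV. card (S m))"
proof -
  have b: "bij_betw (\<lambda>u. \<lambda>m. u $ m) {u :: 'a ^ 'd. \<forall>m. u $ m \<in> S m} (PiE UNIV S)"
    by (rule bij_betw_byWitness[where f' = "\<lambda>g. \<chi> m. g m"]) auto
  show "finite {u :: 'a ^ 'd::finite. \<forall>m. u $ m \<in> S m}"
    using bij_betw_finite[OF b] assms by (simp add: finite_PiE)
  show "card {u :: 'a ^ 'd. \<forall>m. u $ m \<in> S m} = (\<Prod>m\<in>UNIV. card (S m))"
    using bij_betw_same_card[OF b] by (simp add: card_PiE)
qed

text \<open>
  The counting device behind the trace estimate: summands reached from several parameters are
  grouped, and \<open>N\<close> bounds the number of parameters in a group.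
\<close>

lemma sum_fibres_le:
  fixes g :: "'b \<Rightarrow> real"
  assumes fin: "finite X" and nn: "\<And>y. 0 \<le> g y"
    and fib: "\<And>y. real (card {t\<in>X. \<phi> t = y}) \<le> N"
    and tot: "(\<Sum>y\<in>\<phi> ` X. g y) \<le> S" and N: "0 \<le> N"
  shows "(\<Sum>t\<in>X. g (\<phi> t)) \<le> N * S"
proof -
  have "(\<Sum>t\<in>X. g (\<phi> t)) = (\<Sum>y\<in>\<phi> ` X. \<Sum>t\<in>{t\<in>X. \<phi> t = y}. g (\<phi> t))"
    by (rule sum.image_gen[OF fin])
  also have "\<dots> = (\<Sum>y\<in>\<phi> ` X. real (card {t\<in>X. \<phi> t = y}) * g y)"
    by (rule sum.cong) auto
  also have "\<dots> \<le> (\<Sum>y\<in>\<phi> ` X. N * g y)"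
    by (intro sum_mono mult_right_mono fib nn)
  also have "\<dots> \<le> N * S" unfolding sum_distrib_left[symmetric] using tot N by (rule mult_left_mono)
  finally show ?thesis .
qed

text \<open>
  A coordinate direction \<open>i0\<close> with a sign, and the half-spaces \<open>{y. c < level y}\<close>. Boxes are built in
  the positive direction of all coordinates but \<open>i0\<close>, and in direction \<open>\<sigma>\<close> of the coordinate \<open>i0\<close>, so
  that they never leave the half-space in which they start.
\<close>

locale half_space =
  fixes i0 :: "'d::finite" and \<sigma> :: int
  assumes sg: "\<sigma> = 1 \<or> \<sigma> = -1"
begin

definition level :: "int ^ 'd \<Rightarrow> int" where "level y = \<sigma> * y $ i0"

definition dir :: "'d \<Rightarrow> int" where "dir m = (if m = i0 then \<sigma> else 1)"

definition shift :: "'d \<Rightarrow> nat \<Rightarrow> int ^ 'd" where "shift i n = axis i (int n * dir i)"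

lemma dir_sq: "dir m * dir m = 1" "dir m \<noteq> 0"
  using sg by (auto simp: dir_def)

lemma shift_nth: "shift i n $ m = (if m = i then int n * dir i else 0)"
  by (simp add: shift_def axis_def)

lemma shift_0 [simp]: "shift i 0 = 0"
  by (simp add: vec_eq_iff shift_nth)

lemma shift_add: "shift i (m + n) = shift i m + shift i n"
  by (simp add: vec_eq_iff shift_nth distrib_right)

lemma level_add: "level (a + b) = level a + level b"
  by (simp add: level_def distrib_left)

lemma level_shift: "level (shift i n) = (if i = i0 then int n else 0)"
  using dir_sq(1)[of i0] by (auto simp: level_def shift_nth dir_def)

definition box :: "('d \<Rightarrow> nat) \<Rightarrow> (int ^ 'd) set" where
  "box n = {u. \<forall>m. u $ m \<in> (\<lambda>k. int k * dir m) ` {..<n m}}"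

lemma inj_dir: "inj_on (\<lambda>k. int k * dir m) K"
  using dir_sq(2)[of m] by (auto simp: inj_on_def)

lemma finite_box [simp]: "finite (box n)"
  unfolding box_def by (rule card_vec_Collect) simp

lemma card_box: "card (box n) = (\<Prod>m\<in>UNIV. n m)"
  unfolding box_def by (subst card_vec_Collect(2)) (simp_all add: card_image inj_dir)

lemma level_box: "u \<in> box n \<Longrightarrow> 0 \<le> level u"
  using dir_sq(1)[of i0] unfolding box_def level_def
  by (auto simp: dir_def dest!: spec[of _ i0]) (metis mult.commute mult.left_commute mult.right_neutral of_nat_0_le_iff)

text \<open>
  A hyperplane meets at most a proportion \<open>1 / n i0\<close> of a box. This is where it enters that the
  set in the trace estimate lies in a hyperplane.
\<close>

lemma card_box_slice:
  "real (card {u \<in> box n. u $ i0 = w}) * real (n i0) \<le> real (card (box n))"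
proof -
  have "{u \<in> box n. u $ i0 = w} \<subseteq> {u. \<forall>m. u $ m \<in> (if m = i0 then {w} else (\<lambda>k. int k * dir m) ` {..<n m})}"
    by (auto simp: box_def)
  then have "card {u \<in> box n. u $ i0 = w} \<le> card {u :: int ^ 'd. \<forall>m. u $ m \<in> (if m = i0 then {w} else (\<lambda>k. int k * dir m) ` {..<n m})}"
    by (intro card_mono card_vec_Collect) auto
  also have "\<dots> = (\<Prod>m\<in>UNIV. card (if m = i0 then {w} else (\<lambda>k. int k * dir m) ` {..<n m}))"
    by (rule card_vec_Collect) auto
  also have "\<dots> = (\<Prod>m\<in>UNIV. if m = i0 then 1 else n m)"
    by (rule prod.cong) (auto simp: card_image inj_dir)
  also have "\<dots> = (\<Prod>m\<in>UNIV - {i0}. n m)"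
    by (subst prod.remove[of _ i0]) (auto intro!: prod.cong)
  finally have "card {u \<in> box n. u $ i0 = w} * n i0 \<le> (\<Prod>m\<in>UNIV - {i0}. n m) * n i0" by simp
  also have "\<dots> = card (box n)" unfolding card_box by (subst (2) prod.remove[of _ i0]) auto
  finally show ?thesis by (metis of_nat_le_iff of_nat_mult)
qed

lemma box_double:
  fixes n :: "'d \<Rightarrow> nat" and i :: 'd
  defines "n' \<equiv> n(i := 2 * n i)"
  shows "box n' = box n \<union> (\<lambda>u. u + shift i (n i)) ` box n"
    and "box n \<inter> (\<lambda>u. u + shift i (n i)) ` box n = {}"
proof -
  have bi: "u $ i = int k * dir i \<Longrightarrow> u $ i = int k' * dir i \<Longrightarrow> k = k'" for u :: "int ^ 'd" and k k'
    using dir_sq(2)[of i] by auto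
  show "box n' = box n \<union> (\<lambda>u. u + shift i (n i)) ` box n"
  proof (intro equalityI subsetI)
    fix u assume u: "u \<in> box n'"
    then obtain k where k: "k < 2 * n i" "u $ i = int k * dir i" by (auto simp: box_def n'_def dest!: spec[of _ i])
    show "u \<in> box n \<union> (\<lambda>u. u + shift i (n i)) ` box n"
    proof (cases "k < n i")
      case True
      then have "u \<in> box n" using u k unfolding box_def n'_def by (auto split: if_splits)
      then show ?thesis by simp
    next
      case False
      have "(u - shift i (n i)) $ m \<in> (\<lambda>k. int k * dir m) ` {..<n m}" for m
      proof (cases "m = i")
        case True
        have "(u - shift i (n i)) $ i = int (k - n i) * dir i"
          using k False by (simp add: shift_nth of_nat_diff left_diff_distrib)
        then show ?thesis unfolding True by (rule image_eqI) (use k False in auto)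
      next
        case m: False then show ?thesis using u by (auto simp: box_def n'_def shift_nth dest!: spec[of _ m])
      qed
      then have "u - shift i (n i) \<in> box n" by (simp add: box_def)
      then show ?thesis by (intro UnI2) (metis (no_types, lifting) diff_add_cancel imageI)
    qed
  next
    fix u assume "u \<in> box n \<union> (\<lambda>u. u + shift i (n i)) ` box n"
    then consider "u \<in> box n" | w where "w \<in> box n" "u = w + shift i (n i)" by auto
    then show "u \<in> box n'"
    proof cases
      case 1
      have "u $ m \<in> (\<lambda>k. int k * dir m) ` {..<n' m}" for m
        using 1 unfolding box_def n'_def by (auto dest!: spec[of _ m])
      then show ?thesis by (simp add: box_def)
    next
      case 2
      have "u $ m \<in> (\<lambda>k. int k * dir m) ` {..<n' m}" for m
      proof (cases "m = i")
        case True
        obtain k where "k < n i" "w $ i = int k * dir i" using 2 by (auto simp: box_def dest!: spec[of _ i])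
        then have "u $ i = int (k + n i) * dir i" "k + n i < 2 * n i" using 2 by (auto simp: shift_nth distrib_right)
        then show ?thesis unfolding True n'_def by (intro image_eqI[of _ _ "k + n i"]) auto
      next
        case False then show ?thesis using 2 by (auto simp: box_def n'_def shift_nth dest!: spec[of _ m])
      qed
      then show ?thesis by (simp add: box_def)
    qed
  qed
  show "box n \<inter> (\<lambda>u. u + shift i (n i)) ` box n = {}"
  proof (rule ccontr)
    assume "box n \<inter> (\<lambda>u. u + shift i (n i)) ` box n \<noteq> {}"
    then obtain w where w: "w \<in> box n" "w + shift i (n i) \<in> box n" by auto
    obtain k where "w $ i = int k * dir i" using w(1) by (auto simp: box_def dest!: spec[of _ i])
    moreover obtain k' where "k' < n i" "(w + shift i (n i)) $ i = int k' * dir i" using w(2) by (auto simp: box_def dest!: spec[of _ i])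
    ultimately have "int k' * dir i = int (k + n i) * dir i" "k' < n i" by (auto simp: shift_nth distrib_right)
    then show False using dir_sq(2)[of i] by (metis mult_cancel_right not_add_less2 of_nat_eq_iff)
  qed
qed

definition avg :: "('d \<Rightarrow> nat) \<Rightarrow> (int ^ 'd \<Rightarrow> real) \<Rightarrow> int ^ 'd \<Rightarrow> real" where
  "avg n f a = (\<Sum>u\<in>box n. f (a + u)) / real (card (box n))"

lemma avg_double:
  "avg n f a - avg (n(i := 2 * n i)) f a = (avg n f a - avg n f (a + shift i (n i))) / 2"
proof -
  let ?n' = "n(i := 2 * n i)"
  have inj: "inj_on (\<lambda>u. u + shift i (n i)) (box n)" by (auto simp: inj_on_def)
  have "(\<Sum>u\<in>box ?n'. f (a + u)) = (\<Sum>u\<in>box n. f (a + u)) + (\<Sum>u\<in>box n. f (a + shift i (n i) + u))"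
    unfolding box_double(1) by (subst sum.union_disjoint)
      (use box_double(2) in \<open>auto simp: sum.reindex[OF inj] algebra_simps\<close>)
  moreover have "card (box ?n') = 2 * card (box n)"
    unfolding box_double(1) by (subst card_Un_disjoint) (use box_double(2) in \<open>auto simp: card_image[OF inj]\<close>)
  ultimately show ?thesis unfolding avg_def by (simp add: add_divide_distrib field_simps)
qed

text \<open>
  The edges of the half-space above level \<open>c\<close>, with those that lead from the hyperplane into it but
  without those inside the hyperplane, each edge given by its lower endpoint and its direction.
\<close>

definition upper :: "int \<Rightarrow> ((int ^ 'd) \<times> 'd) set" where
  "upper c = {(z, i). c < level z \<or> (level z = c \<and> i = i0)}"

definition sqgrad :: "(int ^ 'd \<Rightarrow> real) \<Rightarrow> (int ^ 'd) \<times> 'd \<Rightarrow> real" where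
  "sqgrad f = (\<lambda>(z, i). (f z - f (z + shift i 1))\<^sup>2)"

lemma sqgrad_nonneg: "0 \<le> sqgrad f y"
  unfolding sqgrad_def by (cases y) simp

lemma shift_diff_sq:
  "(f z - f (z + shift i n))\<^sup>2 \<le> real n * (\<Sum>s<n. sqgrad f (z + shift i s, i))"
proof -
  have "f z - f (z + shift i n) = (\<Sum>s<n. f (z + shift i s) - f (z + shift i (Suc s)))"
    using sum_lessThan_telescope'[of "\<lambda>s. f (z + shift i s)" n] by simp
  also have "\<dots>\<^sup>2 \<le> (\<Sum>s<n. (f (z + shift i s) - f (z + shift i (Suc s)))\<^sup>2) * real (card {..<n})"
    by (rule sum_squared_le_sum_of_squares)
  also have "(\<Sum>s<n. (f (z + shift i s) - f (z + shift i (Suc s)))\<^sup>2) = (\<Sum>s<n. sqgrad f (z + shift i s, i))"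
  proof (rule sum.cong[OF refl])
    fix s
    have "z + shift i (Suc s) = z + shift i s + shift i 1"
      using shift_add[of i s 1] by (metis Suc_eq_plus1 add.assoc)
    then show "(f (z + shift i s) - f (z + shift i (Suc s)))\<^sup>2 = sqgrad f (z + shift i s, i)"
      by (simp only: sqgrad_def prod.case)
  qed
  finally show ?thesis by (simp add: mult.commute)
qed

lemma avg_shift_sq:
  assumes "card (box n) > 0"
  shows "(avg n f a - avg n f (a + shift i l))\<^sup>2
    \<le> real l / real (card (box n)) * (\<Sum>u\<in>box n. \<Sum>s<l. sqgrad f (a + u + shift i s, i))"
proof -
  let ?c = "real (card (box n))"
  have c: "?c > 0" using assms by simp
  have "avg n f a - avg n f (a + shift i l) = (\<Sum>u\<in>box n. f (a + u) - f (a + u + shift i l)) / ?c"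
    unfolding avg_def by (simp add: sum_subtractf diff_divide_distrib algebra_simps)
  then have "(avg n f a - avg n f (a + shift i l))\<^sup>2 = (\<Sum>u\<in>box n. f (a + u) - f (a + u + shift i l))\<^sup>2 / ?c\<^sup>2"
    by (simp add: power_divide)
  also have "\<dots> \<le> ((\<Sum>u\<in>box n. (f (a + u) - f (a + u + shift i l))\<^sup>2) * ?c) / ?c\<^sup>2"
    by (intro divide_right_mono sum_squared_le_sum_of_squares) auto
  also have "\<dots> = (\<Sum>u\<in>box n. (f (a + u) - f (a + u + shift i l))\<^sup>2) / ?c"
    using c by (simp add: power2_eq_square)
  also have "\<dots> \<le> (\<Sum>u\<in>box n. real l * (\<Sum>s<l. sqgrad f (a + u + shift i s, i))) / ?c"
    by (intro divide_right_mono sum_mono shift_diff_sq) auto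
  finally show ?thesis by (simp add: sum_distrib_left sum_divide_distrib)
qed

text \<open>
  By the Cauchy-Schwarz inequality the squared difference of two box averages is at most a mean of
  squared gradients along the connecting segments. Summed over the points of \<open>A\<close>, an edge is used by
  at most \<open>n i\<close> parameters per point of \<open>A\<close> (the position on the segment determines the point of the
  box), and by at most \<open>n i\<close> times a hyperplane slice of the box, since points of \<open>A\<close> have fixed
  level. The first count is the better one for boxes that are large compared with \<open>A\<close>, the second
  one for small boxes.
\<close>

lemma avg_shift_sum_sq:
  fixes A :: "(int ^ 'd) set"
  assumes fin: "finite A" and lev: "\<And>a. a \<in> A \<Longrightarrow> level a = c'" and c': "c < c'"
    and En: "\<And>X. finite X \<Longrightarrow> X \<subseteq> upper c \<Longrightarrow> (\<Sum>y\<in>X. sqgrad f y) \<le> En"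
    and n: "\<And>m. 0 < N \<and> N \<le> n m \<and> n m \<le> 2 * N"
  shows "(\<Sum>a\<in>A. (avg n f a - avg n f (a + shift i (n i)))\<^sup>2)
    \<le> 4 * min (real N) (real (card A) * real N ^ 2 / real N ^ CARD('d)) * En"
proof -
  let ?c = "real (card (box n))" and ?l = "n i"
  have cN: "?c \<ge> real N ^ CARD('d)"
  proof -
    have "(\<Prod>m\<in>(UNIV::'d set). N) \<le> (\<Prod>m\<in>UNIV. n m)" by (rule prod_mono) (use n in auto)
    then have "N ^ CARD('d) \<le> card (box n)" by (simp add: card_box)
    then show ?thesis by (metis of_nat_le_iff of_nat_power)
  qed
  have Npos: "N > 0" using n by auto
  then have cpos: "?c > 0" using cN by (smt (verit) of_nat_0_less_iff zero_less_power)
  have En0: "0 \<le> En" using En[of "{}"] by simp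
  define X where "X = A \<times> box n \<times> {..<?l}"
  define \<phi> where "\<phi> = (\<lambda>(a, u, s). (a + u + shift i s, i))"
  have finX: "finite X" using fin by (simp add: X_def)
  have "\<phi> ` X \<subseteq> upper c"
    using lev c' level_box by (fastforce simp: \<phi>_def X_def upper_def level_add level_shift)
  then have tot: "(\<Sum>y\<in>\<phi> ` X. sqgrad f y) \<le> En" using finX by (intro En) auto
  have fib1: "real (card {t\<in>X. \<phi> t = y}) \<le> real (card A) * real ?l" for y
  proof -
    have "card {t\<in>X. \<phi> t = y} \<le> card (A \<times> {..<?l})"
      by (rule card_inj_on_le[where f = "\<lambda>(a,u,s). (a,s)"]) (auto simp: X_def \<phi>_def inj_on_def fin)
    then show ?thesis by (simp add: card_cartesian_product flip: of_nat_mult)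
  qed
  have fib2: "real (card {t\<in>X. \<phi> t = y}) \<le> real ?l * (?c / real N)" for y
  proof -
    obtain z i' where y: "y = (z, i')" by force
    define w where "w s = \<sigma> * (level (z - shift i s) - c')" for s
    have "card {t\<in>X. \<phi> t = y} \<le> card (SIGMA s:{..<?l}. {u\<in>box n. u $ i0 = w s})"
    proof (rule card_inj_on_le[where f = "\<lambda>(a,u,s). (s,u)"])
      show "(\<lambda>(a, u, s). (s, u)) ` {t \<in> X. \<phi> t = y} \<subseteq> (SIGMA s:{..<?l}. {u \<in> box n. u $ i0 = w s})"
      proof
        fix q assume "q \<in> (\<lambda>(a, u, s). (s, u)) ` {t \<in> X. \<phi> t = y}"
        then obtain a u s where t: "(a, u, s) \<in> X" "\<phi> (a, u, s) = y" and q: "q = (s, u)" by auto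
        then have "z - shift i s = a + u" by (auto simp: \<phi>_def y)
        then have "level (z - shift i s) - c' = level u" using t lev by (auto simp: X_def level_add)
        then have "w s = u $ i0" using sg by (auto simp: w_def level_def)
        then show "q \<in> (SIGMA s:{..<?l}. {u \<in> box n. u $ i0 = w s})" using t q by (auto simp: X_def)
      qed
    qed (auto simp: X_def \<phi>_def inj_on_def)
    also have "\<dots> = (\<Sum>s<?l. card {u\<in>box n. u $ i0 = w s})" by (subst card_SigmaI) auto
    finally have "real (card {t\<in>X. \<phi> t = y}) \<le> real (\<Sum>s<?l. card {u\<in>box n. u $ i0 = w s})"
      by (rule of_nat_mono)
    then have "real (card {t\<in>X. \<phi> t = y}) \<le> (\<Sum>s<?l. real (card {u\<in>box n. u $ i0 = w s}))"
      unfolding of_nat_sum .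
    also have "\<dots> \<le> (\<Sum>s<?l. ?c / real N)"
    proof (rule sum_mono)
      fix s
      have "real (card {u\<in>box n. u $ i0 = w s}) * real N \<le> real (card {u\<in>box n. u $ i0 = w s}) * real (n i0)"
        using n by (intro mult_left_mono) auto
      then have "real (card {u\<in>box n. u $ i0 = w s}) * real N \<le> ?c" using card_box_slice[of n "w s"] by linarith
      then show "real (card {u\<in>box n. u $ i0 = w s}) \<le> ?c / real N" using Npos by (simp add: field_simps)
    qed
    finally show ?thesis by simp
  qed
  have fib: "real (card {t\<in>X. \<phi> t = y}) \<le> real ?l * min (real (card A)) (?c / real N)" for y
    using fib1[of y] fib2[of y] by (auto simp: min_def mult.commute)
  have "(\<Sum>a\<in>A. (avg n f a - avg n f (a + shift i ?l))\<^sup>2)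
    \<le> (\<Sum>a\<in>A. real ?l / ?c * (\<Sum>u\<in>box n. \<Sum>s<?l. sqgrad f (a + u + shift i s, i)))"
    using cpos by (intro sum_mono avg_shift_sq) auto
  also have "\<dots> = real ?l / ?c * (\<Sum>t\<in>X. sqgrad f (\<phi> t))"
    unfolding X_def \<phi>_def by (simp add: sum_distrib_left sum.cartesian_product split_def)
  also have "\<dots> \<le> real ?l / ?c * (real ?l * min (real (card A)) (?c / real N) * En)"
  proof (rule mult_left_mono)
    show "(\<Sum>t\<in>X. sqgrad f (\<phi> t)) \<le> real ?l * min (real (card A)) (?c / real N) * En"
      by (rule sum_fibres_le[OF finX sqgrad_nonneg fib tot]) auto
  qed (use cpos in auto)
  also have "\<dots> = (real ?l * real ?l) * (min (real (card A)) (?c / real N) / ?c) * En" by simp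
  also have "\<dots> \<le> (4 * (real N * real N)) * (min (real (card A)) (?c / real N) / ?c) * En"
  proof -
    have "real ?l \<le> 2 * real N" using n[of i] by linarith
    then have "real ?l * real ?l \<le> (2 * real N) * (2 * real N)" by (intro mult_mono) auto
    then show ?thesis using cpos En0 by (intro mult_right_mono divide_nonneg_nonneg) auto
  qed
  also have "\<dots> \<le> 4 * min (real N) (real (card A) * real N ^ 2 / real N ^ CARD('d)) * En"
  proof (intro mult_right_mono En0)
    let ?P = "real N * real N * (min (real (card A)) (?c / real N) / ?c)"
    have "?P \<le> real N * real N * ((?c / real N) / ?c)"
      using cpos by (intro mult_left_mono divide_right_mono) auto
    also have "\<dots> = real N" using cpos Npos by auto
    finally have 1: "?P \<le> real N" .
    have "?P \<le> real N * real N * (real (card A) / real N ^ CARD('d))"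
      using cpos cN Npos by (intro mult_left_mono frac_le) auto
    also have "\<dots> = real (card A) * real N ^ 2 / real N ^ CARD('d)" by (simp add: power2_eq_square)
    finally have 2: "?P \<le> real (card A) * real N ^ 2 / real N ^ CARD('d)" .
    have "4 * ?P \<le> 4 * min (real N) (real (card A) * real N ^ 2 / real N ^ CARD('d))"
      using 1 2 by simp
    then show "4 * (real N * real N) * (min (real (card A)) (?c / real N) / ?c)
      \<le> 4 * min (real N) (real (card A) * real N ^ 2 / real N ^ CARD('d))"
      by (simp only: mult.assoc)
  qed
  finally show ?thesis .
qed

lemma avg_one: "avg (\<lambda>_. 1) f a = f a"
proof -
  have "box (\<lambda>_. 1) = {0}" by (auto simp: box_def vec_eq_iff)
  then show ?thesis by (simp add: avg_def)
qed

text \<open>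
  The side length is doubled one coordinate at a time; meanwhile all side lengths are between \<open>N\<close>
  and \<open>2 * N\<close>.
\<close>

lemma avg_double_norm:
  fixes A :: "(int ^ 'd) set"
  assumes fin: "finite A" and lev: "\<And>a. a \<in> A \<Longrightarrow> level a = c'" and c': "c < c'"
    and En: "\<And>X. finite X \<Longrightarrow> X \<subseteq> upper c \<Longrightarrow> (\<Sum>y\<in>X. sqgrad f y) \<le> En"
    and N: "0 < N"
  shows "L2_set (\<lambda>a. avg (\<lambda>_. N) f a - avg (\<lambda>_. 2 * N) f a) A
    \<le> real CARD('d) * sqrt (min (real N) (real (card A) * real N ^ 2 / real N ^ CARD('d)) * En)"
proof -
  define \<beta> where "\<beta> = sqrt (min (real N) (real (card A) * real N ^ 2 / real N ^ CARD('d)) * En)"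
  define n where "n S = (\<lambda>m. if m \<in> S then 2 * N else N)" for S :: "'d set"
  have "L2_set (\<lambda>a. avg (n {}) f a - avg (n S) f a) A \<le> real (card S) * \<beta>" if "finite S" for S
    using that
  proof (induction S rule: finite_induct)
    case (insert i S)
    have upd: "n (insert i S) = (n S)(i := 2 * n S i)" using insert.hyps by (auto simp: n_def)
    have "(\<Sum>a\<in>A. (avg (n S) f a - avg (n S) f (a + shift i (n S i)))\<^sup>2) \<le> 4 * \<beta>\<^sup>2"
    proof -
      have "0 \<le> En" using En[of "{}"] by simp
      then have "\<beta>\<^sup>2 = min (real N) (real (card A) * real N ^ 2 / real N ^ CARD('d)) * En"
        unfolding \<beta>_def by (intro real_sqrt_pow2 mult_nonneg_nonneg) auto
      moreover have "(\<Sum>a\<in>A. (avg (n S) f a - avg (n S) f (a + shift i (n S i)))\<^sup>2)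
        \<le> 4 * min (real N) (real (card A) * real N ^ 2 / real N ^ CARD('d)) * En"
        by (rule avg_shift_sum_sq[OF fin lev c' En]) (use N in \<open>auto simp: n_def\<close>)
      ultimately show ?thesis by (simp only: mult.assoc)
    qed
    then have "(\<Sum>a\<in>A. (avg (n S) f a - avg (n (insert i S)) f a)\<^sup>2) \<le> \<beta>\<^sup>2"
      unfolding upd avg_double by (simp add: power_divide flip: sum_divide_distrib)
    then have "L2_set (\<lambda>a. avg (n S) f a - avg (n (insert i S)) f a) A \<le> sqrt (\<beta>\<^sup>2)"
      unfolding L2_set_def by (rule real_sqrt_le_mono)
    moreover have "0 \<le> \<beta>" using En[of "{}"] by (simp add: \<beta>_def)
    ultimately have step: "L2_set (\<lambda>a. avg (n S) f a - avg (n (insert i S)) f a) A \<le> \<beta>" by simp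
    have "L2_set (\<lambda>a. avg (n {}) f a - avg (n (insert i S)) f a) A
        = L2_set (\<lambda>a. (avg (n {}) f a - avg (n S) f a) + (avg (n S) f a - avg (n (insert i S)) f a)) A"
      by simp
    also have "\<dots> \<le> L2_set (\<lambda>a. avg (n {}) f a - avg (n S) f a) A + L2_set (\<lambda>a. avg (n S) f a - avg (n (insert i S)) f a) A"
      by (rule L2_set_triangle_ineq)
    also have "\<dots> \<le> real (card S) * \<beta> + \<beta>" using insert.IH step by simp
    finally show ?case using insert.hyps by (simp add: algebra_simps)
  qed (simp add: L2_set_def)
  from this[of UNIV] show ?thesis by (simp add: n_def \<beta>_def)
qed

text \<open>
  The two bounds balance at the scale \<open>2 ^ J\<close> at which a cube in the hyperplane has as many points
  as \<open>A\<close>. Away from it the terms decay geometrically on both sides: with ratio \<open>sqrt (1/2)\<close> below it,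
  and above it with ratio \<open>2 powr ((2 - d) / 2)\<close>, which is where \<open>d > 2\<close> is used. The ratio \<open>3/4\<close>
  is a convenient rational number above \<open>sqrt (1/2)\<close>.
\<close>

lemma dyadic_weight:
  assumes d: "CARD('d) > 2" and k: "real k \<le> (2 ^ J) ^ (CARD('d) - 1)"
  shows "sqrt (min (2 ^ j) (real k * (2 ^ j)\<^sup>2 / (2 ^ j) ^ CARD('d)))
    \<le> sqrt (2 ^ J) * (if j < J then (3/4) ^ (J - j) else (3/4) ^ (j - J))"
proof -
  have aux: "sqrt x \<le> sqrt (2 ^ J) * (3/4) ^ l" if "x \<le> 2 ^ J * (1/2) ^ l" for x l
  proof -
    have "(1/2::real) ^ l \<le> ((3/4) ^ l)\<^sup>2"
      unfolding power_mult[symmetric] mult.commute[of l 2] unfolding power_mult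
      by (intro power_mono) (auto simp: power2_eq_square)
    then have "x \<le> 2 ^ J * ((3/4) ^ l)\<^sup>2" using that by (smt (verit) mult_left_mono zero_le_power)
    then have "sqrt x \<le> sqrt (2 ^ J * ((3/4) ^ l)\<^sup>2)" by (rule real_sqrt_le_mono)
    then show ?thesis by (simp add: real_sqrt_mult)
  qed
  show ?thesis
  proof (cases "j < J")
    case True
    have "(2::real) ^ J = 2 ^ j * 2 ^ (J - j)" using True by (simp flip: power_add)
    then have "(2::real) ^ j = 2 ^ J * (1/2) ^ (J - j)" by (simp add: power_divide)
    then show ?thesis using True aux[of "min (2 ^ j) (real k * (2 ^ j)\<^sup>2 / (2 ^ j) ^ CARD('d))" "J - j"] by simp
  next
    case False
    then obtain l where l: "j = J + l" using le_Suc_ex by (metis not_less)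
    obtain d' where d': "CARD('d) = 3 + d'" using le_Suc_ex[of 3 "CARD('d)"] d by auto
    have "real k * (2 ^ j)\<^sup>2 \<le> (2 ^ J) ^ (CARD('d) - 1) * (2 ^ j)\<^sup>2" using k by (intro mult_right_mono) auto
    also have "\<dots> = 2 ^ (J * (CARD('d) - 1) + 2 * j)" by (simp add: power_add mult.commute flip: power_mult)
    also have "\<dots> * 2 ^ l \<le> 2 ^ J * (2 ^ j) ^ CARD('d)"
    proof -
      have "J * (CARD('d) - 1) + 2 * j + l \<le> J + j * CARD('d)" unfolding l d' by (simp add: algebra_simps)
      then have "(2::real) ^ (J * (CARD('d) - 1) + 2 * j + l) \<le> 2 ^ (J + j * CARD('d))" by (intro power_increasing) auto
      then show ?thesis by (simp add: power_add power_mult)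
    qed
    finally have "real k * (2 ^ j)\<^sup>2 * 2 ^ l \<le> 2 ^ J * (2 ^ j) ^ CARD('d)" by simp
    then have "real k * (2 ^ j)\<^sup>2 / (2 ^ j) ^ CARD('d) \<le> 2 ^ J * (1/2) ^ l"
      by (simp add: field_simps power_divide)
    then show ?thesis using False l aux[of "min (2 ^ j) (real k * (2 ^ j)\<^sup>2 / (2 ^ j) ^ CARD('d))" l] by simp
  qed
qed

lemma geometric_tent: "(\<Sum>j<n. if j < J then (3/4::real) ^ (J - j) else (3/4) ^ (j - J)) \<le> 8"
proof -
  have geo: "(\<Sum>l<m. (3/4::real) ^ l) \<le> 4" for m by (simp add: geometric_sum)
  have "(\<Sum>j<n. if j < J then (3/4::real) ^ (J - j) else (3/4) ^ (j - J))
    \<le> (\<Sum>j<J + n. if j < J then (3/4::real) ^ (J - j) else (3/4) ^ (j - J))"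
    by (rule sum_mono2) auto
  also have "\<dots> = (\<Sum>j<J. (3/4::real) ^ (J - j)) + (\<Sum>l<n. (3/4) ^ l)"
  proof -
    have "{..<J + n} = {..<J} \<union> (\<lambda>l. J + l) ` {..<n}"
    proof (intro equalityI subsetI)
      fix x assume "x \<in> {..<J + n}"
      then show "x \<in> {..<J} \<union> (\<lambda>l. J + l) ` {..<n}"
        by (cases "x < J") (auto intro: image_eqI[of _ _ "x - J"])
    qed auto
    moreover have "{..<J} \<inter> (\<lambda>l. J + l) ` {..<n} = {}" by auto
    ultimately show ?thesis by (simp add: sum.union_disjoint sum.reindex)
  qed
  also have "(\<Sum>j<J. (3/4::real) ^ (J - j)) \<le> (\<Sum>l<Suc J. (3/4) ^ l)"
  proof -
    have "(\<Sum>j<J. (3/4::real) ^ (J - j)) = (\<Sum>l\<in>(\<lambda>j. J - j) ` {..<J}. (3/4) ^ l)"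
      by (subst sum.reindex) (auto simp: inj_on_def)
    also have "\<dots> \<le> (\<Sum>l<Suc J. (3/4) ^ l)" by (rule sum_mono2) auto
    finally show ?thesis .
  qed
  finally show ?thesis using geo[of n] geo[of "Suc J"] by linarith
qed

text \<open>
  On \<open>A\<close> the function is \<open>1\<close>, whereas its averages over boxes of side \<open>2 ^ n\<close> tend to \<open>0\<close>. Telescoping
  over the dyadic scales in the norm of \<open>l\<^sup>2(A)\<close> bounds \<open>sqrt (card A)\<close> by the sum of a geometric
  series that is dominated by the scale \<open>2 ^ J\<close>.
\<close>

lemma trace_bound_dyadic:
  fixes A :: "(int ^ 'd) set"
  assumes d: "CARD('d) > 2" and fin: "finite A" and lev: "\<And>a. a \<in> A \<Longrightarrow> level a = c"
    and f1: "\<And>a. a \<in> A \<Longrightarrow> f a = 1"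
    and supp: "finite Z" "\<And>z. z \<notin> Z \<Longrightarrow> f z = 0"
    and En: "\<And>X. finite X \<Longrightarrow> X \<subseteq> upper c \<Longrightarrow> (\<Sum>y\<in>X. sqgrad f y) \<le> En"
    and k: "real (card A) \<le> (2 ^ J) ^ (CARD('d) - 1)"
  shows "real (card A) \<le> 81 * real CARD('d) ^ 2 * En * 2 ^ J"
proof -
  let ?d = "real CARD('d)" and ?k = "real (card A)"
  have En0: "0 \<le> En" using En[of "{}"] by simp
  \<comment> \<open>Edges inside the hyperplane are not counted in the energy, so the first step goes straight up.\<close>
  define A1 where "A1 = (\<lambda>a. a + shift i0 1) ` A"
  have inj: "inj_on (\<lambda>a. a + shift i0 1) A" by (auto simp: inj_on_def)
  have cA1: "card A1 = card A" unfolding A1_def by (rule card_image[OF inj])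
  have A1: "finite A1" "\<And>a. a \<in> A1 \<Longrightarrow> level a = c + 1"
    using fin lev by (auto simp: A1_def level_add level_shift)
  have start: "sqrt ?k \<le> sqrt En + L2_set f A1"
  proof -
    have "sqrt ?k = L2_set f A" using f1 by (simp add: L2_set_def)
    also have "\<dots> = L2_set (\<lambda>a. (f a - f (a + shift i0 1)) + f (a + shift i0 1)) A" by simp
    also have "\<dots> \<le> L2_set (\<lambda>a. f a - f (a + shift i0 1)) A + L2_set (\<lambda>a. f (a + shift i0 1)) A"
      by (rule L2_set_triangle_ineq)
    also have "L2_set (\<lambda>a. f (a + shift i0 1)) A = L2_set f A1"
      unfolding L2_set_def A1_def sum.reindex[OF inj] by (simp add: comp_def)
    also have "L2_set (\<lambda>a. f a - f (a + shift i0 1)) A \<le> sqrt En"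
    proof -
      have "(\<Sum>a\<in>A. (f a - f (a + shift i0 1))\<^sup>2) = (\<Sum>y\<in>(\<lambda>a. (a, i0)) ` A. sqgrad f y)"
        by (subst sum.reindex) (auto simp: inj_on_def sqgrad_def)
      also have "\<dots> \<le> En" using fin lev by (intro En) (auto simp: upper_def)
      finally show ?thesis unfolding L2_set_def by (rule real_sqrt_le_mono)
    qed
    finally show ?thesis by simp
  qed
  have tele: "L2_set f A1 \<le> (\<Sum>j<n. ?d * sqrt En * (sqrt (2 ^ J) * (if j < J then (3/4) ^ (J - j) else (3/4) ^ (j - J))))
      + L2_set (avg (\<lambda>_. 2 ^ n) f) A1" for n
  proof (induction n)
    case 0
    have "avg (\<lambda>_. 1) f = f" by (rule ext) (rule avg_one)
    then show ?case by simp
  next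
    case (Suc n)
    let ?w = "\<lambda>j. if j < J then (3/4) ^ (J - j) else (3/4) ^ (j - J) :: real"
    have "L2_set (avg (\<lambda>_. 2 ^ n) f) A1 = L2_set (\<lambda>a. (avg (\<lambda>_. 2 ^ n) f a - avg (\<lambda>_. 2 * 2 ^ n) f a) + avg (\<lambda>_. 2 * 2 ^ n) f a) A1"
      by simp
    also have "\<dots> \<le> L2_set (\<lambda>a. avg (\<lambda>_. 2 ^ n) f a - avg (\<lambda>_. 2 * 2 ^ n) f a) A1 + L2_set (avg (\<lambda>_. 2 * 2 ^ n) f) A1"
      by (rule L2_set_triangle_ineq)
    also have "L2_set (\<lambda>a. avg (\<lambda>_. 2 ^ n) f a - avg (\<lambda>_. 2 * 2 ^ n) f a) A1
      \<le> ?d * sqrt (min (real (2 ^ n)) (real (card A1) * real (2 ^ n) ^ 2 / real (2 ^ n) ^ CARD('d)) * En)"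
      by (rule avg_double_norm[OF A1(1,2) _ En]) auto
    also have "\<dots> = ?d * sqrt En * sqrt (min (2 ^ n) (?k * (2 ^ n)\<^sup>2 / (2 ^ n) ^ CARD('d)))"
      by (simp add: real_sqrt_mult cA1)
    also have "\<dots> \<le> ?d * sqrt En * (sqrt (2 ^ J) * ?w n)"
      using En0 by (intro mult_left_mono dyadic_weight[OF d k]) auto
    finally show ?case using Suc.IH by simp
  qed
  define G where "G = (\<Sum>z\<in>Z. \<bar>f z\<bar>)"
  have last: "L2_set (avg (\<lambda>_. 2 ^ n) f) A1 \<le> sqrt ?k * (G * (1/2) ^ n)" for n
  proof -
    have cb: "real (card (box (\<lambda>_. 2 ^ n))) \<ge> 2 ^ n"
    proof -
      have "(2::real) ^ n \<le> (2 ^ n) ^ CARD('d)" using d by (intro self_le_power) auto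
      then show ?thesis by (simp add: card_box)
    qed
    have "\<bar>avg (\<lambda>_. 2 ^ n) f a\<bar> \<le> G * (1/2) ^ n" for a
    proof -
      have "\<bar>\<Sum>u\<in>box (\<lambda>_. 2 ^ n). f (a + u)\<bar> \<le> (\<Sum>u\<in>box (\<lambda>_. 2 ^ n). \<bar>f (a + u)\<bar>)" by (rule sum_abs)
      also have "\<dots> = (\<Sum>z\<in>(\<lambda>u. a + u) ` box (\<lambda>_. 2 ^ n). \<bar>f z\<bar>)" by (subst sum.reindex) auto
      also have "\<dots> = (\<Sum>z\<in>(\<lambda>u. a + u) ` box (\<lambda>_. 2 ^ n) \<inter> Z. \<bar>f z\<bar>)"
        using supp by (intro sum.mono_neutral_right) auto
      also have "\<dots> \<le> G" unfolding G_def using supp by (intro sum_mono2) auto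
      finally have "\<bar>avg (\<lambda>_. 2 ^ n) f a\<bar> \<le> G / real (card (box (\<lambda>_. 2 ^ n)))"
        unfolding avg_def abs_divide by (simp add: divide_right_mono)
      also have "\<dots> \<le> G / 2 ^ n"
      proof (rule divide_left_mono[OF cb])
        show "0 \<le> G" by (simp add: G_def sum_nonneg)
        have "0 < real (card (box (\<lambda>_. 2 ^ n)))" using cb zero_less_power[of "2::real" n] by linarith
        then show "0 < real (card (box (\<lambda>_. 2 ^ n))) * 2 ^ n" by simp
      qed
      finally show ?thesis by (simp add: power_divide)
    qed
    then have "(avg (\<lambda>_. 2 ^ n) f a)\<^sup>2 \<le> (G * (1/2) ^ n)\<^sup>2" for a by (metis abs_ge_zero power2_abs power_mono)
    then have "(\<Sum>a\<in>A1. (avg (\<lambda>_. 2 ^ n) f a)\<^sup>2) \<le> (\<Sum>a\<in>A1. (G * (1/2) ^ n)\<^sup>2)" by (intro sum_mono)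
    then have "L2_set (avg (\<lambda>_. 2 ^ n) f) A1 \<le> sqrt (?k * (G * (1/2) ^ n)\<^sup>2)"
      unfolding L2_set_def by (intro real_sqrt_le_mono) (simp add: cA1)
    also have "\<dots> = sqrt ?k * (G * (1/2) ^ n)" by (simp add: real_sqrt_mult G_def sum_nonneg)
    finally show ?thesis .
  qed
  have main: "sqrt ?k \<le> sqrt En + ?d * sqrt En * sqrt (2 ^ J) * 8 + sqrt ?k * (G * (1/2) ^ n)" for n
  proof -
    have "(\<Sum>j<n. ?d * sqrt En * (sqrt (2 ^ J) * (if j < J then (3/4) ^ (J - j) else (3/4) ^ (j - J))))
      = ?d * sqrt En * sqrt (2 ^ J) * (\<Sum>j<n. if j < J then (3/4) ^ (J - j) else (3/4) ^ (j - J))"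
      by (simp add: sum_distrib_left mult.assoc)
    also have "\<dots> \<le> ?d * sqrt En * sqrt (2 ^ J) * 8"
      using En0 by (intro mult_left_mono geometric_tent) auto
    finally show ?thesis using start tele[of n] last[of n] by linarith
  qed
  have lim: "(\<lambda>n. sqrt En + ?d * sqrt En * sqrt (2 ^ J) * 8 + sqrt ?k * (G * (1/2) ^ n))
    \<longlonglongrightarrow> sqrt En + ?d * sqrt En * sqrt (2 ^ J) * 8 + sqrt ?k * (G * 0)"
    by (intro tendsto_intros LIMSEQ_power_zero) auto
  have "sqrt ?k \<le> sqrt En + ?d * sqrt En * sqrt (2 ^ J) * 8 + sqrt ?k * (G * 0)"
    by (rule LIMSEQ_le_const[OF lim]) (use main in blast)
  also have "\<dots> \<le> 9 * ?d * sqrt (En * 2 ^ J)"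
  proof -
    have "1 \<le> ?d * sqrt (2 ^ J)"
    proof -
      have "1 * 1 \<le> ?d * sqrt (2 ^ J)" using d by (intro mult_mono) auto
      then show ?thesis by simp
    qed
    then have "sqrt En * 1 \<le> sqrt En * (?d * sqrt (2 ^ J))" using En0 by (intro mult_left_mono) auto
    then show ?thesis by (simp add: real_sqrt_mult algebra_simps)
  qed
  finally have "(sqrt ?k)\<^sup>2 \<le> (9 * ?d * sqrt (En * 2 ^ J))\<^sup>2" by (intro power_mono) auto
  then show ?thesis using En0 by (simp add: power_mult_distrib)
qed

text \<open>
  The capacity of a set of \<open>k\<close> points in the boundary hyperplane of a half-space is at least of order
  \<open>k powr ((d - 2) / (d - 1))\<close>, the order for a ball of the hyperplane. It is stated for functions of
  finite support, with the energy entering through its finite partial sums.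
\<close>

theorem trace_bound:
  fixes A :: "(int ^ 'd) set"
  assumes d: "CARD('d) > 2" and fin: "finite A" and lev: "\<And>a. a \<in> A \<Longrightarrow> level a = c"
    and f1: "\<And>a. a \<in> A \<Longrightarrow> f a = 1"
    and supp: "finite Z" "\<And>z. z \<notin> Z \<Longrightarrow> f z = 0"
    and En: "\<And>X. finite X \<Longrightarrow> X \<subseteq> upper c \<Longrightarrow> (\<Sum>y\<in>X. sqgrad f y) \<le> En"
    and ne: "A \<noteq> {}"
  shows "real (card A) powr ((real CARD('d) - 2) / (real CARD('d) - 1)) \<le> 162 * real CARD('d) ^ 2 * En"
proof -
  let ?d = "real CARD('d)" and ?k = "real (card A)"
  have k1: "?k \<ge> 1" using fin ne by (simp add: Suc_le_eq card_gt_0_iff)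
  have En0: "0 \<le> En" using En[of "{}"] by simp
  have ex: "\<exists>J. ?k \<le> (2 ^ J) ^ (CARD('d) - 1)"
  proof -
    have "?k \<le> 2 ^ card A" by (rule less_imp_le) (rule of_nat_less_two_power)
    also have "\<dots> \<le> (2 ^ card A) ^ (CARD('d) - 1)" using d by (intro self_le_power) auto
    finally show ?thesis by blast
  qed
  define J where "J = (LEAST J. ?k \<le> (2 ^ J) ^ (CARD('d) - 1))"
  have J: "?k \<le> (2 ^ J) ^ (CARD('d) - 1)" unfolding J_def using ex by (rule LeastI_ex)
  have J2: "2 ^ J \<le> 2 * ?k powr (1 / (?d - 1))"
  proof (cases J)
    case 0
    have "1 \<le> ?k powr (1 / (?d - 1))" using k1 d by (intro ge_one_powr_ge_zero) auto
    then show ?thesis using 0 by simp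
  next
    case (Suc j)
    have "\<not> ?k \<le> (2 ^ j) ^ (CARD('d) - 1)" using not_less_Least[of j "\<lambda>J. ?k \<le> (2 ^ J) ^ (CARD('d) - 1)"] Suc unfolding J_def by simp
    then have lt: "(2 ^ j) ^ (CARD('d) - 1) \<le> ?k" by simp
    have "(2::real) ^ j = ((2 ^ j) ^ (CARD('d) - 1)) powr (1 / (?d - 1))"
    proof -
      have "((2::real) ^ j) ^ (CARD('d) - 1) = (2 ^ j) powr (?d - 1)"
        using d by (simp add: powr_realpow[symmetric] of_nat_diff)
      then show ?thesis using d by (simp add: powr_powr)
    qed
    also have "\<dots> \<le> ?k powr (1 / (?d - 1))" using lt d by (intro powr_mono2) auto
    finally show ?thesis using Suc by simp
  qed
  have sp: "?k = ?k powr (1 / (?d - 1)) * ?k powr ((?d - 2) / (?d - 1))"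
  proof -
    have "1 / (?d - 1) + (?d - 2) / (?d - 1) = (?d - 1) / (?d - 1)" by (simp flip: add_divide_distrib)
    also have "\<dots> = 1" using d by simp
    finally have "?k powr (1 / (?d - 1) + (?d - 2) / (?d - 1)) = ?k" using k1 by simp
    then show ?thesis unfolding powr_add by (rule sym)
  qed
  have "?k \<le> 81 * ?d ^ 2 * En * 2 ^ J" by (rule trace_bound_dyadic[OF d fin lev f1 supp En J])
  also have "\<dots> \<le> 81 * ?d ^ 2 * En * (2 * ?k powr (1 / (?d - 1)))" using J2 En0 by (intro mult_left_mono) auto
  finally have "?k powr (1 / (?d - 1)) * ?k powr ((?d - 2) / (?d - 1)) \<le> ?k powr (1 / (?d - 1)) * (162 * ?d ^ 2 * En)"
    unfolding sp[symmetric] by (simp add: mult.commute mult.left_commute)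
  then show ?thesis by (rule mult_left_le_imp_le) (use k1 in \<open>auto\<close>)
qed

end

section \<open>Exploring the wired lattice by half-spaces\<close>

lemma int_lattice_simps [simp]:
  "verts int_lattice = UNIV" "endpoints int_lattice = (\<lambda>e. e)"
  by (simp_all add: int_lattice_def)

context half_space
begin

lemma shift_ne: "z + shift i 1 \<noteq> z"
  using dir_sq(2)[of i] by (auto simp: vec_eq_iff shift_nth)

lemma shift_pair_inj:
  assumes "{z, z + shift i 1} = {z', z' + shift i' 1}"
  shows "z = z' \<and> i = i'"
proof -
  have ii: "shift i 1 = shift i' 1 \<Longrightarrow> i = i'"
    using dir_sq(2)[of i] by (auto simp: vec_eq_iff shift_nth dest!: spec[of _ i] split: if_splits)
  have "shift i 1 + shift i' 1 \<noteq> 0"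
    using dir_sq(2)[of i] dir_sq(2)[of i']
    by (auto simp: vec_eq_iff shift_nth intro!: exI[of _ i] split: if_splits)
  then show ?thesis using assms ii by (auto simp: doubleton_eq_iff algebra_simps)
qed

lemma lattice_edge_iff: "e \<in> edges int_lattice \<longleftrightarrow> (\<exists>z i. e = {z, z + shift i 1})"
proof
  assume "e \<in> edges int_lattice"
  then obtain a b where e: "e = {a, b}" and ab: "(\<Sum>i\<in>UNIV. \<bar>a $ i - b $ i\<bar>) = 1"
    by (auto simp: int_lattice_def)
  obtain i where i: "a $ i \<noteq> b $ i" using ab by force
  have sp: "(\<Sum>i\<in>UNIV. \<bar>a $ i - b $ i\<bar>) = \<bar>a $ i - b $ i\<bar> + (\<Sum>j\<in>UNIV - {i}. \<bar>a $ j - b $ j\<bar>)"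
    by (rule sum.remove) auto
  have nn: "(\<Sum>j\<in>UNIV - {i}. \<bar>a $ j - b $ j\<bar>) \<ge> 0" by (rule sum_nonneg) simp
  have one: "\<bar>a $ i - b $ i\<bar> = 1" and zero: "(\<Sum>j\<in>UNIV - {i}. \<bar>a $ j - b $ j\<bar>) = 0"
    using ab sp nn i by linarith+
  have oth: "a $ j = b $ j" if "j \<noteq> i" for j
    using zero that by (subst (asm) sum_nonneg_eq_0_iff) auto
  have "dir i = 1 \<or> dir i = -1" using sg by (auto simp: dir_def)
  then have "b = a + shift i 1 \<or> a = b + shift i 1"
    using one oth by (auto simp: vec_eq_iff shift_nth abs_if split: if_splits) (metis+)?
  then show "\<exists>z i. e = {z, z + shift i 1}" using e by (metis insert_commute)
next
  assume "\<exists>z i. e = {z, z + shift i 1}"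
  then obtain z i where e: "e = {z, z + shift i 1}" by auto
  have "(\<Sum>j\<in>UNIV. \<bar>z $ j - (z + shift i 1) $ j\<bar>) = (\<Sum>j\<in>UNIV. if j = i then \<bar>dir i\<bar> else 0)"
    by (rule sum.cong) (auto simp: shift_nth)
  also have "\<dots> = 1" using sg by (auto simp: dir_def)
  finally show "e \<in> edges int_lattice" unfolding e int_lattice_def multigraph.select_convs by blast
qed

lemma level_edge:
  assumes "e \<in> edges int_lattice" "a \<in> e" "b \<in> e"
  shows "level b \<le> level a + 1"
  using assms unfolding lattice_edge_iff by (auto simp: level_add level_shift)

end

text \<open>
  The identification map of the wired graph.
\<close>

definition glue :: "'v set \<Rightarrow> 'v \<Rightarrow> 'v option" where
  "glue K v = (if v \<in> K then Some v else None)"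

lemma wired_simps:
  "verts (wired int_lattice K) = insert None (Some ` K)"
  "edges (wired int_lattice K) = {e \<in> edges int_lattice. card (glue K ` e) \<noteq> 1}"
  "endpoints (wired int_lattice K) = (\<lambda>e. glue K ` e)"
  unfolding wired_def Let_def glue_def[abs_def]
  by (simp_all only: multigraph.select_convs int_lattice_simps)

lemma glue_in: "glue K v \<in> insert None (Some ` K)"
  by (simp add: glue_def)

lemma glue_Some: "glue K v = Some w \<longleftrightarrow> v = w \<and> w \<in> K" "Some w = glue K v \<longleftrightarrow> v = w \<and> w \<in> K"
  by (auto simp: glue_def)

lemma half_space_exists: "half_space 1"
  by unfold_locales simp

lemma lattice_edgeE:
  assumes "e \<in> edges int_lattice"
  obtains a b where "e = {a, b}" "a \<noteq> b"
proof -
  interpret half_space undefined 1 by (rule half_space_exists)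
  obtain z i where "e = {z, z + shift i 1}" using assms unfolding lattice_edge_iff by blast
  then show ?thesis using that shift_ne by metis
qed

definition star :: "int ^ 'd \<Rightarrow> (int ^ 'd) set set" where
  "star x = {e \<in> edges int_lattice. x \<in> e}"

lemma star_card: "finite (star (x :: int ^ 'd::finite)) \<and> card (star x) \<le> 2 * CARD('d)"
proof -
  interpret half_space undefined 1 by (rule half_space_exists)
  let ?f = "\<lambda>i. {x, x + shift i 1}" and ?g = "\<lambda>i. {x - shift i 1, x}"
  have "star x \<subseteq> ?f ` UNIV \<union> ?g ` UNIV"
  proof
    fix e assume "e \<in> star x"
    then obtain z i where "e = {z, z + shift i 1}" "x = z \<or> x = z + shift i 1"
      by (auto simp: star_def lattice_edge_iff)
    then show "e \<in> ?f ` UNIV \<union> ?g ` UNIV" by auto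
  qed
  moreover have "card (?f ` UNIV \<union> ?g ` UNIV) \<le> 2 * CARD('d)"
    using card_Un_le[of "?f ` UNIV" "?g ` UNIV"] card_image_le[of UNIV ?f] card_image_le[of UNIV ?g] by simp
  ultimately show ?thesis by (meson card_mono finite_UnI finite_imageI finite finite_subset le_trans)
qed

lemma finite_wired_edges:
  assumes "finite (K :: (int ^ 'd::finite) set)"
  shows "finite (edges (wired int_lattice K))"
proof (rule finite_subset)
  show "edges (wired int_lattice K) \<subseteq> (\<Union>x\<in>K. star x)"
  proof
    fix e assume e: "e \<in> edges (wired int_lattice K)"
    then have el: "e \<in> edges int_lattice" "card (glue K ` e) \<noteq> 1" by (auto simp: wired_simps)
    obtain a b where ab: "e = {a, b}" using lattice_edgeE[OF el(1)] by metis
    have "a \<in> K \<or> b \<in> K"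
    proof (rule ccontr)
      assume "\<not> ?thesis"
      then have "glue K ` e = {None}" by (auto simp: ab glue_def)
      then show False using el(2) by simp
    qed
    then show "e \<in> (\<Union>x\<in>K. star x)" using ab el(1) by (auto simp: star_def)
  qed
qed (use assms star_card in auto)

lemma wired_network:
  assumes "finite (K :: (int ^ 'd::finite) set)" "x \<in> K"
  shows "\<exists>src tgt. network (verts (wired int_lattice K)) (edges (wired int_lattice K)) (endpoints (wired int_lattice K)) src tgt (Some x) None"
proof -
  have "\<exists>a b. e \<in> edges (wired int_lattice K) \<longrightarrow> endpoints (wired int_lattice K) e = {a, b} \<and>
     a \<in> verts (wired int_lattice K) \<and> b \<in> verts (wired int_lattice K)" for e
  proof (cases "e \<in> edges (wired int_lattice K)")
    case True
    then have "e \<in> edges int_lattice" by (simp add: wired_simps)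
    then obtain a b where "e = {a, b}" by (rule lattice_edgeE)
    then show ?thesis unfolding wired_simps
      by (intro exI[of _ "glue K a"] exI[of _ "glue K b"]) (auto simp: glue_def)
  qed auto
  then obtain src tgt where st: "\<And>e. e \<in> edges (wired int_lattice K) \<Longrightarrow>
     endpoints (wired int_lattice K) e = {src e, tgt e} \<and>
     src e \<in> verts (wired int_lattice K) \<and> tgt e \<in> verts (wired int_lattice K)" by metis
  show ?thesis
    by (rule exI[of _ src], rule exI[of _ tgt], unfold_locales)
      (use st assms finite_wired_edges in \<open>auto simp: wired_simps(1)\<close>)
qed

text \<open>
  The uniform forest on the lattice wired outside \<open>K\<close> is explored by revealing the edges below
  higher and higher levels. All edges above the current level remain unrevealed, so the potential
  there can be compared with the potential of a full half-space.
\<close>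

locale wired_half_space = half_space i0 \<sigma> +
  network "verts (wired int_lattice K)" "edges (wired int_lattice K)" "endpoints (wired int_lattice K)" src tgt "Some x" None
  for i0 :: "'d::finite" and \<sigma> and K :: "(int ^ 'd) set" and src tgt x +
  assumes finK: "finite K" and xK: "x \<in> K" and dim: "CARD('d) > 2"
begin

abbreviation "E \<equiv> edges (wired int_lattice K)"
abbreviation "en \<equiv> endpoints (wired int_lattice K)"

definition below :: "nat \<Rightarrow> (int ^ 'd) set set" where
  "below r = {e \<in> E. \<forall>y\<in>e. level y \<le> level x + int r}"

definition touches :: "nat \<Rightarrow> (int ^ 'd) set set \<Rightarrow> bool" where
  "touches r Q \<longleftrightarrow> (\<exists>a. level a = level x + int r \<and> lk Q (Some x) (Some a))"

definition reaches :: "nat \<Rightarrow> (int ^ 'd) set set \<Rightarrow> bool" where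
  "reaches R F \<longleftrightarrow> (\<exists>a. level x + int R \<le> level a \<and> lk F (Some x) (Some a))"

lemma E_lattice: "e \<in> E \<Longrightarrow> e \<in> edges int_lattice"
  by (simp add: wired_simps)

lemma en_glue: "en e = glue K ` e"
  by (simp add: wired_simps)

text \<open>
  A path starting at \<open>x\<close> uses revealed edges only until it first arrives at level \<open>level x + r\<close>.
\<close>

lemma reaches_imp_touches:
  assumes F: "F \<in> forests {} {}" and R: "reaches R F" and r: "r \<le> R"
  shows "touches r (F \<inter> below r)"
proof (rule ccontr)
  assume ng: "\<not> touches r (F \<inter> below r)"
  have FE: "F \<subseteq> E" and nr: "\<not> lk F (Some x) None" using F by (auto simp: forests_def)
  have r0: "r > 0"
  proof (rule ccontr)
    assume "\<not> 0 < r"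
    then have "touches r (F \<inter> below r)" unfolding touches_def by (intro exI[of _ x]) auto
    then show False using ng by simp
  qed
  have "lk (F \<inter> below r) (Some x) w \<and> (\<exists>b. w = Some b \<and> level b < level x + int r)" if "lk F (Some x) w" for w
    using that
  proof (induction rule: linked_induct)
    case (step y z e)
    then obtain b where b: "y = Some b" "level b < level x + int r" by auto
    have eE: "e \<in> E" using step FE by auto
    have be: "b \<in> e" using step.hyps(3) b by (auto simp: en_glue glue_Some dest!: equalityD2)
    have ebel: "e \<in> below r" using eE be b level_edge[OF E_lattice[OF eE] be] by (fastforce simp: below_def)
    have lz: "lk (F \<inter> below r) (Some x) z"
      using step.IH step.hyps ebel by (meson IntI linked_edge linked_trans)
    have "lk F (Some x) z" using lz by (rule linked_mono) auto
    then obtain b' where b': "z = Some b'" using nr by (cases z) auto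
    have "b' \<in> e" using step.hyps(3) b' by (auto simp: en_glue glue_Some dest!: equalityD2)
    then have "level b' \<le> level x + int r" using ebel by (auto simp: below_def)
    moreover have "level b' \<noteq> level x + int r" using ng lz b' by (auto simp: touches_def)
    ultimately show ?case using lz b' by auto
  qed (use r0 in auto)
  then show False using R r by (force simp: reaches_def)
qed

text \<open>
  The conductance is the energy of the potential, which is \<open>1\<close> on the set of explored vertices at
  the top level and \<open>0\<close> outside \<open>K\<close>; the unrevealed edges contain the whole half-space above, so
  the trace estimate applies.
\<close>

lemma trace_le_conductance:
  assumes ne: "forests (below r) Q \<noteq> {}" and g: "touches r Q"
  defines "A \<equiv> {a. level a = level x + int r \<and> lk Q (Some x) (Some a)}"
  shows "finite A" "card A > 0"
    and "real (card A) powr ((real CARD('d) - 2) / (real CARD('d) - 1)) \<le> 162 * real CARD('d) ^ 2 * conductance (below r) Q"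
proof -
  let ?v = "potential (below r) Q" and ?c = "level x + int r"
  have Q: "Q \<subseteq> below r" "Q \<subseteq> E" using ne by (auto simp: forests_def)
  have "w \<in> insert None (Some ` K)" if "lk Q (Some x) w" for w
    using that
  proof (induction rule: linked_induct)
    case (step y z e)
    then show ?case using glue_in by (fastforce simp: en_glue dest!: equalityD2)
  qed (use xK in auto)
  then have AK: "A \<subseteq> K" by (auto simp: A_def)
  then show fA: "finite A" using finK finite_subset by auto
  have Ane: "A \<noteq> {}" using g by (auto simp: touches_def A_def)
  then show "card A > 0" using fA by (simp add: card_gt_0_iff)
  define f where "f y = (if y \<in> K then ?v (Some y) else 0)" for y
  have f_glue: "f y = ?v (glue K y)" for y using potential_root by (simp add: f_def glue_def)
  show "real (card A) powr ((real CARD('d) - 2) / (real CARD('d) - 1)) \<le> 162 * real CARD('d) ^ 2 * conductance (below r) Q"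
  proof (rule trace_bound[OF dim fA _ _ finK _ _ Ane])
    show "level a = ?c" if "a \<in> A" for a using that by (simp add: A_def)
    show "f a = 1" if "a \<in> A" for a
      using that AK potential_one[OF ne] by (auto simp: f_def A_def)
    show "f z = 0" if "z \<notin> K" for z using that by (simp add: f_def)
    fix X assume X: "finite X" "X \<subseteq> upper ?c"
    define X' where "X' = {y\<in>X. sqgrad f y \<noteq> 0}"
    define h where "h = (\<lambda>(z, i). {z, z + shift i 1})"
    define D where "D e = (?v (src e) - ?v (tgt e)) * (?v (src e) - ?v (tgt e))" for e
    have inj: "inj_on h X'" using shift_pair_inj by (auto simp: inj_on_def h_def)
    have hX: "h y \<in> E - below r \<and> sqgrad f y = D (h y)" if y: "y \<in> X'" for y
    proof -
      obtain z i where zi: "y = (z, i)" by force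
      let ?e = "{z, z + shift i 1}"
      have "f z \<noteq> f (z + shift i 1)" using y by (auto simp: X'_def sqgrad_def zi)
      then have gne: "glue K z \<noteq> glue K (z + shift i 1)" by (auto simp: f_glue)
      have eE: "?e \<in> E" using gne lattice_edge_iff by (auto simp: wired_simps)
      have "?c < level z \<or> (level z = ?c \<and> i = i0)" using y X by (auto simp: X'_def upper_def zi)
      then have "?e \<notin> below r" by (auto simp: below_def level_add level_shift)
      moreover have "{glue K z, glue K (z + shift i 1)} = {src ?e, tgt ?e}" using en_eq[OF eE] by (simp add: en_glue)
      then have "sqgrad f y = D ?e"
        by (auto simp: zi sqgrad_def f_glue D_def doubleton_eq_iff power2_eq_square algebra_simps)
      ultimately show ?thesis using eE by (simp add: h_def zi)
    qed
    have "(\<Sum>y\<in>X. sqgrad f y) = (\<Sum>y\<in>X'. sqgrad f y)"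
      using X by (intro sum.mono_neutral_right) (auto simp: X'_def)
    also have "\<dots> = (\<Sum>y\<in>X'. D (h y))" using hX by (intro sum.cong) auto
    also have "\<dots> = (\<Sum>e\<in>h ` X'. D e)" by (subst sum.reindex[OF inj]) simp
    also have "\<dots> \<le> (\<Sum>e\<in>E - below r. D e)" using hX by (intro sum_mono2) (auto simp: D_def)
    also have "\<dots> = conductance (below r) Q"
      using conductance_energy[OF Q ne] by (simp add: energy_def D_def)
    finally show "(\<Sum>y\<in>X. sqgrad f y) \<le> conductance (below r) Q" .
  qed
qed

text \<open>
  All current leaves the explored cluster through its vertices at the top level, and each of these
  has a single edge to the next level. Green's identity for the indicator of the cluster turns this
  into a bound on the conductance.
\<close>

lemma conductance_le_gradient:
  assumes ne: "forests (below r) Q \<noteq> {}" and g: "touches r Q"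
    and small: "\<And>e. e \<in> below (Suc r) - below r \<Longrightarrow> \<bar>potential (below r) Q (src e) - potential (below r) Q (tgt e)\<bar> \<le> \<epsilon>"
    and eps: "0 \<le> \<epsilon>"
  defines "A \<equiv> {a. level a = level x + int r \<and> lk Q (Some x) (Some a)}"
  shows "conductance (below r) Q \<le> real (card A) * \<epsilon>"
proof -
  let ?v = "potential (below r) Q" and ?c = "level x + int r"
  have Q: "Q \<subseteq> below r" "Q \<subseteq> E" using ne by (auto simp: forests_def)
  have fA: "finite A" unfolding A_def by (rule trace_le_conductance(1)[OF ne g])
  define \<phi> :: "(int ^ 'd) option \<Rightarrow> real" where "\<phi> w = of_bool (lk Q (Some x) w)" for w
  have nr: "\<not> lk Q (Some x) None"
  proof
    assume "lk Q (Some x) None"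
    moreover obtain F where "F \<in> forests (below r) Q" using ne by auto
    ultimately show False using linked_mono[of en Q "Some x" None F] by (auto simp: forests_def)
  qed
  have lev: "level a \<le> ?c" if "lk Q (Some x) w" "w = Some a" for w a
    using that
  proof (induction arbitrary: a rule: linked_induct)
    case (step y z e)
    then have "a \<in> e" by (auto simp: en_glue glue_Some dest!: equalityD2)
    then show ?case using Q step by (auto simp: below_def)
  qed auto
  have \<phi>c: "\<phi> (src e) = \<phi> (tgt e)" if "e \<in> Q" for e
  proof -
    have "lk Q (src e) (tgt e)" using that en_eq Q by (auto intro: linked_edge)
    then have "lk Q (Some x) (src e) \<longleftrightarrow> lk Q (Some x) (tgt e)" by (meson linked_sym linked_trans)
    then show ?thesis by (simp add: \<phi>_def)
  qed
  define X where "X = {e \<in> E - below r. \<phi> (src e) \<noteq> \<phi> (tgt e)}"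
  have X: "e \<in> below (Suc r) \<and> e \<in> (\<lambda>a. {a, a + shift i0 1}) ` A" if e: "e \<in> X" for e
  proof -
    have eE: "e \<in> E" "e \<notin> below r" using e by (auto simp: X_def)
    have "\<exists>w\<in>en e. lk Q (Some x) w" using e en_eq[OF eE(1)] by (auto simp: X_def \<phi>_def split: if_splits)
    then obtain a where a: "a \<in> e" "lk Q (Some x) (Some a)"
      using nr by (auto simp: en_glue glue_def split: if_splits)
    have la: "level a \<le> ?c" using lev a by auto
    obtain z i where zi: "e = {z, z + shift i 1}" using E_lattice[OF eE(1)] lattice_edge_iff by auto
    have "\<not> (level z \<le> ?c \<and> level (z + shift i 1) \<le> ?c)" using eE zi by (auto simp: below_def)
    then have "a = z \<and> i = i0 \<and> level a = ?c" using a(1) la zi by (auto simp: level_add level_shift split: if_splits)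
    then show ?thesis using a zi eE by (auto simp: A_def below_def level_add level_shift)
  qed
  have "conductance (below r) Q = conductance (below r) Q * (\<phi> (Some x) - \<phi> None)"
    using nr by (simp add: \<phi>_def)
  also have "\<dots> = energy (below r) \<phi> ?v" by (rule conductance_green[OF Q(1) \<phi>c ne])
  also have "\<dots> = (\<Sum>e\<in>X. (\<phi> (src e) - \<phi> (tgt e)) * (?v (src e) - ?v (tgt e)))"
    unfolding energy_def X_def by (rule sum.mono_neutral_right) auto
  also have "\<dots> \<le> (\<Sum>e\<in>X. \<epsilon>)"
  proof (rule sum_mono)
    fix e assume e: "e \<in> X"
    then have "\<bar>?v (src e) - ?v (tgt e)\<bar> \<le> \<epsilon>" using X[OF e] by (intro small) (auto simp: X_def)
    moreover have "\<phi> (src e) - \<phi> (tgt e) = 1 \<or> \<phi> (src e) - \<phi> (tgt e) = -1"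
      using e by (auto simp: X_def \<phi>_def of_bool_def split: if_splits)
    ultimately show "(\<phi> (src e) - \<phi> (tgt e)) * (?v (src e) - ?v (tgt e)) \<le> \<epsilon>" by auto
  qed
  also have "\<dots> = real (card X) * \<epsilon>" by simp
  also have "\<dots> \<le> real (card A) * \<epsilon>"
  proof (intro mult_right_mono eps of_nat_mono)
    have "card X \<le> card ((\<lambda>a. {a, a + shift i0 1}) ` A)" using X fA by (intro card_mono) auto
    also have "\<dots> \<le> card A" by (rule card_image_le[OF fA])
    finally show "card X \<le> card A" .
  qed
  finally show ?thesis .
qed

end

definition beta_exp :: "real \<Rightarrow> real" where "beta_exp d = 1/2 - 1/d"

text \<open>
  This inverts the trace estimate, whose constant is \<open>162 * d ^ 2\<close>; the factor \<open>1/2\<close> makes the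
  inequality that \<open>steep_edge_exists\<close> contradicts a strict one.
\<close>

definition gradient_const :: "real \<Rightarrow> real" where
  "gradient_const d = (162 * d ^ 2) powr - ((d - 1) / (d - 2)) / 2"

definition reach_const :: "real \<Rightarrow> real" where
  "reach_const d = 4 / gradient_const d ^ 4 + 1"

lemma gradient_const_pos: "d > 2 \<Longrightarrow> gradient_const d > 0"
  by (simp add: gradient_const_def)

lemma reach_const_pos: "d > 2 \<Longrightarrow> reach_const d > 0"
  using gradient_const_pos[of d] by (simp add: reach_const_def add_pos_pos)

context wired_half_space
begin

text \<open>
  If \<open>k\<close> explored vertices lie at the top level, then the trace estimate gives
  \<open>k \<le> C * M powr ((d - 1) / (d - 2))\<close> for the conductance \<open>M\<close>, while the current through the steepest
  of the \<open>k\<close> edges above them is at least \<open>M / k\<close>. So this current is of order at least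
  \<open>M powr - (1 / (d - 2))\<close>, whatever the shape of the cluster. Exploring by half-spaces rather than
  along the cluster is what makes this work: nothing above the top level has been removed that
  could screen the cluster from the root.
\<close>

lemma steep_edge_exists:
  assumes ne: "forests (below r) Q \<noteq> {}" and g: "touches r Q" and M: "conductance (below r) Q < L"
  shows "\<exists>e\<in>below (Suc r) - below r. gradient_const (real CARD('d)) * L powr - (1 / (real CARD('d) - 2))
    \<le> \<bar>potential (below r) Q (src e) - potential (below r) Q (tgt e)\<bar>"
proof (rule ccontr)
  let ?d = "real CARD('d)"
  define \<epsilon> where "\<epsilon> = gradient_const ?d * L powr - (1 / (?d - 2))"
  define M where "M = conductance (below r) Q"
  define k where "k = card {a. level a = level x + int r \<and> lk Q (Some x) (Some a)}"
  let ?g = "(?d - 1) / (?d - 2)" and ?C = "162 * ?d ^ 2"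
  have d2: "?d > 2" using dim by simp
  assume "\<not> ?thesis"
  then have small: "\<bar>potential (below r) Q (src e) - potential (below r) Q (tgt e)\<bar> \<le> \<epsilon>"
    if "e \<in> below (Suc r) - below r" for e using that by (force simp: \<epsilon>_def)
  have eps0: "0 \<le> \<epsilon>" using gradient_const_pos[OF d2] by (simp add: \<epsilon>_def)
  have Mk: "M \<le> real k * \<epsilon>"
    unfolding M_def k_def by (rule conductance_le_gradient[OF ne g small eps0])
  have k: "k > 0" "real k powr ((?d - 2) / (?d - 1)) \<le> ?C * M"
    using trace_le_conductance[OF ne g] by (auto simp: k_def M_def)
  have "0 < real k powr ((?d - 2) / (?d - 1))" using k(1) by simp
  then have CM: "0 < ?C * M" using k(2) by linarith
  then have M0: "M > 0" using d2 by (simp add: zero_less_mult_iff)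
  have L0: "L > M" using M by (simp add: M_def)
  have "real k = (real k powr ((?d - 2) / (?d - 1))) powr ?g"
    using k(1) d2 by (simp add: powr_powr)
  also have "\<dots> \<le> (?C * M) powr ?g" using k(2) d2 by (intro powr_mono2) auto
  also have "\<dots> = ?C powr ?g * M powr ?g" using M0 by (simp add: powr_mult)
  finally have kb: "real k \<le> ?C powr ?g * M powr ?g" .
  have gam: "?g = 1 + 1 / (?d - 2)" using d2 by (simp add: field_simps)
  have "M \<le> ?C powr ?g * M powr ?g * \<epsilon>" using Mk mult_right_mono[OF kb eps0] by linarith
  also have "\<dots> = (?C powr ?g * ?C powr - ?g) * M powr ?g * L powr - (1 / (?d - 2)) / 2"
    by (simp add: \<epsilon>_def gradient_const_def)
  also have "?C powr ?g * ?C powr - ?g = 1" using d2 by (simp flip: powr_add)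
  also have "1 * M powr ?g * L powr - (1 / (?d - 2)) / 2 = M * (M powr (1 / (?d - 2)) * L powr - (1 / (?d - 2))) / 2"
    using M0 by (simp add: gam powr_add)
  also have "\<dots> \<le> M * 1 / 2"
  proof -
    have "M powr (1 / (?d - 2)) \<le> L powr (1 / (?d - 2))" using M0 L0 d2 by (intro powr_mono2) auto
    then have "M powr (1 / (?d - 2)) * L powr - (1 / (?d - 2)) \<le> L powr (1 / (?d - 2)) * L powr - (1 / (?d - 2))"
      by (intro mult_right_mono) auto
    also have "\<dots> = 1" using M0 L0 by (simp flip: powr_add)
    finally show ?thesis using M0 by (intro divide_right_mono mult_left_mono) auto
  qed
  finally show False using M0 by simp
qed

text \<open>
  With \<open>\<epsilon>\<close> of order \<open>L powr - (1 / (d - 2))\<close>, \<open>reach_bound\<close> gives a bound of order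
  \<open>L powr (1 + 4 / (d - 2)) / R + 1 / L\<close>. The two terms are equal for \<open>L = R powr \<beta>\<close> with
  \<open>\<beta> = 1/2 - 1/d\<close>.
\<close>

lemma reaches_count:
  assumes R: "R > 0"
  shows "real (card {F\<in>forests {} {}. reaches R F})
    \<le> reach_const (real CARD('d)) * real R powr - beta_exp (real CARD('d)) * real (card (trees {} {}))"
proof -
  let ?d = "real CARD('d)"
  let ?t = "real (card (trees {} {}))" and ?n = "real (card {F\<in>forests {} {}. reaches R F})"
  have d2: "?d > 2" using dim by simp
  define b where "b = beta_exp ?d"
  define L where "L = real R powr b"
  define \<epsilon> where "\<epsilon> = gradient_const ?d * L powr - (1 / (?d - 2))"
  have L0: "L > 0" using R by (simp add: L_def)
  have e0: "\<epsilon> > 0" using gradient_const_pos[OF d2] L0 by (simp add: \<epsilon>_def)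
  have "(\<Sum>r<R. real (card {F\<in>forests {} {}. touches r (F \<inter> below r)})) * (\<epsilon> ^ 4 / 2)
    \<le> ?t * (2 * L + real R * \<epsilon> ^ 4 / (2 * L))"
  proof (rule reach_bound[OF _ _ L0])
    show "below r \<subseteq> E" for r by (auto simp: below_def)
    show "below r \<subseteq> below (Suc r)" for r by (fastforce simp: below_def)
    show "0 \<le> \<epsilon>" using e0 by simp
    show "\<exists>e\<in>below (Suc r) - below r. \<epsilon> \<le> \<bar>potential (below r) Q (src e) - potential (below r) Q (tgt e)\<bar>"
      if "forests (below r) Q \<noteq> {}" "touches r Q" "conductance (below r) Q < L" for r Q
      unfolding \<epsilon>_def by (rule steep_edge_exists[OF that])
  qed
  moreover have "real R * ?n \<le> (\<Sum>r<R. real (card {F\<in>forests {} {}. touches r (F \<inter> below r)}))"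
  proof -
    have "(\<Sum>r<R. ?n) \<le> (\<Sum>r<R. real (card {F\<in>forests {} {}. touches r (F \<inter> below r)}))"
      by (intro sum_mono of_nat_mono card_mono) (auto intro: reaches_imp_touches)
    then show ?thesis by simp
  qed
  ultimately have "real R * ?n * (\<epsilon> ^ 4 / 2) \<le> ?t * (2 * L + real R * \<epsilon> ^ 4 / (2 * L))"
    using e0 by (smt (verit) mult_right_mono zero_le_power divide_nonneg_nonneg)
  then have n: "?n \<le> ?t * (4 * L / (real R * \<epsilon> ^ 4) + 1 / L)"
    using R e0 L0 by (simp add: field_simps)
  have b: "b = (?d - 2) / (2 * ?d)" using d2 by (simp add: b_def beta_exp_def field_simps)
  have L4: "(L powr - (1 / (?d - 2))) ^ 4 = L powr - (4 / (?d - 2))"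
    using L0 by (simp add: powr_powr flip: powr_realpow)
  have "L / (real R * \<epsilon> ^ 4) = (1 / gradient_const ?d ^ 4) * (L * L powr (4 / (?d - 2)) / real R)"
    unfolding \<epsilon>_def power_mult_distrib L4 by (simp add: powr_minus field_simps)
  also have "L * L powr (4 / (?d - 2)) / real R = real R powr - b"
  proof -
    have "L * L powr (4 / (?d - 2)) = L powr (1 + 4 / (?d - 2))" using L0 by (simp add: powr_add)
    also have "\<dots> = real R powr (b * (1 + 4 / (?d - 2)))" by (simp add: L_def powr_powr)
    also have "b * (1 + 4 / (?d - 2)) = 1 + - b" using d2 unfolding b by (simp add: field_simps)
    also have "real R powr (1 + - b) = real R * real R powr - b" using R by (subst powr_add) simp
    finally show ?thesis using R by simp
  qed
  finally have LR: "L / (real R * \<epsilon> ^ 4) = 1 / gradient_const ?d ^ 4 * real R powr - b" .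
  have "4 * L / (real R * \<epsilon> ^ 4) + 1 / L = reach_const ?d * real R powr - b"
  proof -
    have "4 * L / (real R * \<epsilon> ^ 4) = 4 * (L / (real R * \<epsilon> ^ 4))" by simp
    also have "\<dots> = 4 / gradient_const ?d ^ 4 * real R powr - b" unfolding LR by simp
    finally have *: "4 * L / (real R * \<epsilon> ^ 4) = 4 / gradient_const ?d ^ 4 * real R powr - b" .
    have "1 / L = real R powr - b" by (simp add: L_def powr_minus_divide)
    then show ?thesis unfolding * reach_const_def by (simp only: distrib_right mult_1)
  qed
  then show ?thesis using n by (simp add: b_def mult.commute)
qed

end

section \<open>Two long arms at a vertex\<close>

lemma linked_first_edge:
  assumes "linked en T x w"
  shows "w = x \<or> (\<exists>e\<in>T. \<exists>z. en e = {x, z} \<and> linked en {e\<in>T. x \<notin> en e} z w)"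
  using assms
proof (induction rule: linked_induct)
  case (step y z e)
  show ?case
  proof (cases "z = x \<or> y = x")
    case True then show ?thesis using step.hyps by auto
  next
    case False
    then have "e \<in> {e\<in>T. x \<notin> en e}" using step.hyps by auto
    then have "linked en {e\<in>T. x \<notin> en e} y z" using step.hyps(3) by (rule linked_edge)
    then show ?thesis using step.IH False by (meson linked_trans)
  qed
qed simp

text \<open>
  An arm of \<open>x\<close> through its neighbour \<open>y\<close> reaches distance \<open>m\<close> without returning to \<open>x\<close>. Distances are
  taken in the maximum norm and the arm is required to stay in the box of radius \<open>m\<close>, so that the
  event depends on finitely many edges.
\<close>

definition box_edges :: "int ^ 'd \<Rightarrow> nat \<Rightarrow> (int ^ 'd) set set" where
  "box_edges x m = {e \<in> edges int_lattice. \<forall>y\<in>e. \<forall>i. \<bar>y $ i - x $ i\<bar> \<le> int m}"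

definition far :: "int ^ 'd \<Rightarrow> nat \<Rightarrow> int ^ 'd \<Rightarrow> bool" where
  "far x m z \<longleftrightarrow> (\<exists>i. int m \<le> \<bar>z $ i - x $ i\<bar>)"

definition arm :: "(int ^ 'd) set set \<Rightarrow> int ^ 'd \<Rightarrow> nat \<Rightarrow> int ^ 'd \<Rightarrow> bool" where
  "arm F x m y \<longleftrightarrow> {x, y} \<in> F \<inter> box_edges x m \<and>
     (\<exists>z. far x m z \<and> linked (\<lambda>e. e) {e \<in> F \<inter> box_edges x m. x \<notin> e} y z)"

definition two_arms :: "(int ^ 'd) set set \<Rightarrow> int ^ 'd \<Rightarrow> nat \<Rightarrow> bool" where
  "two_arms F x m \<longleftrightarrow> (\<exists>y y'. y \<noteq> y' \<and> arm F x m y \<and> arm F x m y')"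

lemma two_arms_local: "two_arms (F \<inter> box_edges x m) x m \<longleftrightarrow> two_arms F x m"
  by (simp add: two_arms_def arm_def)

text \<open>
  In a spanning tree of the wired graph with two arms at \<open>x\<close>, at least one arm does not start with the
  first edge \<open>e\<close> of the path from \<open>x\<close> to the root. After removing \<open>e\<close> this arm is still there, so the
  component of \<open>x\<close> in the remaining two-component forest reaches distance \<open>m\<close> in one of the \<open>2 * d\<close>
  coordinate directions. There are at most \<open>2 * d\<close> possibilities for \<open>e\<close>, and \<open>e\<close> and the forest
  determine the tree.
\<close>

lemma two_arms_count:
  fixes K :: "(int ^ 'd::finite) set"
  assumes dim: "CARD('d) > 2" and K: "finite K" and m: "m > 0"
    and inK: "\<And>z. (\<And>i. \<bar>z $ i - x $ i\<bar> \<le> int m) \<Longrightarrow> z \<in> K"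
  shows "real (card {T \<in> spanning_trees (wired int_lattice K). two_arms T x m})
    \<le> 4 * real CARD('d) ^ 2 * reach_const (real CARD('d)) * real m powr - beta_exp (real CARD('d))
       * real (card (spanning_trees (wired int_lattice K)))"
proof -
  let ?G = "wired int_lattice K" and ?d = "real CARD('d)"
  let ?V = "verts ?G" and ?E = "edges ?G" and ?en = "endpoints ?G"
  have xK: "x \<in> K" by (rule inK) simp
  obtain src tgt where "network ?V ?E ?en src tgt (Some x) None"
    using wired_network[OF K xK] by blast
  then interpret network ?V ?E ?en src tgt "Some x" None .
  have st: "spanning_trees ?G = trees {} {}"
  proof -
    have en_sub: "?en e \<subseteq> ?V" for e unfolding wired_simps by (rule image_subsetI) (rule glue_in)
    have xV: "Some x \<in> ?V" using xK by (auto simp: wired_simps)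
    have "(\<forall>u\<in>?V. \<forall>v\<in>?V. lk T u v) \<longleftrightarrow> (\<forall>u\<in>?V. lk T (Some x) u)" for T
      using xV by (meson linked_sym linked_trans)
    moreover have "T \<in> spanning_trees ?G \<longleftrightarrow> T \<subseteq> ?E \<and> acyc ?en T \<and> (\<forall>u\<in>?V. \<forall>v\<in>?V. lk T u v)" for T
      by (rule spanning_trees_iff) (use en_sub xV in auto)
    ultimately show ?thesis unfolding trees_def by auto
  qed
  define reach where "reach i \<sigma> F \<longleftrightarrow> (\<exists>a. \<sigma> * x $ i + int m \<le> \<sigma> * a $ i \<and> lk F (Some x) (Some a))" for i :: 'd and \<sigma> :: int and F
  define FR where "FR = (\<lambda>(i, \<sigma>). {F \<in> forests {} {}. reach i \<sigma> F})"
  let ?c = "reach_const ?d * real m powr - beta_exp ?d * real (card (trees {} {}))"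
  have FR: "real (card (FR (i, \<sigma>))) \<le> ?c" if "\<sigma> = 1 \<or> \<sigma> = -1" for i \<sigma>
  proof -
    interpret H: wired_half_space i \<sigma> K src tgt x
      by unfold_locales (use that K xK dim in auto)
    have "reach i \<sigma> F = H.reaches m F" for F by (simp add: reach_def H.reaches_def H.level_def)
    then show ?thesis using H.reaches_count[OF m] by (simp add: FR_def)
  qed
  define I where "I = (UNIV :: 'd set) \<times> {1, -1 :: int}"
  define Z where "Z = star x \<times> (\<Union>p\<in>I. FR p)"
  have ex: "\<exists>e. (e, T - {e}) \<in> Z \<and> e \<in> T" if T: "T \<in> trees {} {}" and arms: "two_arms T x m" for T
  proof -
    have TE: "T \<subseteq> ?E" and ac: "acyc ?en T" and Tr: "lk T (Some x) None"
      using T rV by (auto simp: trees_def)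
    obtain e z where e: "e \<in> T" "?en e = {Some x, z}" "lk {e\<in>T. Some x \<notin> ?en e} z None"
      using linked_first_edge[OF Tr] by auto
    have zr: "lk (T - {e}) z None" by (rule linked_mono[OF e(3)]) (use e(2) in auto)
    have xe: "x \<in> e" using e(2) by (auto simp: wired_simps glue_Some dest!: equalityD2)
    have eE: "e \<in> ?E" using e TE by auto
    have zV: "z \<in> ?V" using e(2) glue_in by (fastforce simp: wired_simps dest!: equalityD2)
    have F: "T - {e} \<in> forests {} {}"
      using bij_betwE[OF tree_cut_bij[of e "{}" "Some x" z "{}", OF _ e(2) zV]] T e zr eE by auto
    obtain y where y: "arm T x m y" "{x, y} \<noteq> e"
      using arms unfolding two_arms_def by (metis doubleton_eq_iff)
    obtain w where w: "far x m w" "linked (\<lambda>e. e) {e \<in> T \<inter> box_edges x m. x \<notin> e} y w"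
      using y by (auto simp: arm_def)
    have box_in: "v \<in> K" if "f \<in> box_edges x m" "v \<in> f" for f v
      using that by (intro inK) (auto simp: box_edges_def)
    have xy: "lk (T - {e}) (Some x) (Some y)"
      by (rule linked_edge[of "{x, y}"]) (use y box_in xK in \<open>auto simp: arm_def wired_simps glue_def\<close>)
    have "lk (T - {e}) (Some y) (Some w)"
      using w(2)
    proof (induction rule: linked_induct)
      case (step u v f)
      then have "f \<in> T - {e}" "u \<in> K" "v \<in> K" using xe box_in by auto
      then have "lk (T - {e}) (Some u) (Some v)"
        using step.hyps(3) by (intro linked_edge[of f]) (auto simp: wired_simps glue_def)
      then show ?case using step.IH by (rule linked_trans[rotated])
    qed simp
    then have xw: "lk (T - {e}) (Some x) (Some w)" by (rule linked_trans[OF xy])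
    obtain i where i: "int m \<le> \<bar>w $ i - x $ i\<bar>" using w(1) by (auto simp: far_def)
    define \<sigma> :: int where "\<sigma> = (if w $ i \<ge> x $ i then 1 else -1)"
    have "reach i \<sigma> (T - {e})" unfolding reach_def using i xw by (intro exI[of _ w]) (auto simp: \<sigma>_def)
    then have "T - {e} \<in> FR (i, \<sigma>)" "(i, \<sigma>) \<in> I" using F by (auto simp: FR_def I_def \<sigma>_def)
    moreover have "e \<in> star x" using xe eE by (auto simp: star_def wired_simps)
    ultimately show ?thesis using e(1) unfolding Z_def by blast
  qed
  then obtain g where g: "\<And>T. T \<in> trees {} {} \<Longrightarrow> two_arms T x m \<Longrightarrow> (g T, T - {g T}) \<in> Z \<and> g T \<in> T"
    by metis
  have finZ: "finite Z" using star_card[of x] by (auto simp: Z_def I_def FR_def)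
  have "card {T \<in> trees {} {}. two_arms T x m} \<le> card Z"
  proof (rule card_inj_on_le[where f = "\<lambda>T. (g T, T - {g T})", OF _ _ finZ])
    show "inj_on (\<lambda>T. (g T, T - {g T})) {T \<in> trees {} {}. two_arms T x m}"
    proof (rule inj_onI)
      fix S T assume S: "S \<in> {T \<in> trees {} {}. two_arms T x m}" and T: "T \<in> {T \<in> trees {} {}. two_arms T x m}"
        and eq: "(g S, S - {g S}) = (g T, T - {g T})"
      have 1: "g S = g T" and 2: "S - {g S} = T - {g T}" using eq by auto
      have "g S \<in> S" "g T \<in> T" using g S T by auto
      then have S': "insert (g S) (S - {g S}) = S" and T': "insert (g T) (T - {g T}) = T" by auto
      show "S = T" by (rule trans[OF trans[OF S'[symmetric] arg_cong2[where f = insert, OF 1 2]] T'])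
    qed
  qed (use g in auto)
  also have "\<dots> = card (star x) * card (\<Union>p\<in>I. FR p)" by (simp add: Z_def card_cartesian_product)
  finally have "real (card {T \<in> trees {} {}. two_arms T x m}) \<le> real (card (star x) * card (\<Union>p\<in>I. FR p))"
    by (rule of_nat_mono)
  also have "\<dots> = real (card (star x)) * real (card (\<Union>p\<in>I. FR p))" by (rule of_nat_mult)
  also have "\<dots> \<le> (2 * ?d) * (2 * ?d * ?c)"
  proof (rule mult_mono)
    show "real (card (star x)) \<le> 2 * ?d" using of_nat_mono[OF star_card[of x, THEN conjunct2], where 'a = real] by simp
    have "real (card (\<Union>p\<in>I. FR p)) \<le> (\<Sum>p\<in>I. real (card (FR p)))"
      using of_nat_mono[OF card_UN_le[of I FR], where 'a = real] by (simp add: I_def)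
    also have "\<dots> \<le> (\<Sum>p\<in>I. ?c)" by (rule sum_mono) (use FR in \<open>auto simp: I_def\<close>)
    also have "\<dots> = 2 * ?d * ?c" by (simp add: I_def card_cartesian_product)
    finally show "real (card (\<Union>p\<in>I. FR p)) \<le> 2 * ?d * ?c" .
  qed auto
  finally show ?thesis unfolding st by (simp add: power2_eq_square)
qed

section \<open>Forests without two infinite arms\<close>

abbreviation "joined \<equiv> linked (\<lambda>e. e)"

text \<open>
  \<open>branch F x y\<close> is the component of \<open>y\<close> after the removal of \<open>x\<close>. For \<open>x = 0\<close> these are the
  components in the statement of the theorem.
\<close>

definition away :: "'v set set \<Rightarrow> 'v \<Rightarrow> 'v set set" where "away F x = {e \<in> F. x \<notin> e}"

definition branch :: "'v set set \<Rightarrow> 'v \<Rightarrow> 'v \<Rightarrow> 'v set" where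
  "branch F x y = {z. joined (away F x) y z}"

lemma branch_self: "y \<in> branch F x y"
  by (simp add: branch_def)

lemma branch_eq: "z \<in> branch F x y \<Longrightarrow> branch F x z = branch F x y"
  unfolding branch_def by (auto intro: linked_trans linked_sym)

lemma branch_avoids: 
  assumes "z \<in> branch F x y" "y \<noteq> x" shows "z \<noteq> x"
  using assms(1) unfolding branch_def mem_Collect_eq
  by (induction rule: linked_induct) (use assms(2) in \<open>auto simp: away_def\<close>)

lemma branch_step: "a \<in> branch F x y \<Longrightarrow> {a, b} \<in> F \<Longrightarrow> x \<notin> {a, b} \<Longrightarrow> b \<in> branch F x y"
  unfolding branch_def mem_Collect_eq by (erule linked_trans, rule linked_edge) (auto simp: away_def)

lemma joined_first: 
  assumes "joined F x w" "w \<noteq> x"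
  obtains z where "{x, z} \<in> F" "w \<in> branch F x z"
  using linked_first_edge[OF assms(1)] assms(2) unfolding branch_def away_def by auto

lemma lattice_edge_dist:
  assumes "e \<in> edges int_lattice" "a \<in> e" "b \<in> e"
  shows "\<bar>a $ i - b $ i\<bar> \<le> 1"
proof -
  obtain p q :: "int ^ 'a" where e: "e = {p, q}" and s: "(\<Sum>i\<in>UNIV. \<bar>p $ i - q $ i\<bar>) = 1"
    using assms(1) by (auto simp: int_lattice_def)
  have "\<bar>p $ i - q $ i\<bar> \<le> 1" unfolding s[symmetric] by (rule member_le_sum) auto
  then show ?thesis using assms e by auto
qed

lemma lattice_edge_ne: "{a, b} \<in> edges int_lattice \<Longrightarrow> a \<noteq> (b :: int ^ 'd::finite)"
  by (auto simp: int_lattice_def)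

lemma finite_near: "finite {z :: int ^ 'd::finite. \<not> far x m z}"
proof (rule finite_subset)
  show "{z. \<not> far x m z} \<subseteq> {z. \<forall>i. z $ i \<in> {x $ i - int m..x $ i + int m}}"
    by (auto simp: far_def not_le abs_less_iff) (smt (verit))+
qed (rule card_vec_Collect, simp)

text \<open>
  A path in the branch to a far vertex is followed up to the first far vertex on it; up to there it
  stays in the box.
\<close>

lemma arm_if_far_branch:
  assumes F: "F \<subseteq> edges int_lattice" and xy: "{x, y} \<in> F" and m: "m > 0"
    and z: "z \<in> branch F x y" "far x m z"
  shows "arm F x m y"
proof -
  let ?B = "{e \<in> F \<inter> box_edges x m. x \<notin> e}"
  have "(\<exists>z'. far x m z' \<and> joined ?B y z') \<or> (joined ?B y w \<and> \<not> far x m w)" if "w \<in> branch F x y" for w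
    using that unfolding branch_def mem_Collect_eq
  proof (induction rule: linked_induct)
    case (step u v e)
    show ?case
    proof (cases "\<exists>z'. far x m z' \<and> joined ?B y z'")
      case False
      then have u: "joined ?B y u" "\<not> far x m u" using step.IH by auto
      have e: "e \<in> F" "x \<notin> e" "e = {u, v}" using step.hyps by (auto simp: away_def)
      have "\<bar>w $ i - x $ i\<bar> \<le> int m" if "w \<in> e" for w i
      proof -
        have "\<bar>w $ i - u $ i\<bar> \<le> 1" by (rule lattice_edge_dist[of e]) (use e F that in auto)
        moreover have "\<bar>u $ i - x $ i\<bar> < int m" using u(2) by (simp add: far_def not_le)
        ultimately show ?thesis by linarith
      qed
      then have "e \<in> ?B" using e F by (auto simp: box_edges_def)
      then have "joined ?B u v" by (rule linked_edge) (simp add: e)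
      then have "joined ?B y v" using u(1) by (rule linked_trans[rotated])
      then show ?thesis using False by auto
    qed simp
  qed auto
  then have "\<exists>z'. far x m z' \<and> joined ?B y z'" using z by blast
  moreover have "\<bar>w $ i - x $ i\<bar> \<le> int m" if "w \<in> {x, y}" for w i
    using lattice_edge_dist[of "{x, y}" w x i] that F xy m by auto
  then have "{x, y} \<in> box_edges x m" using F xy by (auto simp: box_edges_def)
  ultimately show ?thesis using xy by (auto simp: arm_def)
qed

lemma arm_if_infinite_branch:
  assumes F: "F \<subseteq> edges int_lattice" and xy: "{x, y} \<in> F" and m: "m > 0"
    and inf: "infinite (branch F x (y :: int ^ 'd::finite))"
  shows "arm F x m y"
proof -
  have "\<not> branch F x y \<subseteq> {z. \<not> far x m z}" using inf finite_near finite_subset by blast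
  then show ?thesis using arm_if_far_branch[OF F xy m] by blast
qed

lemma tree_at_0_simps:
  "verts (tree_at_0 F) = {u. joined F 0 u}"
  "edges (tree_at_0 F) = {e \<in> F. e \<subseteq> {u. joined F 0 u}}"
  "endpoints (tree_at_0 F) = (\<lambda>e. e)"
  by (simp_all add: tree_at_0_def cluster_def reachable_eq_linked Let_def)

text \<open>
  Every component of the tree of \<open>0\<close> without \<open>0\<close> is a branch at \<open>0\<close>; passing to the cluster of \<open>0\<close>
  first makes no difference, since a path from a vertex of the cluster stays in it.
\<close>

lemma components_eq_branches:
  "components_verts (remove_verts (tree_at_0 F) {0}) = {branch F 0 v | v. joined F 0 v \<and> v \<noteq> 0}"
proof -
  let ?G = "remove_verts (tree_at_0 F) {0}"
  have G: "verts ?G = {u. joined F 0 u} - {0}" "edges ?G = {e \<in> F. e \<subseteq> {u. joined F 0 u} \<and> 0 \<notin> e}"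
    "endpoints ?G = (\<lambda>e. e)"
    by (auto simp: remove_verts_def tree_at_0_simps)
  have "verts (cluster ?G v) = branch F 0 v" if v: "joined F 0 v" "v \<noteq> 0" for v
  proof -
    have 1: "joined (edges ?G) v u \<and> joined F 0 u \<and> u \<noteq> 0" if "joined (away F 0) v u" for u
      using that
    proof (induction rule: linked_induct)
      case (step y z e)
      have e: "e \<in> F" "0 \<notin> e" "e = {y, z}" using step.hyps by (auto simp: away_def)
      have yz: "joined F y z" by (rule linked_edge[OF e(1)]) (rule e(3))
      have z: "joined F 0 z" by (rule linked_trans[OF _ yz]) (use step.IH in simp)
      then have "e \<in> edges ?G" using e step.IH unfolding G by auto
      then have yz': "joined (edges ?G) y z" by (rule linked_edge) (rule e(3))
      have "joined (edges ?G) v z" by (rule linked_trans[OF _ yz']) (use step.IH in simp)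
      then show ?case using z e by auto
    qed (use v in auto)
    have 2: "joined (away F 0) v u" if "joined (edges ?G) v u" for u
      using that by (rule linked_mono) (auto simp: G away_def)
    have "verts (cluster ?G v) = {u \<in> verts ?G. joined (edges ?G) v u}"
      by (simp add: cluster_def Let_def reachable_eq_linked G(3))
    then show ?thesis unfolding G(1) branch_def using 1 2 by blast
  qed
  then show ?thesis unfolding components_verts_def G(1) by blast
qed

lemma finite_part_iff: "w \<in> finite_part F \<longleftrightarrow> joined F 0 w \<and> w \<noteq> 0 \<and> finite (branch F 0 w)"
proof
  assume "w \<in> finite_part F"
  then obtain v where v: "w \<in> branch F 0 v" "joined F 0 v" "v \<noteq> 0" "finite (branch F 0 v)"
    by (auto simp: finite_part_def components_eq_branches)
  have "joined F v w" using v(1) unfolding branch_def mem_Collect_eq by (rule linked_mono) (auto simp: away_def)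
  then show "joined F 0 w \<and> w \<noteq> 0 \<and> finite (branch F 0 w)"
    using v branch_eq[OF v(1)] branch_avoids[OF v(1,3)] linked_trans[OF v(2)] by auto
next
  assume "joined F 0 w \<and> w \<noteq> 0 \<and> finite (branch F 0 w)"
  then show "w \<in> finite_part F"
    using branch_self[of w F 0] unfolding finite_part_def components_eq_branches by blast
qed

lemma finite_neighbours:
  assumes "F \<subseteq> edges int_lattice" shows "finite {z :: int ^ 'd::finite. {x, z} \<in> F}"
proof (rule finite_subset)
  show "{z. {x, z} \<in> F} \<subseteq> \<Union>(star x)" using assms by (auto simp: star_def)
  show "finite (\<Union>(star x))"
  proof (rule finite_Union)
    show "finite e" if "e \<in> star x" for e using that lattice_edgeE[of e] by (auto simp: star_def)
  qed (use star_card in auto)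
qed

lemma finite_finite_part:
  assumes "F \<subseteq> edges (int_lattice :: (int ^ 'd::finite, _) multigraph)" shows "finite (finite_part F)"
proof (rule finite_subset)
  show "finite_part F \<subseteq> (\<Union>z\<in>{z. {0, z} \<in> F \<and> finite (branch F 0 z)}. branch F 0 z)"
  proof
    fix w assume "w \<in> finite_part F"
    then have w: "joined F 0 w" "w \<noteq> 0" "finite (branch F 0 w)" by (auto simp: finite_part_iff)
    obtain z where z: "{0, z} \<in> F" "w \<in> branch F 0 z" using joined_first[OF w(1,2)] .
    then show "w \<in> (\<Union>z\<in>{z. {0, z} \<in> F \<and> finite (branch F 0 z)}. branch F 0 z)"
      using w branch_eq[OF z(2)] by auto
  qed
  have "finite {z. {0, z} \<in> F \<and> finite (branch F 0 z)}"
    by (rule finite_subset[OF _ finite_neighbours[OF assms, of 0]]) auto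
  then show "finite (\<Union>z\<in>{z. {0, z} \<in> F \<and> finite (branch F 0 z)}. branch F 0 z)" by auto
qed

text \<open>
  The properties of almost every sample that determine its geometry: edges leave every finite set, so
  all components are infinite, and no vertex has two arms of every length.
\<close>

locale one_arm_forest =
  fixes F :: "(int ^ 'd::finite) set set"
  assumes lattice: "F \<subseteq> edges int_lattice"
    and escape: "finite U \<Longrightarrow> U \<noteq> {} \<Longrightarrow> \<exists>e\<in>F. e \<inter> U \<noteq> {} \<and> \<not> e \<subseteq> U"
    and one_arm: "\<exists>m>0. \<not> two_arms F x m"
begin

lemma edge_ne: "{a, b} \<in> F \<Longrightarrow> a \<noteq> b"
  using lattice lattice_edge_ne by blast

lemma edge_pair: "e \<in> F \<Longrightarrow> a \<in> e \<Longrightarrow> \<exists>b. e = {a, b}"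
  using lattice by (auto elim!: lattice_edgeE dest!: subsetD)

lemma infinite_cluster: "infinite {z. joined F x z}"
proof
  assume "finite {z. joined F x z}"
  moreover have "{z. joined F x z} \<noteq> {}" by auto
  ultimately obtain e a where e: "e \<in> F" "a \<in> e" "joined F x a" "\<not> e \<subseteq> {z. joined F x z}"
    using escape[of "{z. joined F x z}"] by auto
  obtain b where "e = {a, b}" using edge_pair e by blast
  then have "joined F a b" using e(1) by (intro linked_edge[of e]) auto
  then have "joined F x b" by (rule linked_trans[OF e(3)])
  then show False using e \<open>e = {a, b}\<close> by auto
qed

lemma infinite_branch_unique:
  assumes "{x, y} \<in> F" "infinite (branch F x y)" "{x, y'} \<in> F" "infinite (branch F x y')"
  shows "y = y'"
  using one_arm[of x] arm_if_infinite_branch[OF lattice] assms unfolding two_arms_def by metis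

lemma infinite_branch_exists: "\<exists>y. {x, y} \<in> F \<and> infinite (branch F x y)"
proof (rule ccontr)
  assume *: "\<nexists>y. {x, y} \<in> F \<and> infinite (branch F x y)"
  have "{z. joined F x z} \<subseteq> {x} \<union> (\<Union>y\<in>{y. {x, y} \<in> F}. branch F x y)"
    by (auto elim: joined_first)
  moreover have "finite ({x} \<union> (\<Union>y\<in>{y. {x, y} \<in> F}. branch F x y))"
    using * finite_neighbours[OF lattice, of x] by auto
  ultimately show False using infinite_cluster finite_subset by blast
qed

text \<open>
  Exactly one branch at \<open>x\<close> is infinite: one exists because the component of \<open>x\<close> is infinite and \<open>x\<close>
  has finitely many neighbours, and two would give two arms of every length.
\<close>

definition parent :: "int ^ 'd \<Rightarrow> int ^ 'd" where
  "parent x = (SOME y. {x, y} \<in> F \<and> infinite (branch F x y))"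

lemma parent: "{x, parent x} \<in> F" "infinite (branch F x (parent x))"
  using someI_ex[OF infinite_branch_exists[of x]] by (auto simp: parent_def)

lemma parent_eq: "{x, y} \<in> F \<Longrightarrow> infinite (branch F x y) \<Longrightarrow> parent x = y"
  using infinite_branch_unique parent by blast

text \<open>
  If the infinite branch at \<open>y\<close> began with \<open>x\<close>, then it would consist of \<open>x\<close> and branches at \<open>x\<close> other than
  the one through \<open>y\<close>, all of which are finite.
\<close>

lemma parent_parent: "parent (parent x) \<noteq> x"
proof
  define y where "y = parent x"
  assume "parent (parent x) = x"
  then have inf: "infinite (branch F y x)" using parent[of y] by (simp add: y_def)
  have "branch F y x \<subseteq> {x} \<union> (\<Union>y'\<in>{y'. {x, y'} \<in> F \<and> y' \<noteq> y}. branch F x y')"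
  proof
    fix z assume "z \<in> branch F y x"
    then have z: "joined (away F y) x z" by (simp add: branch_def)
    show "z \<in> {x} \<union> (\<Union>y'\<in>{y'. {x, y'} \<in> F \<and> y' \<noteq> y}. branch F x y')"
    proof (cases "z = x")
      case False
      obtain y' where y': "{x, y'} \<in> away F y" "z \<in> branch (away F y) x y'" using joined_first[OF z False] .
      have "z \<in> branch F x y'" using y'(2) unfolding branch_def mem_Collect_eq
        by (rule linked_mono) (auto simp: away_def)
      then show ?thesis using y'(1) by (auto simp: away_def)
    qed simp
  qed
  moreover have fin: "finite {y'. {x, y'} \<in> F \<and> y' \<noteq> y}"
    by (rule finite_subset[OF _ finite_neighbours[OF lattice, of x]]) auto
  moreover have "finite (branch F x y')" if "{x, y'} \<in> F" "y' \<noteq> y" for y'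
    using that parent_eq by (auto simp: y_def)
  then have "finite (\<Union>y'\<in>{y'. {x, y'} \<in> F \<and> y' \<noteq> y}. branch F x y')"
    by (intro finite_UN_I[OF fin]) auto
  ultimately show False using inf by (meson finite.emptyI finite.insertI finite_UnI finite_subset)
qed

text \<open>
  The infinite branches along successive parents are nested, which makes the orbit of a vertex under
  \<open>parent\<close> a ray: by \<open>branch_avoids\<close> the infinite branch at a vertex does not contain the vertex.
\<close>

lemma branch_parent_mono: "branch F (parent x) (parent (parent x)) \<subseteq> branch F x (parent x)"
proof -
  define y where "y = parent x"
  define w where "w = parent y"
  have wx: "w \<noteq> x" using parent_parent by (simp add: w_def y_def)
  have xy: "{x, y} \<in> F" "{y, w} \<in> F" "infinite (branch F y w)" using parent by (simp_all add: y_def w_def)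
  have x_out: "x \<notin> branch F y w"
  proof
    assume "x \<in> branch F y w"
    then have "infinite (branch F y x)" using branch_eq xy(3) by metis
    then have "parent y = x" using xy by (intro parent_eq) (auto simp: insert_commute)
    then show False using wx by (simp add: w_def)
  qed
  have yw: "w \<in> branch F x y" using branch_step[OF branch_self xy(2)] edge_ne[OF xy(1)] wx by auto
  have "z \<in> branch F x y \<and> z \<in> branch F y w" if "joined (away F y) w z" for z
    using that
  proof (induction rule: linked_induct)
    case (step a b e)
    have e: "{a, b} \<in> F" "y \<notin> {a, b}" using step.hyps by (auto simp: away_def)
    have b: "b \<in> branch F y w" by (rule branch_step[OF conjunct2[OF step.IH] e])
    then have "x \<notin> {a, b}" using x_out step.IH by blast
    then have "b \<in> branch F x y" by (rule branch_step[OF conjunct1[OF step.IH] e(1)])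
    then show ?case using b by simp
  qed (use yw branch_self in auto)
  then show ?thesis unfolding y_def[symmetric] w_def[symmetric] by (auto simp: branch_def)
qed

definition orbit :: "int ^ 'd \<Rightarrow> nat \<Rightarrow> int ^ 'd" where "orbit x n = (parent ^^ n) x"

lemma orbit_Suc: "orbit x (Suc n) = parent (orbit x n)" by (simp add: orbit_def)

lemma orbit_in_branch: "n < m \<Longrightarrow> orbit x m \<in> branch F (orbit x n) (orbit x (Suc n))"
proof -
  assume "n < m"
  then obtain k where k: "m = Suc n + k" using less_iff_Suc_add by auto
  have "branch F (orbit x (n + k)) (orbit x (Suc (n + k))) \<subseteq> branch F (orbit x n) (orbit x (Suc n))" for k
  proof (induction k)
    case (Suc k) then show ?case using branch_parent_mono[of "orbit x (n + k)"] by (auto simp: orbit_Suc)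
  qed simp
  then show ?thesis using branch_self k by fastforce
qed

lemma orbit_inj: "inj (orbit x)"
proof -
  have "orbit x m \<noteq> orbit x n" if "n < m" for n m
    using branch_avoids[OF orbit_in_branch[OF that]] edge_ne parent(1)[of "orbit x n"] by (metis orbit_Suc)
  then show ?thesis by (metis injI nat_neq_iff)
qed

text \<open>
  A ray stays in the branch of its next vertex, which is therefore infinite.
\<close>

lemma ray_eq_orbit:
  assumes r: "r \<in> rays (tree_at_0 F)"
  shows "r = orbit (r 0)"
proof -
  have inj: "inj r" using r by (simp add: rays_def)
  have ed: "{r n, r (Suc n)} \<in> F" for n
    using r unfolding rays_def adjacent_def by (auto simp: tree_at_0_simps dest!: spec[of _ n])
  have "r (Suc n) = parent (r n)" for n
  proof -
    have "r (Suc n + k) \<in> branch F (r n) (r (Suc n))" for k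
    proof (induction k)
      case (Suc k)
      have "r n \<notin> {r (Suc n + k), r (Suc (Suc n + k))}" using inj by (auto simp: inj_eq)
      then show ?case using branch_step[OF Suc.IH ed] by simp
    qed (simp add: branch_self)
    then have "range (\<lambda>k. r (Suc n + k)) \<subseteq> branch F (r n) (r (Suc n))" by auto
    moreover have "infinite (range (\<lambda>k. r (Suc n + k)))"
      by (intro range_inj_infinite injI) (auto dest: injD[OF inj])
    ultimately have "infinite (branch F (r n) (r (Suc n)))" using finite_subset by blast
    then show ?thesis using parent_eq[OF ed] by metis
  qed
  then have "r n = orbit (r 0) n" for n by (induction n) (simp_all add: orbit_Suc, simp add: orbit_def)
  then show ?thesis by (rule ext)
qed

lemma orbit_in_rays: "orbit 0 \<in> rays (tree_at_0 F)"
proof -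
  have j: "joined F 0 (orbit 0 n)" for n
  proof (induction n)
    case (Suc n)
    have "joined F (orbit 0 n) (orbit 0 (Suc n))" unfolding orbit_Suc by (rule linked_edge[OF parent(1)]) simp
    then show ?case using Suc by (rule linked_trans[rotated])
  qed (simp add: orbit_def)
  have "adjacent (tree_at_0 F) (orbit 0 n) (orbit 0 (Suc n))" for n
    unfolding adjacent_def tree_at_0_simps using j[of n] j[of "Suc n"] parent(1)[of "orbit 0 n"]
    by (intro bexI[of _ "{orbit 0 n, orbit 0 (Suc n)}"]) (auto simp: orbit_Suc)
  then show ?thesis using j orbit_inj by (auto simp: rays_def tree_at_0_simps)
qed

text \<open>
  The branch at \<open>u\<close> through \<open>v\<close> and the branch at \<open>v\<close> through \<open>u\<close> cover the component, so they are not
  both finite.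
\<close>

lemma parent_of_edge:
  assumes "{u, v} \<in> F" shows "parent u = v \<or> parent v = u"
proof (rule ccontr)
  assume n: "\<not> ?thesis"
  have vu: "{v, u} \<in> F" using assms by (simp add: insert_commute)
  have fin: "finite (branch F u v)" "finite (branch F v u)" using n parent_eq assms vu by blast+
  have uv: "u \<noteq> v" using edge_ne[OF assms] .
  have "z \<in> branch F u v \<union> branch F v u" if "joined F u z" for z
    using that
  proof (induction rule: linked_induct)
    case (step a b e)
    have e: "{a, b} \<in> F" using step.hyps by simp
    have av: "a \<in> branch F v u \<Longrightarrow> a \<noteq> v" "a \<in> branch F u v \<Longrightarrow> a \<noteq> u"
      using branch_avoids uv by metis+
    consider "a \<in> branch F u v" "b = u" | "a \<in> branch F u v" "b \<noteq> u"
      | "a \<in> branch F v u" "b = v" | "a \<in> branch F v u" "b \<noteq> v" using step.IH by blast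
    then show ?case
    proof cases
      case 1 then show ?thesis using branch_self[of u F v] by simp
    next
      case 2 then show ?thesis using branch_step[OF 2(1) e] av by auto
    next
      case 3 then show ?thesis using branch_self[of v F u] by simp
    next
      case 4 then show ?thesis using branch_step[OF 4(1) e] av by auto
    qed
  qed (simp add: branch_self)
  then have "{z. joined F u z} \<subseteq> branch F u v \<union> branch F v u" by auto
  then show False using infinite_cluster fin finite_subset by (metis finite_UnI)
qed

lemma range_orbit: "range (orbit u) = insert u (range (orbit (parent u)))"
proof -
  have "orbit u (Suc n) = orbit (parent u) n" for n by (simp add: orbit_def funpow_swap1)
  moreover have "orbit u 0 = u" by (simp add: orbit_def)
  moreover have "range (orbit u) = insert (orbit u 0) (range (\<lambda>n. orbit u (Suc n)))"
    by (auto simp: image_iff) (metis not0_implies_Suc)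
  ultimately show ?thesis by simp
qed

lemma orbits_merge:
  assumes "joined F u v"
  shows "finite ((range (orbit u) - range (orbit v)) \<union> (range (orbit v) - range (orbit u)))"
  using assms
proof (induction rule: linked_induct)
  case (step y z e)
  have "{y, z} \<in> F" using step.hyps by simp
  then have "range (orbit y) = insert y (range (orbit z)) \<or> range (orbit z) = insert z (range (orbit y))"
    using parent_of_edge range_orbit by metis
  then have "(range (orbit y) - range (orbit z)) \<union> (range (orbit z) - range (orbit y)) \<subseteq> {y, z}"
    by blast
  then have "finite ((range (orbit y) - range (orbit z)) \<union> (range (orbit z) - range (orbit y)))"
    by (rule finite_subset) simp
  then have "finite (((range (orbit u) - range (orbit y)) \<union> (range (orbit y) - range (orbit u)))
    \<union> ((range (orbit y) - range (orbit z)) \<union> (range (orbit z) - range (orbit y))))"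
    using step.IH by (rule finite_UnI[rotated])
  then show ?case by (rule finite_subset[rotated]) auto
qed simp

lemma one_end: "card (tree_ends (tree_at_0 F)) = 1"
proof -
  let ?R = "rays (tree_at_0 F)"
  let ?rel = "{(p, q). p \<in> ?R \<and> q \<in> ?R \<and> finite ((range p - range q) \<union> (range q - range p))}"
  have "finite ((range p - range q) \<union> (range q - range p))" if "p \<in> ?R" "q \<in> ?R" for p q
  proof -
    have start: "joined F 0 (r 0)" if "r \<in> ?R" for r
    proof -
      have "range r \<subseteq> verts (tree_at_0 F)" using that by (simp add: rays_def)
      then have "r 0 \<in> verts (tree_at_0 F)" by (rule subsetD) simp
      then show ?thesis by (simp add: tree_at_0_simps)
    qed
    have "joined F (p 0) (q 0)" by (rule linked_trans[OF linked_sym[OF start] start]) (fact that)+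
    then have "finite ((range (orbit (p 0)) - range (orbit (q 0))) \<union> (range (orbit (q 0)) - range (orbit (p 0))))"
      by (rule orbits_merge)
    then show ?thesis unfolding ray_eq_orbit[OF that(1), symmetric] ray_eq_orbit[OF that(2), symmetric] .
  qed
  then have "?rel `` {p} = ?R" if "p \<in> ?R" for p using that by auto
  then have "tree_ends (tree_at_0 F) = (\<Union>p\<in>?R. {?R})"
    unfolding tree_ends_def quotient_def by simp
  also have "\<dots> = {?R}" using orbit_in_rays by auto
  finally show ?thesis by simp
qed

lemma one_infinite_component:
  "card {K \<in> components_verts (remove_verts (tree_at_0 F) {0}). infinite K} = 1"
proof -
  have "{K \<in> components_verts (remove_verts (tree_at_0 F) {0}). infinite K} = {branch F 0 (parent 0)}"
  proof (intro equalityI subsetI)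
    fix K assume "K \<in> {K \<in> components_verts (remove_verts (tree_at_0 F) {0}). infinite K}"
    then obtain v where v: "K = branch F 0 v" "joined F 0 v" "v \<noteq> 0" "infinite K"
      by (auto simp: components_eq_branches)
    obtain z where z: "{0, z} \<in> F" "v \<in> branch F 0 z" using joined_first[OF v(2,3)] .
    have "K = branch F 0 z" using branch_eq[OF z(2)] v by simp
    then show "K \<in> {branch F 0 (parent 0)}" using parent_eq[OF z(1)] v by simp
  next
    fix K assume K: "K \<in> {branch F 0 (parent 0)}"
    have "joined F 0 (parent 0)" by (rule linked_edge[OF parent(1)]) simp
    moreover have "parent 0 \<noteq> 0" using edge_ne[OF parent(1)] by metis
    ultimately show "K \<in> {K \<in> components_verts (remove_verts (tree_at_0 F) {0}). infinite K}"
      using K parent(2) unfolding components_eq_branches by auto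
  qed
  then show ?thesis by simp
qed

text \<open>
  A component of \<open>F(0) - {0}\<close> that goes far is an arm through a finite branch, and the infinite branch
  provides the second arm. If the diameter exceeds \<open>t\<close>, some vertex has norm above \<open>t / 2\<close>
  and hence a coordinate of absolute value at least \<open>t / (2 * d)\<close>.
\<close>

lemma two_arms_if_diam:
  assumes t: "0 < t" "t < euclidean_diam (finite_part F)"
  shows "two_arms F 0 (nat \<lceil>t / (2 * real CARD('d))\<rceil>)"
proof -
  define m where "m = nat \<lceil>t / (2 * real CARD('d))\<rceil>"
  let ?emb = "\<lambda>x. (\<chi> i. real_of_int (x $ i)) :: real ^ 'd"
  have m: "m > 0" using t by (simp add: m_def)
  have "\<exists>w\<in>finite_part F. t / 2 < norm (?emb w)"
  proof (rule ccontr)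
    assume "\<not> ?thesis"
    then have small: "norm (?emb w) \<le> t / 2" if "w \<in> finite_part F" for w using that by force
    have "diameter (?emb ` finite_part F) \<le> t"
    proof (rule diameter_le)
      fix a b assume "a \<in> ?emb ` finite_part F" "b \<in> ?emb ` finite_part F"
      then have "norm a \<le> t / 2" "norm b \<le> t / 2" using small by auto
      then show "norm (a - b) \<le> t" using norm_triangle_ineq4[of a b] by linarith
    qed (use t in auto)
    then show False using t by (simp add: euclidean_diam_def)
  qed
  then obtain w where w: "w \<in> finite_part F" "t / 2 < norm (?emb w)" by auto
  have "\<exists>i. t / (2 * real CARD('d)) \<le> real_of_int \<bar>w $ i\<bar>"
  proof (rule ccontr)
    assume "\<not> ?thesis"
    then have "(\<Sum>i\<in>UNIV. \<bar>?emb w $ i\<bar>) \<le> (\<Sum>i\<in>(UNIV::'d set). t / (2 * real CARD('d)))"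
      by (intro sum_mono) (auto simp: not_le intro: less_imp_le)
    also have "\<dots> = t / 2" by simp
    finally show False using w(2) norm_le_l1_cart[of "?emb w"] by linarith
  qed
  then obtain i where "t / (2 * real CARD('d)) \<le> real_of_int \<bar>w $ i\<bar>" by auto
  then have "\<lceil>t / (2 * real CARD('d))\<rceil> \<le> \<bar>w $ i\<bar>" by (simp add: ceiling_le_iff)
  then have far: "far 0 m w" unfolding far_def m_def by (intro exI[of _ i]) auto
  have w': "joined F 0 w" "w \<noteq> 0" "finite (branch F 0 w)" using w by (auto simp: finite_part_iff)
  obtain z where z: "{0, z} \<in> F" "w \<in> branch F 0 z" using joined_first[OF w'(1,2)] .
  have "finite (branch F 0 z)" using branch_eq[OF z(2)] w' by simp
  then have "z \<noteq> parent 0" using parent(2) by auto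
  moreover have "arm F 0 m z" by (rule arm_if_far_branch[OF lattice z(1) m z(2) far])
  moreover have "arm F 0 m (parent 0)" by (rule arm_if_infinite_branch[OF lattice parent(1) m parent(2)])
  ultimately show ?thesis unfolding two_arms_def m_def[symmetric] by blast
qed

end

section \<open>Passing to the wired uniform spanning forest\<close>

lemma topspace_edge_sets [simp]: "topspace (edge_set_topology E) = Pow E"
  by (auto simp: edge_set_topology_def topspace_pullback_topology)

lemma openin_edge_member:
  assumes "e \<in> E"
  shows "openin (edge_set_topology E) {F \<in> Pow E. (e \<in> F) = b}"
proof -
  let ?P = "product_topology (\<lambda>_. discrete_topology (UNIV :: bool set)) E"
  have "continuous_map ?P (discrete_topology UNIV) (\<lambda>g. g e)"
    using assms by (rule continuous_map_product_projection)
  then have "openin ?P {g \<in> topspace ?P. g e \<in> {b}}"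
    by (rule openin_continuous_map_preimage) simp
  moreover have "{F \<in> Pow E. (e \<in> F) = b} = (\<lambda>F. \<lambda>e\<in>E. e \<in> F) -` {g \<in> topspace ?P. g e \<in> {b}} \<inter> Pow E"
    using assms by auto
  ultimately show ?thesis unfolding edge_set_topology_def openin_pullback_topology by blast
qed

text \<open>
  Events that depend on finitely many edges are open, and so are their complements; hence their
  indicators are continuous and weak limits preserve their probabilities.
\<close>

lemma openin_cylinder:
  assumes "finite B" "B \<subseteq> E"
  shows "openin (edge_set_topology E) {F \<in> Pow E. P (F \<inter> B)}"
  using assms
proof (induction B arbitrary: P rule: finite_induct)
  case empty
  have "openin (edge_set_topology E) (Pow E)" using openin_topspace[of "edge_set_topology E"] by simp
  then show ?case by (cases "P {}") (auto simp: Pow_def)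
next
  case (insert e B)
  have e: "e \<in> E" using insert.prems by simp
  have ins: "F \<inter> insert e B = (if e \<in> F then insert e (F \<inter> B) else F \<inter> B)" for F by auto
  have split: "{F \<in> Pow E. P (F \<inter> insert e B)} =
    ({F \<in> Pow E. (e \<in> F) = True} \<inter> {F \<in> Pow E. P (insert e (F \<inter> B))})
    \<union> ({F \<in> Pow E. (e \<in> F) = False} \<inter> {F \<in> Pow E. P (F \<inter> B)})"
    unfolding ins by auto
  show ?case
    unfolding split using insert.prems
    by (intro openin_Un openin_Int openin_edge_member[OF e] insert.IH[of "\<lambda>Q. P (insert e Q)"] insert.IH[of P]) auto
qed

lemma space_borel_sets_of: "space (borel_sets_of X) = topspace X"
  unfolding borel_sets_of_def by (rule space_measure_of) (auto dest: openin_subset)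

lemma open_in_borel_sets_of: "openin X U \<Longrightarrow> U \<in> sets (borel_sets_of X)"
  unfolding borel_sets_of_def by (subst sets_measure_of) (auto dest: openin_subset)

lemma integral_ust_cylinder:
  assumes B: "finite B" "B \<subseteq> E" and H: "edges H \<subseteq> E" "finite (edges H)"
  shows "integral\<^sup>L (ust E H) (indicator {F. P (F \<inter> B)})
    = real (card {T \<in> spanning_trees H. P (T \<inter> B)}) / real (card (spanning_trees H))"
proof -
  let ?X = "borel_sets_of (edge_set_topology E)" and ?S = "spanning_trees H"
  have S: "?S \<subseteq> Pow E" "finite ?S"
    using H by (auto simp: spanning_trees_def intro: finite_subset[of _ "Pow (edges H)"])
  have id: "(\<lambda>T. T) \<in> measurable (uniform_count_measure ?S) ?X"
    using S by (auto simp: measurable_def space_uniform_count_measure sets_uniform_count_measure space_borel_sets_of)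
  have "{F. P (F \<inter> B)} \<inter> space ?X = {F \<in> Pow E. P (F \<inter> B)}"
    by (auto simp: space_borel_sets_of)
  then have ind: "(indicator {F. P (F \<inter> B)} :: _ \<Rightarrow> real) \<in> borel_measurable ?X"
    unfolding borel_measurable_indicator_iff
    using open_in_borel_sets_of[OF openin_cylinder[OF B]] by simp
  have "integral\<^sup>L (ust E H) (indicator {F. P (F \<inter> B)})
    = integral\<^sup>L (uniform_count_measure ?S) (indicator {F. P (F \<inter> B)} :: _ \<Rightarrow> real)"
    unfolding ust_def by (rule integral_distr[OF id]) (use ind in simp)
  also have "\<dots> = measure (uniform_count_measure ?S) ({F. P (F \<inter> B)} \<inter> ?S)"
    by (simp add: space_uniform_count_measure)
  also have "{F. P (F \<inter> B)} \<inter> ?S = {T \<in> ?S. P (T \<inter> B)}" by auto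
  also have "measure (uniform_count_measure ?S) {T \<in> ?S. P (T \<inter> B)}
    = real (card {T \<in> ?S. P (T \<inter> B)}) / real (card ?S)"
    using S by (intro measure_uniform_count_measure) auto
  finally show ?thesis .
qed

lemma continuous_cylinder:
  assumes "finite B" "B \<subseteq> E"
  shows "continuous_map (edge_set_topology E) euclideanreal (indicator {F. P (F \<inter> B)})"
  unfolding continuous_map_def
proof (intro conjI allI impI)
  fix U :: "real set" assume "openin euclideanreal U"
  have "{F \<in> topspace (edge_set_topology E). indicator {F. P (F \<inter> B)} F \<in> U}
    = {F \<in> Pow E. (\<lambda>Q. of_bool (P Q) \<in> U) (F \<inter> B)}"
    by (auto simp: indicator_def of_bool_def)
  then show "openin (edge_set_topology E) {F \<in> topspace (edge_set_topology E). indicator {F. P (F \<inter> B)} F \<in> U}"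
    using openin_cylinder[OF assms, of "\<lambda>Q. of_bool (P Q) \<in> U"] by simp
qed simp

lemma exhaustion_eventually:
  assumes ex: "exhaustion G Gs" and K: "finite K" "K \<subseteq> verts G"
  shows "eventually (\<lambda>n. K \<subseteq> verts (Gs n)) sequentially"
proof -
  have mono: "verts (Gs m) \<subseteq> verts (Gs n)" if "m \<le> n" for m n
    using that by (rule lift_Suc_mono_le[of "\<lambda>n. verts (Gs n)", rotated])
      (use ex in \<open>auto simp: exhaustion_def subgraph_def\<close>)
  have un: "(\<Union>n. verts (Gs n)) = verts G" using ex by (simp add: exhaustion_def)
  have "\<exists>n. v \<in> verts (Gs n)" if "v \<in> K" for v
  proof -
    have "v \<in> (\<Union>n. verts (Gs n))" unfolding un using that K(2) by (rule subsetD[rotated])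
    then show ?thesis by simp
  qed
  then obtain f where f: "\<And>v. v \<in> K \<Longrightarrow> v \<in> verts (Gs (f v))" by metis
  have "K \<subseteq> verts (Gs n)" if n: "Max (insert 0 (f ` K)) \<le> n" for n
  proof
    fix v assume v: "v \<in> K"
    have "f v \<le> Max (insert 0 (f ` K))" using K v by (intro Max_ge) auto
    then show "v \<in> verts (Gs n)" using mono[of "f v" n] f[OF v] n by auto
  qed
  then show ?thesis by (auto simp: eventually_sequentially)
qed

locale lattice_wsf =
  fixes W :: "(int ^ 'd::finite) set set measure"
  assumes wsf: "is_wsf int_lattice W" and dim: "CARD('d) > 2"
begin

sublocale prob_space W using wsf by (simp add: is_wsf_def)

abbreviation "EL \<equiv> edges (int_lattice :: (int ^ 'd, (int ^ 'd) set) multigraph)"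

lemma sets_W: "sets W = sets (borel_sets_of (edge_set_topology EL))"
  using wsf by (simp add: is_wsf_def)

lemma space_W: "space W = Pow EL"
  using sets_eq_imp_space_eq[OF sets_W] by (simp add: space_borel_sets_of)

lemma cylinder_sets:
  assumes "finite B" "B \<subseteq> EL" shows "{F \<in> space W. P (F \<inter> B)} \<in> sets W"
  unfolding sets_W space_W by (rule open_in_borel_sets_of[OF openin_cylinder[OF assms]])

text \<open>
  Bounds on the uniform spanning trees of all large wired graphs pass to the limit, because the
  sets of an exhaustion eventually contain any given finite set.
\<close>

lemma cylinder_le:
  assumes B: "finite B" "B \<subseteq> EL" and Kmin: "finite Kmin" and c: "0 \<le> c"
    and bound: "\<And>K. finite K \<Longrightarrow> Kmin \<subseteq> K \<Longrightarrow>
      real (card {T \<in> spanning_trees (wired int_lattice K). P (T \<inter> B)})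
        \<le> c * real (card (spanning_trees (wired int_lattice K)))"
  shows "measure W {F \<in> space W. P (F \<inter> B)} \<le> c"
proof -
  obtain Gs where ex: "exhaustion int_lattice Gs"
    and conv: "weakly_converges (edge_set_topology EL) (\<lambda>n. ust EL (wired int_lattice (verts (Gs n)))) W"
    using wsf unfolding is_wsf_def by blast
  let ?f = "indicator {F. P (F \<inter> B)} :: (int ^ 'd) set set \<Rightarrow> real"
  have "bounded (?f ` topspace (edge_set_topology EL))"
    by (rule bounded_subset[of "{0, 1}"]) (auto simp: indicator_def)
  then have lim: "(\<lambda>n. integral\<^sup>L (ust EL (wired int_lattice (verts (Gs n)))) ?f) \<longlonglongrightarrow> integral\<^sup>L W ?f"
    using conv continuous_cylinder[OF B, of P] unfolding weakly_converges_def by blast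
  have fin: "finite (verts (Gs n))" for n using ex by (simp add: exhaustion_def)
  have "eventually (\<lambda>n. Kmin \<subseteq> verts (Gs n)) sequentially"
    using Kmin by (intro exhaustion_eventually[OF ex]) auto
  then have "eventually (\<lambda>n. integral\<^sup>L (ust EL (wired int_lattice (verts (Gs n)))) ?f \<le> c) sequentially"
  proof eventually_elim
    case (elim n)
    let ?H = "wired int_lattice (verts (Gs n))"
    have "edges ?H \<subseteq> EL" by (auto simp: wired_simps)
    then have "integral\<^sup>L (ust EL ?H) ?f = real (card {T \<in> spanning_trees ?H. P (T \<inter> B)}) / real (card (spanning_trees ?H))"
      by (intro integral_ust_cylinder B finite_wired_edges fin)
    also have "\<dots> \<le> c"
      using bound[OF fin elim] c by (cases "card (spanning_trees ?H) = 0") (auto simp: divide_le_eq)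
    finally show ?case .
  qed
  then have "integral\<^sup>L W ?f \<le> c" using lim by (intro tendsto_upperbound) auto
  moreover have "integral\<^sup>L W ?f = measure W {F \<in> space W. P (F \<inter> B)}"
    by (simp add: Collect_conj_eq Int_commute)
  ultimately show ?thesis by simp
qed

text \<open>
  A spanning tree of a wired graph connects every finite set to the vertex at infinity.
\<close>

lemma AE_escape:
  assumes U: "finite U" "U \<noteq> {}"
  shows "AE F in W. \<exists>e\<in>F. e \<inter> U \<noteq> {} \<and> \<not> e \<subseteq> U"
proof -
  define B where "B = {e \<in> EL. e \<inter> U \<noteq> {} \<and> \<not> e \<subseteq> U}"
  have B: "finite B" "B \<subseteq> EL"
  proof -
    have "B \<subseteq> (\<Union>x\<in>U. star x)" by (auto simp: B_def star_def)
    moreover have "finite (\<Union>x\<in>U. star x)" using U star_card by auto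
    ultimately show "finite B" by (rule finite_subset)
  qed (auto simp: B_def)
  have "measure W {F \<in> space W. F \<inter> B = {}} \<le> 0"
  proof (rule cylinder_le[OF B U(1)])
    fix K assume K: "finite K" "U \<subseteq> K"
    let ?H = "wired int_lattice K"
    have "T \<inter> B \<noteq> {}" if T: "T \<in> spanning_trees ?H" for T
    proof
      assume TB: "T \<inter> B = {}"
      obtain u where u: "u \<in> U" using U by auto
      have TE: "T \<subseteq> edges ?H" using T by (simp add: spanning_trees_def)
      have "Some u \<in> verts ?H" "None \<in> verts ?H" using u K by (auto simp: wired_simps)
      then have "linked (endpoints ?H) T (Some u) None"
        using T by (auto simp: spanning_trees_def connected_graph_def reachable_eq_linked)
      then have "None \<in> Some ` U"
      proof (induction rule: linked_induct)
        case (step y z e)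
        then obtain b where b: "y = Some b" "b \<in> U" by auto
        have be: "b \<in> e" using step.hyps(3) b by (auto simp: wired_simps glue_Some dest!: equalityD2)
        have "e \<in> EL" using step.hyps(2) TE by (auto simp: wired_simps)
        then have eU: "e \<subseteq> U" using TB step.hyps(2) be b by (auto simp: B_def)
        have "z \<in> glue K ` e" using step.hyps(3) by (auto simp: wired_simps)
        then show ?case using eU K by (auto simp: glue_def split: if_splits)
      qed (use u in auto)
      then show False by auto
    qed
    then have none: "{T \<in> spanning_trees ?H. T \<inter> B = {}} = {}" by auto
    show "real (card {T \<in> spanning_trees ?H. T \<inter> B = {}}) \<le> 0 * real (card (spanning_trees ?H))"
      unfolding none by simp
  qed simp
  then have "{F \<in> space W. F \<inter> B = {}} \<in> null_sets W"
    using cylinder_sets[OF B, of "\<lambda>Q. Q = {}"] measure_le_0_iff by (auto simp: null_sets_def emeasure_eq_measure)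
  moreover have "{F \<in> space W. \<not> (\<exists>e\<in>F. e \<inter> U \<noteq> {} \<and> \<not> e \<subseteq> U)} \<subseteq> {F \<in> space W. F \<inter> B = {}}"
    by (auto simp: B_def)
  ultimately show ?thesis by (rule AE_I')
qed

definition arms_const :: real where
  "arms_const = 4 * real CARD('d) ^ 2 * reach_const (real CARD('d))"

lemma arms_const_nonneg: "0 \<le> arms_const"
  using reach_const_pos[of "real CARD('d)"] dim by (simp add: arms_const_def)

lemma finite_box_edges: "finite (box_edges x m :: (int ^ 'd) set set)"
proof (rule finite_subset)
  let ?K = "{z :: int ^ 'd. \<forall>i. z $ i \<in> {x $ i - int m..x $ i + int m}}"
  show "box_edges x m \<subseteq> Pow ?K"
    by (auto simp: box_edges_def abs_le_iff) (smt (verit))+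
  show "finite (Pow ?K)" by (intro finite_Pow_iff[THEN iffD2] card_vec_Collect) simp
qed

lemma two_arms_sets: "{F \<in> space W. two_arms F x m} \<in> sets W"
proof -
  have "box_edges x m \<subseteq> EL" by (auto simp: box_edges_def)
  from cylinder_sets[OF finite_box_edges this, of "\<lambda>Q. two_arms Q x m"] show ?thesis
    unfolding two_arms_local .
qed

lemma two_arms_le:
  assumes m: "m > 0"
  shows "measure W {F \<in> space W. two_arms F x m} \<le> arms_const * real m powr - beta_exp (real CARD('d))"
proof -
  define K0 where "K0 = {z :: int ^ 'd. \<forall>i. z $ i \<in> {x $ i - int m..x $ i + int m}}"
  have "measure W {F \<in> space W. two_arms (F \<inter> box_edges x m) x m} \<le> arms_const * real m powr - beta_exp (real CARD('d))"
  proof (rule cylinder_le[where Kmin = K0])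
    show "finite K0" unfolding K0_def by (rule card_vec_Collect) simp
    show "0 \<le> arms_const * real m powr - beta_exp (real CARD('d))" using arms_const_nonneg by simp
    fix K assume K: "finite K" "K0 \<subseteq> K"
    have inK: "z \<in> K" if "\<And>i. \<bar>z $ i - x $ i\<bar> \<le> int m" for z
    proof -
      have "z $ i \<in> {x $ i - int m..x $ i + int m}" for i using that[of i] by auto
      then show ?thesis using K unfolding K0_def by auto
    qed
    show "real (card {T \<in> spanning_trees (wired int_lattice K). two_arms (T \<inter> box_edges x m) x m})
      \<le> arms_const * real m powr - beta_exp (real CARD('d)) * real (card (spanning_trees (wired int_lattice K)))"
      unfolding two_arms_local arms_const_def by (rule two_arms_count[OF dim K(1) m]) (rule inK)
  qed (auto simp: finite_box_edges, auto simp: box_edges_def)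
  then show ?thesis by (simp only: two_arms_local)
qed

lemma beta_pos: "0 < beta_exp (real CARD('d))"
  using dim by (simp add: beta_exp_def field_simps)

lemma AE_one_arm: "AE F in W. \<exists>m>0. \<not> two_arms F x m"
proof -
  let ?b = "beta_exp (real CARD('d))"
  define N where "N = {F \<in> space W. \<forall>m>0. two_arms F x m}"
  have N: "N = (\<Inter>m\<in>{0<..}. {F \<in> space W. two_arms F x m})" by (auto simp: N_def)
  have Ns: "N \<in> sets W" unfolding N by (rule sets.countable_INT) (use two_arms_sets in auto)
  have le: "measure W N \<le> arms_const * real (Suc n) powr - ?b" for n
  proof -
    have "measure W N \<le> measure W {F \<in> space W. two_arms F x (Suc n)}"
      by (intro finite_measure_mono two_arms_sets) (auto simp: N_def)
    also have "\<dots> \<le> arms_const * real (Suc n) powr - ?b" by (rule two_arms_le) simp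
    finally show ?thesis .
  qed
  have "(\<lambda>n. arms_const * real (Suc n) powr - ?b) \<longlonglongrightarrow> arms_const * 0"
  proof (rule tendsto_mult_left)
    have "(\<lambda>n. real n powr - ?b) \<longlonglongrightarrow> 0"
      using beta_pos by (intro tendsto_neg_powr filterlim_real_sequentially) auto
    then show "(\<lambda>n. real (Suc n) powr - ?b) \<longlonglongrightarrow> 0" by (rule LIMSEQ_Suc)
  qed
  then have "measure W N \<le> arms_const * 0" by (rule LIMSEQ_le_const) (use le in blast)
  then have "N \<in> null_sets W" using Ns measure_le_0_iff by (auto simp: null_sets_def emeasure_eq_measure)
  moreover have "{F \<in> space W. \<not> (\<exists>m>0. \<not> two_arms F x m)} \<subseteq> N" unfolding N_def by blast
  ultimately show ?thesis by (rule AE_I')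
qed

lemma AE_one_arm_forest: "AE F in W. one_arm_forest F"
proof -
  have "AE F in W. \<forall>xs. xs \<noteq> [] \<longrightarrow> (\<exists>e\<in>F. e \<inter> set xs \<noteq> {} \<and> \<not> e \<subseteq> set xs)"
    unfolding AE_all_countable using AE_escape by (auto simp: AE_conj_iff)
  moreover have "AE F in W. \<forall>x. \<exists>m>0. \<not> two_arms F x m"
    unfolding AE_all_countable using AE_one_arm by auto
  moreover have "AE F in W. F \<subseteq> EL" using space_W by (intro AE_I2) auto
  ultimately show ?thesis
  proof eventually_elim
    case (elim F)
    show ?case
    proof
      fix U :: "(int ^ 'd) set" assume "finite U" "U \<noteq> {}"
      then obtain xs where "U = set xs" "xs \<noteq> []" using finite_list by (metis set_empty)
      then show "\<exists>e\<in>F. e \<inter> U \<noteq> {} \<and> \<not> e \<subseteq> U" using elim(1) by blast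
    qed (use elim in auto)
  qed
qed

lemma countable_EL: "countable EL"
proof (rule countable_subset)
  show "EL \<subseteq> range (\<lambda>(a, b). {a, b})" by (auto simp: int_lattice_def)
qed simp

text \<open>
  Connection is witnessed by finite sets of edges, of which there are countably many.
\<close>

lemma joined_sets: "{F \<in> space W. joined (F \<inter> S) a b} \<in> sets W"
proof -
  define \<D> where "\<D> = {D. finite D \<and> D \<subseteq> EL \<and> D \<subseteq> S \<and> joined D a b}"
  have "{F \<in> space W. joined (F \<inter> S) a b} = (\<Union>D\<in>\<D>. {F \<in> space W. F \<inter> D = D})"
  proof (intro equalityI subsetI)
    fix F assume F: "F \<in> {F \<in> space W. joined (F \<inter> S) a b}"
    then have "joined (F \<inter> S) a b" by simp
    from linked_finite[OF this] obtain D where D: "D \<subseteq> F \<inter> S" "finite D" "joined D a b" by auto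
    then have "D \<in> \<D>" using F by (auto simp: \<D>_def space_W)
    then show "F \<in> (\<Union>D\<in>\<D>. {F \<in> space W. F \<inter> D = D})" using F D by auto
  next
    fix F assume "F \<in> (\<Union>D\<in>\<D>. {F \<in> space W. F \<inter> D = D})"
    then obtain D where D: "D \<in> \<D>" "F \<in> space W" "F \<inter> D = D" by auto
    have DS: "joined D a b" "D \<subseteq> S" using D(1) by (simp_all add: \<D>_def)
    have "D \<subseteq> F \<inter> S" using D(3) DS(2) by blast
    with DS(1) have "joined (F \<inter> S) a b" by (rule linked_mono)
    then show "F \<in> {F \<in> space W. joined (F \<inter> S) a b}" using D by simp
  qed
  moreover have "countable \<D>"
    by (rule countable_subset[OF _ countable_Collect_finite_subset[OF countable_EL]]) (auto simp: \<D>_def)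
  moreover have "{F \<in> space W. F \<inter> D = D} \<in> sets W" if "D \<in> \<D>" for D
    using cylinder_sets[of D "\<lambda>Q. Q = D"] that by (simp add: \<D>_def)
  ultimately show ?thesis by (simp only:) (rule sets.countable_UN'', auto)
qed

text \<open>
  The finite part is a random finite set of lattice points. Quantifying over lists instead of finite
  sets keeps the quantifiers countable.
\<close>

lemma diam_sets: "{F \<in> space W. t < euclidean_diam (finite_part F)} \<in> sets W"
proof -
  have away_eq: "away F 0 = F \<inter> {e. 0 \<notin> e}" for F :: "(int ^ 'd) set set" by (auto simp: away_def)
  have [measurable]: "Measurable.pred W (\<lambda>F. joined F a b)" for a b
    using joined_sets[of UNIV a b] by (simp add: pred_def)
  have [measurable]: "Measurable.pred W (\<lambda>F. joined (away F 0) a b)" for a b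
    using joined_sets[of "{e. 0 \<notin> e}" a b] by (simp add: pred_def away_eq)
  have fp: "w \<in> finite_part F \<longleftrightarrow> joined F 0 w \<and> w \<noteq> 0 \<and> (\<exists>xs. \<forall>z. joined (away F 0) w z \<longrightarrow> z \<in> set xs)"
    for w and F :: "(int ^ 'd) set set"
  proof -
    have "finite (branch F 0 w) \<longleftrightarrow> (\<exists>xs. branch F 0 w \<subseteq> set xs)"
      by (metis List.finite_set finite_list finite_subset order_refl)
    then show ?thesis unfolding finite_part_iff by (auto simp: branch_def)
  qed
  have [measurable]: "Measurable.pred W (\<lambda>F. w \<in> finite_part F)" for w
    unfolding fp by measurable
  have "{F \<in> space W. t < euclidean_diam (finite_part F)}
    = {F \<in> space W. \<exists>xs. t < euclidean_diam (set xs) \<and> (\<forall>w. w \<in> finite_part F \<longleftrightarrow> w \<in> set xs)}"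
  proof (intro Collect_cong conj_cong refl)
    fix F assume "F \<in> space W"
    then have "finite (finite_part F)" using finite_finite_part space_W by auto
    then obtain ys where ys: "set ys = finite_part F" using finite_list by blast
    show "t < euclidean_diam (finite_part F) \<longleftrightarrow>
      (\<exists>xs. t < euclidean_diam (set xs) \<and> (\<forall>w. w \<in> finite_part F \<longleftrightarrow> w \<in> set xs))"
    proof
      assume "t < euclidean_diam (finite_part F)"
      then show "\<exists>xs. t < euclidean_diam (set xs) \<and> (\<forall>w. w \<in> finite_part F \<longleftrightarrow> w \<in> set xs)"
        using ys by (intro exI[of _ ys]) auto
    next
      assume "\<exists>xs. t < euclidean_diam (set xs) \<and> (\<forall>w. w \<in> finite_part F \<longleftrightarrow> w \<in> set xs)"
      then obtain xs where "t < euclidean_diam (set xs)" "finite_part F = set xs" by blast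
      then show "t < euclidean_diam (finite_part F)" by simp
    qed
  qed
  also have "\<dots> \<in> sets W" by measurable
  finally show ?thesis .
qed

lemma diam_le:
  assumes t: "t > 0"
  shows "measure W {F \<in> space W. t < euclidean_diam (finite_part F)}
    \<le> arms_const * (2 * real CARD('d)) powr beta_exp (real CARD('d)) * t powr - beta_exp (real CARD('d))"
proof -
  let ?b = "beta_exp (real CARD('d))" and ?D = "2 * real CARD('d)"
  define m where "m = nat \<lceil>t / ?D\<rceil>"
  have m: "m > 0" using t by (simp add: m_def)
  have tm: "t / ?D \<le> real m" unfolding m_def by (rule real_nat_ceiling_ge)
  have "measure W {F \<in> space W. t < euclidean_diam (finite_part F)} \<le> measure W {F \<in> space W. two_arms F 0 m}"
  proof (rule finite_measure_mono_AE[OF _ two_arms_sets])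
    show "AE F in W. F \<in> {F \<in> space W. t < euclidean_diam (finite_part F)} \<longrightarrow> F \<in> {F \<in> space W. two_arms F 0 m}"
      using AE_one_arm_forest
    proof eventually_elim
      case (elim F)
      then show ?case using one_arm_forest.two_arms_if_diam[of F t] t by (auto simp: m_def)
    qed
  qed
  also have "\<dots> \<le> arms_const * real m powr - ?b" by (rule two_arms_le[OF m])
  also have "\<dots> \<le> arms_const * (t / ?D) powr - ?b"
    using t tm beta_pos by (intro mult_left_mono powr_mono2' arms_const_nonneg) auto
  also have "\<dots> = arms_const * ?D powr ?b * t powr - ?b"
    using t by (simp add: powr_divide powr_minus field_simps)
  finally show ?thesis .
qed

end

theorem theorem4p1:
  assumes "CARD('d::finite) > 2"
  shows "\<exists>C::real. \<forall>W. is_wsf (int_lattice :: (int ^ 'd, (int ^ 'd) set) multigraph) W \<longrightarrow>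
           (AE F in W. card (tree_ends (tree_at_0 F)) = 1) \<and>
           (AE F in W. card {K \<in> components_verts (remove_verts (tree_at_0 F) {0}). infinite K} = 1) \<and>
           (\<forall>t>0. {F \<in> space W. euclidean_diam (finite_part F) > t} \<in> sets W \<and>
                  measure W {F \<in> space W. euclidean_diam (finite_part F) > t}
                    \<le> C * t powr - (1/2 - 1 / real CARD('d)))"
proof (intro exI allI impI)
  fix W :: "(int ^ 'd) set set measure"
  assume wsf: "is_wsf int_lattice W"
  interpret lattice_wsf W by unfold_locales (use wsf assms in auto)
  have "AE F in W. card (tree_ends (tree_at_0 F)) = 1"
    using AE_one_arm_forest by eventually_elim (rule one_arm_forest.one_end)
  moreover have "AE F in W. card {K \<in> components_verts (remove_verts (tree_at_0 F) {0}). infinite K} = 1"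
    using AE_one_arm_forest by eventually_elim (rule one_arm_forest.one_infinite_component)
  ultimately show "(AE F in W. card (tree_ends (tree_at_0 F)) = 1) \<and>
      (AE F in W. card {K \<in> components_verts (remove_verts (tree_at_0 F) {0}). infinite K} = 1) \<and>
      (\<forall>t>0. {F \<in> space W. euclidean_diam (finite_part F) > t} \<in> sets W \<and>
         measure W {F \<in> space W. euclidean_diam (finite_part F) > t}
           \<le> (4 * real CARD('d) ^ 2 * reach_const (real CARD('d))) * (2 * real CARD('d)) powr (1/2 - 1 / real CARD('d))
             * t powr - (1/2 - 1 / real CARD('d)))"
    using diam_sets diam_le unfolding arms_const_def beta_exp_def by blast
qed

end
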